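(* Let $p>0$, let $\Sigma$ be a compact metric space with a Borel probability measure $\mu$, and let $A\in\mathscr{C}_p(\Omega,\mathrm{SL}_m(\mathbb{R}))$ be such that (1) $A$ is quasi-irreducible, and (2) $L_1(A)>L_2(A)$. Then the function $\mathscr{C}_p(\Omega,\mathrm{SL}_m(\mathbb{R}))\ni B\mapsto L_1(B)$ is Hölder continuous in a small neighborhood of $A$ with respect to the $L^1$-distance $d(A,B)=\int_\Omega\|A-B\|\,d\mathbb{P}_\mu$.
   Context: $\Omega=\Sigma^{\mathbb{Z}}$ carries the Bernoulli measure $\mathbb{P}_\mu=\mu^{\mathbb{Z}}$ and the shift $\sigma$. A (measurable) function $A:\Omega\to\mathrm{SL}_m(\mathbb{R})$ is locally constant if $A(\omega)=A(\omega_0)$ depends only on the $0$-th coordinate. $\mathscr{C}_p(\Omega,\mathrm{SL}_m(\mathbb{R}))$ is the space of locally constant functions with $\int_\Omega\|A(\omega)\|^p\,d\mathbb{P}_\mu(\omega)<\infty$. The function $A$ determines the linear cocycle $F_A(\omega,v)=(\sigma\omega,A(\omega)v)$ on $\Omega\times\mathbb{R}^m$, with iterates $A^n(\omega)=A(\sigma^{n-1}\omega)\cdots A(\omega)$. $L_1(A)$ and $L_2(A)$ are the $\mathbb{P}_\mu$-almost sure limits of $\frac1n\log\|A^n(\omega)\|$ and $\frac1n\log s_2(A^n(\omega))$, with $s_2$ the second largest singular value; they coincide with the exponents of the random cocycle determined by the push-forward measure $A_*\mathbb{P}_\mu$ on $\mathrm{SL}_m(\mathbb{R})$. $A$ is quasi-irreducible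 if for every proper nonzero linear subspace $E\subset\mathbb{R}^m$ such that $gE\subseteq E$ for $A_*\mathbb{P}_\mu$-almost every $g$, the cocycle induced on $E$ has first Lyapunov exponent equal to $L_1(A)$, i.e. $\lim_n\frac1n\log\|A^n(\omega)|_E\|=L_1(A)$ for $\mathbb{P}_\mu$-a.e. $\omega$. *)

theory Defs
  imports "HOL-Probability.Probability" "HOL-Library.Multiset"
begin

text \<open>
  The alphabet \<open>\<Sigma>\<close> is the type \<open>'s\<close>; \<open>\<Omega> = \<Sigma>\<^sup>\<int>\<close> is the type \<open>int \<Rightarrow> 's\<close>. Matrices are measured by
  the Euclidean operator norm, not by the (Frobenius) \<open>norm\<close> of the type \<open>real ^ 'm ^ 'm\<close>.
\<close>

definition bernoulli_measure :: "'s measure \<Rightarrow> (int \<Rightarrow> 's) measure" where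
  "bernoulli_measure \<mu> = (\<Pi>\<^sub>M i\<in>UNIV. \<mu>)"

definition shift :: "(int \<Rightarrow> 's) \<Rightarrow> (int \<Rightarrow> 's)" where
  "shift \<omega> = (\<lambda>i. \<omega> (i + 1))"

definition opnorm :: "real ^ 'm ^ 'm \<Rightarrow> real" where
  "opnorm g = onorm (\<lambda>v. g *v v)"

definition opnorm_on :: "(real ^ 'm) set \<Rightarrow> real ^ 'm ^ 'm \<Rightarrow> real" where
  "opnorm_on E g = (SUP v \<in> {v \<in> E. norm v = 1}. norm (g *v v))"

definition SL :: "(real ^ 'm ^ 'm) set" where
  "SL = {g. det g = 1}"

text \<open>
  The singular values of \<open>g\<close>, that is, the square roots of the eigenvalues of \<open>g\<^sup>T g\<close>, listed in
  descending order and repeated according to multiplicity. As \<open>g\<^sup>T g\<close> is symmetric, the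
  multiplicity of an eigenvalue is the dimension of its eigenspace.
\<close>
definition gram_eigenspace :: "real ^ 'm ^ 'm \<Rightarrow> real \<Rightarrow> (real ^ 'm) set" where
  "gram_eigenspace g s = {v. (transpose g ** g) *v v = s\<^sup>2 *\<^sub>R v}"

definition singular_values :: "real ^ 'm ^ 'm \<Rightarrow> real list" where
  "singular_values g = rev (sorted_list_of_multiset
     (\<Sum>s \<in> {s. 0 \<le> s \<and> (\<exists>v. v \<noteq> 0 \<and> v \<in> gram_eigenspace g s)}.
        replicate_mset (dim (gram_eigenspace g s)) s))"

definition second_singular_value :: "real ^ 'm ^ 'm \<Rightarrow> real" where
  "second_singular_value g = singular_values g ! 1"

definition locally_constant :: "((int \<Rightarrow> 's) \<Rightarrow> 'b) \<Rightarrow> bool" where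
  "locally_constant A \<longleftrightarrow> (\<forall>\<omega> \<omega>'. \<omega> 0 = \<omega>' 0 \<longrightarrow> A \<omega> = A \<omega>')"

definition Cp_space :: "real \<Rightarrow> 's measure \<Rightarrow> ((int \<Rightarrow> 's) \<Rightarrow> real ^ 'm ^ 'm) set" where
  "Cp_space p \<mu> = {A. A \<in> borel_measurable (bernoulli_measure \<mu>) \<and> range A \<subseteq> SL \<and>
     locally_constant A \<and>
     (\<integral>\<^sup>+ \<omega>. ennreal (opnorm (A \<omega>) powr p) \<partial>bernoulli_measure \<mu>) < \<infinity>}"

text \<open>
  The distance takes values in \<open>[0, \<infinity>]\<close>: for \<open>p < 1\<close> it may be infinite on \<open>Cp_space p \<mu>\<close>.
\<close>
definition L1_dist ::
  "'s measure \<Rightarrow> ((int \<Rightarrow> 's) \<Rightarrow> real ^ 'm ^ 'm) \<Rightarrow> ((int \<Rightarrow> 's) \<Rightarrow> real ^ 'm ^ 'm) \<Rightarrow> ennreal" where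
  "L1_dist \<mu> A B = (\<integral>\<^sup>+ \<omega>. ennreal (opnorm (A \<omega> - B \<omega>)) \<partial>bernoulli_measure \<mu>)"

primrec cocycle_iter :: "((int \<Rightarrow> 's) \<Rightarrow> real ^ 'm ^ 'm) \<Rightarrow> nat \<Rightarrow> (int \<Rightarrow> 's) \<Rightarrow> real ^ 'm ^ 'm" where
  "cocycle_iter A 0 \<omega> = mat 1"
| "cocycle_iter A (Suc n) \<omega> = A ((shift ^^ n) \<omega>) ** cocycle_iter A n \<omega>"

text \<open>
  For \<open>A \<in> Cp_space p \<mu>\<close> with \<open>p > 0\<close> and \<open>\<mu>\<close> a probability measure, both almost sure limits
  exist, are constant and finite (Furstenberg-Kesten), so that the descriptions below denote.
\<close>
definition lyapunov1 :: "'s measure \<Rightarrow> ((int \<Rightarrow> 's) \<Rightarrow> real ^ 'm ^ 'm) \<Rightarrow> real" where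
  "lyapunov1 \<mu> A = (THE l. AE \<omega> in bernoulli_measure \<mu>.
     (\<lambda>n. 1 / real n * ln (opnorm (cocycle_iter A n \<omega>))) \<longlonglongrightarrow> l)"

definition lyapunov2 :: "'s measure \<Rightarrow> ((int \<Rightarrow> 's) \<Rightarrow> real ^ 'm ^ 'm) \<Rightarrow> real" where
  "lyapunov2 \<mu> A = (THE l. AE \<omega> in bernoulli_measure \<mu>.
     (\<lambda>n. 1 / real n * ln (second_singular_value (cocycle_iter A n \<omega>))) \<longlonglongrightarrow> l)"

definition quasi_irreducible :: "'s measure \<Rightarrow> ((int \<Rightarrow> 's) \<Rightarrow> real ^ 'm ^ 'm) \<Rightarrow> bool" where
  "quasi_irreducible \<mu> A \<longleftrightarrow>
     (\<forall>E. subspace E \<and> E \<noteq> {0} \<and> E \<noteq> UNIV \<and>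
          (AE g in distr (bernoulli_measure \<mu>) borel A. (\<lambda>v. g *v v) ` E \<subseteq> E) \<longrightarrow>
          (AE \<omega> in bernoulli_measure \<mu>.
             (\<lambda>n. 1 / real n * ln (opnorm_on E (cocycle_iter A n \<omega>))) \<longlonglongrightarrow> lyapunov1 \<mu> A))"

end

theory Submission
  imports Defs
begin

text \<open>
  Let \<open>a s\<close> be the matrix attached to the letter \<open>s\<close>, and let \<open>A n\<close> be the product of the first \<open>n\<close>
  matrices along a random sequence of letters. The proof shows that directions contract on average
  under the cocycles near \<open>A\<close>, and reads off the regularity of the exponent from this contraction.

  Areas of parallelograms are multiplied by at most \<open>area_norm (A n)\<close>, the product of the two largest
  singular values (\<open>area_norm_eq_singular_values\<close>), which grows at the rate \<open>L1 + L2 < 2 L1\<close>. If every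
  vector grows on average at a rate close to \<open>L1\<close>, uniformly in its direction, then the sine of an angle,
  an area divided by two lengths, decreases exponentially on average. A second-order expansion turns
  this into \<open>E (d (A n x, A n y))^\<theta> \<le> \<rho> (d (x, y))^\<theta>\<close> for some fixed \<open>n\<close>, a small \<open>\<theta> > 0\<close> and \<open>\<rho> < 1\<close>
  (\<open>contraction_of_mean_angle_rate\<close>). Only the expectation of a logarithm at the fixed time \<open>n\<close> and a
  bound on moments enter, both of which are stable in the \<open>L\<^sup>1\<close>-distance, so the
  same \<open>n\<close>, \<open>\<theta>\<close> and \<open>\<rho>\<close> work for all cocycles near \<open>A\<close> (\<open>contracting_cocycle_near\<close>).

  Given the contraction, the expected logarithmic growth of a vector over \<open>n\<close> steps is a Hoelder function
  of its direction, with a constant that does not depend on \<open>n\<close>, because the powers of the angles along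
  two orbits are summable on average. Exchanging the letters of one cocycle for those of another one at
  a time then changes the expected growth by at most \<open>n C d^\<theta>\<close> (\<open>gain_compare\<close>), and
  dividing by \<open>n\<close> gives the theorem.

  The uniform growth of vectors is where quasi-irreducibility enters. The vectors that grow at a rate
  below \<open>L1\<close> along a given sequence form a subspace. If a vector belonged to this random subspace
  with positive probability, then by a zero-one law and compactness some vector would belong to it almost
  surely (\<open>ex_almost_surely_slow\<close>); all such vectors form an invariant subspace on which the cocycle grows
  too slowly, which quasi-irreducibility excludes. So each vector almost surely reaches
  growth close to \<open>L1\<close> at some time, and cutting orbits at such times gives the bound on expectations
  (\<open>uniform_growth\<close>). The same cutting argument (\<open>integral_le_of_often_small\<close>), due to Katznelson and
  Weiss, also yields the lower half of the Furstenberg-Kesten theorem, while the upper half follows from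
  Chernoff's bound (\<open>ratio_tendsto_rate\<close>). This theorem shows that the exponents, which are
  defined as the almost sure limits, exist and are the limits of the expectations.
\<close>

section \<open>Operator norm, areas and the second singular value\<close>

lemma norm_mult_le_opnorm: "norm (g *v x) \<le> opnorm g * norm x"
  unfolding opnorm_def by (rule onorm) (rule matrix_vector_mul_bounded_linear)

lemma opnorm_nonneg: "0 \<le> opnorm g"
  unfolding opnorm_def by (rule onorm_pos_le) (rule matrix_vector_mul_bounded_linear)

lemma opnorm_leI: "(\<And>x. norm (g *v x) \<le> c * norm x) \<Longrightarrow> opnorm g \<le> c"
  unfolding opnorm_def by (rule onorm_le)

lemma opnorm_mult_le: "opnorm (g ** h) \<le> opnorm g * opnorm h"
proof (rule opnorm_leI)
  fix x
  have "norm ((g ** h) *v x) \<le> opnorm g * norm (h *v x)"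
    by (metis matrix_vector_mul_assoc norm_mult_le_opnorm)
  also have "\<dots> \<le> opnorm g * (opnorm h * norm x)"
    by (intro mult_left_mono norm_mult_le_opnorm opnorm_nonneg)
  finally show "norm ((g ** h) *v x) \<le> opnorm g * opnorm h * norm x" by (simp add: mult.assoc)
qed

lemma opnorm_triangle: "opnorm (g + h) \<le> opnorm g + opnorm h"
proof (rule opnorm_leI)
  fix x
  have "norm ((g + h) *v x) \<le> norm (g *v x) + norm (h *v x)"
    by (simp add: matrix_vector_mult_add_rdistrib norm_triangle_ineq)
  also have "\<dots> \<le> opnorm g * norm x + opnorm h * norm x"
    by (intro add_mono norm_mult_le_opnorm)
  finally show "norm ((g + h) *v x) \<le> (opnorm g + opnorm h) * norm x" by (simp add: algebra_simps)
qed

lemma opnorm_minus_commute: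
  fixes g h :: "real ^ 'm ^ 'm"
  shows "opnorm (g - h) = opnorm (h - g)"
proof -
  have "opnorm (g - h) \<le> opnorm (h - g)" for g h :: "real ^ 'm ^ 'm"
  proof (rule opnorm_leI)
    fix x
    have "(g - h) *v x = - ((h - g) *v x)"
      by (simp add: matrix_vector_mult_diff_rdistrib)
    then show "norm ((g - h) *v x) \<le> opnorm (h - g) * norm x"
      using norm_mult_le_opnorm[of "h - g" x] by simp
  qed
  then show ?thesis by (simp add: antisym)
qed

lemma linear_matrix_apply: "linear (\<lambda>g :: real ^ 'm ^ 'm. g *v x)"
  by (rule linearI) (simp_all add: matrix_vector_mult_add_rdistrib scaleR_matrix_vector_assoc)

lemma continuous_matrix_apply: "continuous_on UNIV (\<lambda>g :: real ^ 'm ^ 'm. g *v x)"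
  using linear_continuous_on linear_conv_bounded_linear linear_matrix_apply by blast

lemma continuous_apply_vector: "continuous_on UNIV (\<lambda>x. (g :: real ^ 'm ^ 'm) *v x)"
  by (rule matrix_vector_mult_linear_continuous_on)

lemma opnorm_gt_iff: "0 \<le> c \<Longrightarrow> c < opnorm g \<longleftrightarrow> (\<exists>x. c * norm x < norm (g *v x))"
proof
  assume "0 \<le> c" "c < opnorm g"
  then show "\<exists>x. c * norm x < norm (g *v x)" using opnorm_leI[of g c] by (meson not_le)
next
  assume "\<exists>x. c * norm x < norm (g *v x)"
  then obtain x where x: "c * norm x < norm (g *v x)" by blast
  also have "\<dots> \<le> opnorm g * norm x" by (rule norm_mult_le_opnorm)
  finally show "c < opnorm g" by (auto simp: mult_less_cancel_right)
qed

lemma borel_measurable_opnorm [measurable]: "(opnorm :: real ^ 'm ^ 'm \<Rightarrow> real) \<in> borel_measurable borel"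
proof -
  \<comment> \<open>As a supremum of continuous functions, the operator norm is lower semicontinuous.\<close>
  have "{g :: real ^ 'm ^ 'm. c < opnorm g} \<in> sets borel" for c
  proof (cases "0 \<le> c")
    case True
    have "{g :: real ^ 'm ^ 'm. c < opnorm g} = (\<Union>x. {g. c * norm x < norm (g *v x)})"
      using opnorm_gt_iff[OF True] by auto
    moreover have "open {g :: real ^ 'm ^ 'm. c * norm x < norm (g *v x)}" for x
      by (intro open_Collect_less continuous_intros continuous_matrix_apply)
    ultimately show ?thesis by (simp add: borel_open open_UN)
  next
    case False
    then have "{g :: real ^ 'm ^ 'm. c < opnorm g} = UNIV" using opnorm_nonneg less_le_trans
      by (metis (mono_tags, lifting) UNIV_eq_I mem_Collect_eq not_le)
    then show ?thesis by simp
  qed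
  then show ?thesis by (simp add: borel_measurable_iff_greater)
qed

text \<open>
  A common bound for a matrix of determinant one and its inverse, a power of which is integrable as
  soon as some power of \<open>opnorm g\<close> is. The constant comes from Cramer's rule: the coordinates of a
  preimage of a unit vector are determinants of matrices with entries at most \<open>max 1 (opnorm g)\<close>.
\<close>
definition distortion :: "real ^ 'm ^ 'm \<Rightarrow> real" where
  "distortion g = real CARD('m) * fact CARD('m) * max 1 (opnorm g) ^ CARD('m)"

lemma borel_measurable_distortion [measurable]: "distortion \<in> borel_measurable borel"
  unfolding distortion_def by measurable

lemma abs_det_le:
  fixes M :: "real ^ 'm ^ 'm"
  assumes "\<And>i j. \<bar>M $ i $ j\<bar> \<le> c"
  shows "\<bar>det M\<bar> \<le> fact CARD('m) * c ^ CARD('m)"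
proof -
  have "\<bar>det M\<bar> \<le> (\<Sum>p | p permutes (UNIV::'m set). \<bar>of_int (sign p) * (\<Prod>i\<in>UNIV. M $ i $ p i)\<bar>)"
    unfolding det_def by (rule sum_abs)
  also have "\<dots> \<le> (\<Sum>p | p permutes (UNIV::'m set). c ^ CARD('m))"
  proof (rule sum_mono)
    fix p :: "'m \<Rightarrow> 'm"
    have "\<bar>of_int (sign p) * (\<Prod>i\<in>UNIV. M $ i $ p i)\<bar> = (\<Prod>i\<in>UNIV. \<bar>M $ i $ p i\<bar>)"
      by (simp add: abs_mult abs_prod sign_def)
    also have "\<dots> \<le> (\<Prod>i\<in>(UNIV::'m set). c)"
      by (intro prod_mono) (simp add: assms)
    finally show "\<bar>of_int (sign p) * (\<Prod>i\<in>UNIV. M $ i $ p i)\<bar> \<le> c ^ CARD('m)" by simp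
  qed
  also have "\<dots> = fact CARD('m) * c ^ CARD('m)"
    by (simp add: card_permutations)
  finally show ?thesis .
qed

lemma distortion_ge_1: "1 \<le> distortion (g :: real ^ 'm ^ 'm)"
proof -
  have "1 * 1 * 1 \<le> real CARD('m) * fact CARD('m) * max 1 (opnorm g) ^ CARD('m)"
    by (intro mult_mono) (auto simp: Suc_le_eq fact_ge_1 one_le_power)
  then show ?thesis by (simp add: distortion_def)
qed

lemma distortion_pos [simp]: "0 < distortion g"
  using distortion_ge_1[of g] by linarith

lemma distortion_neq_0 [simp]: "distortion g \<noteq> 0"
  using distortion_pos[of g] by linarith

lemma opnorm_le_distortion: "opnorm (g :: real ^ 'm ^ 'm) \<le> distortion g"
proof -
  let ?x = "max 1 (opnorm g)"
  have "1 * 1 * ?x \<le> real CARD('m) * fact CARD('m) * ?x ^ CARD('m)"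
    by (intro mult_mono self_le_power) (auto simp: Suc_le_eq fact_ge_1)
  then show ?thesis by (simp add: distortion_def)
qed

lemma norm_mult_le_distortion: "norm (g *v x) \<le> distortion g * norm x"
  using norm_mult_le_opnorm[of g x] opnorm_le_distortion[of g]
  by (meson mult_right_mono norm_ge_zero order_trans)

lemma abs_component_le_opnorm: "\<bar>g $ i $ j\<bar> \<le> opnorm g"
proof -
  have "\<bar>g $ i $ j\<bar> = \<bar>(g *v axis j 1) $ i\<bar>" by (simp add: matrix_vector_mul_component inner_axis)
  also have "\<dots> \<le> norm (g *v axis j 1)" by (rule component_le_norm_cart)
  also have "\<dots> \<le> opnorm g * norm (axis j (1::real))" by (rule norm_mult_le_opnorm)
  finally show ?thesis by (simp add: norm_axis_1)
qed

lemma matrix_mult_inv: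
  assumes "invertible (g :: real ^ 'm ^ 'm)"
  shows "g ** matrix_inv g = mat 1" "matrix_inv g ** g = mat 1"
  using someI_ex[OF assms[unfolded invertible_def]] by (auto simp: matrix_inv_def)

lemma norm_le_distortion_mult:
  fixes g :: "real ^ 'm ^ 'm"
  assumes "det g = 1"
  shows "norm x \<le> distortion g * norm (g *v x)"
proof -
  let ?M = "max 1 (opnorm g)"
  have unit: "norm x \<le> distortion g" if b: "norm (g *v x) = 1" for x
  proof -
    define b where "b = g *v x"
    have "det g \<noteq> 0" using assms by simp
    then have x: "x = (\<chi> k. det (\<chi> i j. if j = k then b $ i else g $ i $ j) / det g)"
      using cramer[of g x b] b_def by simp
    have xk: "\<bar>x $ k\<bar> \<le> fact CARD('m) * ?M ^ CARD('m)" for k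
    proof -
      have "\<bar>b $ i\<bar> \<le> 1" for i using component_le_norm_cart[of b i] b b_def by simp
      then have "\<bar>det (\<chi> i j. if j = k then b $ i else g $ i $ j)\<bar> \<le> fact CARD('m) * ?M ^ CARD('m)"
        by (intro abs_det_le) (auto intro: order_trans[OF abs_component_le_opnorm]
            order_trans[OF _ max.cobounded1])
      then show ?thesis by (subst x) (simp add: assms)
    qed
    have "norm x \<le> (\<Sum>k\<in>UNIV. \<bar>x $ k\<bar>)" by (rule norm_le_l1_cart)
    also have "\<dots> \<le> (\<Sum>k\<in>(UNIV::'m set). fact CARD('m) * ?M ^ CARD('m))"
      by (intro sum_mono xk)
    finally show ?thesis by (simp add: distortion_def mult.assoc)
  qed
  show ?thesis
  proof (cases "x = 0")
    case False
    have inv: "invertible g" using assms by (simp add: invertible_det_nz)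
    then have nz: "g *v x \<noteq> 0" using False
      by (metis matrix_mult_inv(2) matrix_vector_mul_assoc matrix_vector_mul_lid matrix_vector_mult_0_right)
    let ?y = "(1 / norm (g *v x)) *\<^sub>R x"
    have "norm (g *v ?y) = 1" using nz by (simp add: matrix_vector_mult_scaleR)
    then have "norm ?y \<le> distortion g" by (rule unit)
    then show ?thesis using nz by (simp add: field_simps)
  qed (simp add: distortion_pos)
qed

lemma mult_eq_0_iff_det_1: "det g = 1 \<Longrightarrow> g *v x = 0 \<longleftrightarrow> x = (0 :: real ^ 'm)"
  using norm_le_distortion_mult[of g x] by auto

text \<open>The area of the parallelogram spanned by two vectors, that is, the norm of \<open>x \<and> y\<close>.\<close>
definition area :: "real ^ 'm \<Rightarrow> real ^ 'm \<Rightarrow> real" where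
  "area x y = sqrt ((x \<bullet> x) * (y \<bullet> y) - (x \<bullet> y)\<^sup>2)"

lemma area_nonneg: "0 \<le> area x y"
  unfolding area_def using Cauchy_Schwarz_ineq[of x y] by simp

lemma area_le: "area x y \<le> norm x * norm y"
proof -
  have "area x y \<le> sqrt ((x \<bullet> x) * (y \<bullet> y))"
    unfolding area_def by (intro real_sqrt_le_mono) simp
  then show ?thesis by (simp add: real_sqrt_mult norm_eq_sqrt_inner)
qed

lemma area_orthogonal: "x \<bullet> y = 0 \<Longrightarrow> area x y = norm x * norm y"
  by (simp add: area_def real_sqrt_mult norm_eq_sqrt_inner)

lemma area_lincomb:
  "area (\<alpha> *\<^sub>R u + \<beta> *\<^sub>R v) (\<gamma> *\<^sub>R u + \<delta> *\<^sub>R v) = \<bar>\<alpha> * \<delta> - \<beta> * \<gamma>\<bar> * area u v"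
proof -
  let ?x = "\<alpha> *\<^sub>R u + \<beta> *\<^sub>R v" and ?y = "\<gamma> *\<^sub>R u + \<delta> *\<^sub>R v"
  have "(?x \<bullet> ?x) * (?y \<bullet> ?y) - (?x \<bullet> ?y)\<^sup>2
      = (\<alpha> * \<delta> - \<beta> * \<gamma>)\<^sup>2 * ((u \<bullet> u) * (v \<bullet> v) - (u \<bullet> v)\<^sup>2)"
    by (simp add: inner_simps inner_commute[of v u] power2_eq_square algebra_simps)
  then show ?thesis unfolding area_def by (simp add: real_sqrt_mult)
qed

lemma area_scaleR_left: "area (c *\<^sub>R x) y = \<bar>c\<bar> * area x y"
  using area_lincomb[of c x 0 y 0 1] by simp

lemma area_commute: "area x y = area y x"
  by (simp add: area_def inner_commute mult.commute)

lemma continuous_on_area [continuous_intros]: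
  "continuous_on S f \<Longrightarrow> continuous_on S g \<Longrightarrow> continuous_on S (\<lambda>x. area (f x) (g x))"
  unfolding area_def by (intro continuous_intros)

text \<open>
  Within the plane spanned by \<open>x\<close> and \<open>y\<close> there is a direction orthogonal to any prescribed
  vector, and passing to a basis of the plane with the same oriented area does not change the area
  of any linear image.
\<close>
lemma area_adapted_basis:
  fixes x y w :: "real ^ 'm"
  obtains x' y' where "x' \<bullet> y' = 0" "y' \<bullet> w = 0"
    "\<And>g :: real ^ 'm ^ 'm. area (g *v x') (g *v y') = area (g *v x) (g *v y)"
proof -
  have image: "area (g *v (\<alpha> *\<^sub>R x + \<beta> *\<^sub>R y)) (g *v (\<gamma> *\<^sub>R x + \<delta> *\<^sub>R y)) = area (g *v x) (g *v y)"
    if "\<alpha> * \<delta> - \<beta> * \<gamma> = 1 \<or> \<alpha> * \<delta> - \<beta> * \<gamma> = -1" for \<alpha> \<beta> \<gamma> \<delta> and g :: "real ^ 'm ^ 'm"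
    using that by (auto simp: matrix_vector_right_distrib matrix_vector_mult_scaleR area_lincomb)
  obtain \<alpha> \<delta> \<beta> \<gamma> where det: "\<alpha> * \<delta> - \<beta> * \<gamma> = 1" and orth: "(\<gamma> *\<^sub>R x + \<delta> *\<^sub>R y) \<bullet> w = 0"
  proof (cases "x \<bullet> w = 0")
    case True
    show ?thesis by (rule that[of 0 0 1 "-1"]) (auto simp: True inner_simps)
  next
    case False
    show ?thesis
      by (rule that[of 1 1 0 "- (y \<bullet> w) / (x \<bullet> w)"]) (use False in \<open>auto simp: inner_simps\<close>)
  qed
  define y' where "y' = \<gamma> *\<^sub>R x + \<delta> *\<^sub>R y"
  define u where "u = \<alpha> *\<^sub>R x + \<beta> *\<^sub>R y"
  define c where "c = (if y' = 0 then 0 else (u \<bullet> y') / (y' \<bullet> y'))"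
  define x' where "x' = (\<alpha> - c * \<gamma>) *\<^sub>R x + (\<beta> - c * \<delta>) *\<^sub>R y"
  have "x' = u - c *\<^sub>R y'" unfolding x'_def u_def y'_def by (simp add: algebra_simps)
  then have 1: "x' \<bullet> y' = 0" by (auto simp: c_def inner_simps)
  have 2: "(\<alpha> - c * \<gamma>) * \<delta> - (\<beta> - c * \<delta>) * \<gamma> = 1" using det by (simp add: algebra_simps)
  show ?thesis
    by (rule that[of x' y']) (use 1 2 orth image in \<open>auto simp: x'_def y'_def\<close>)
qed

text \<open>
  In a basis of the plane with orthogonal vectors, one of them orthogonal to \<open>w\<close>, area is the product
  of the lengths.
\<close>
lemma area_image_le:
  fixes g :: "real ^ 'm ^ 'm"
  assumes "\<And>v. norm (g *v v) \<le> s * norm v" "\<And>v. v \<bullet> w = 0 \<Longrightarrow> norm (g *v v) \<le> t * norm v"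
    "0 \<le> s"
  shows "area (g *v x) (g *v y) \<le> s * t * area x y"
proof -
  obtain x' y' :: "real ^ 'm" where o: "x' \<bullet> y' = 0" "y' \<bullet> w = 0"
    and eq: "\<And>g :: real ^ 'm ^ 'm. area (g *v x') (g *v y') = area (g *v x) (g *v y)"
    by (rule area_adapted_basis[of w x y]) blast
  have "area (g *v x) (g *v y) = area (g *v x') (g *v y')" by (simp add: eq)
  also have "\<dots> \<le> norm (g *v x') * norm (g *v y')" by (rule area_le)
  also have "\<dots> \<le> (s * norm x') * (t * norm y')"
    using assms o by (intro mult_mono) auto
  also have "\<dots> = s * t * area x' y'" by (simp add: area_orthogonal o)
  also have "area x' y' = area x y" using eq[of "mat 1"] by simp
  finally show ?thesis .
qed

text \<open>
  The operator norm of the action of \<open>g\<close> on bivectors; it suffices to test on decomposable ones,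
  that is, on pairs of vectors.
\<close>
definition area_norm :: "real ^ 'm ^ 'm \<Rightarrow> real" where
  "area_norm g = (SUP p\<in>{(x, y). area x y = 1}. area (g *v fst p) (g *v snd p))"

lemma area_image_le_opnorm: "area (g *v x) (g *v y) \<le> (opnorm g)\<^sup>2 * area x y"
  using area_image_le[of g "opnorm g" 0 "opnorm g" x y] norm_mult_le_opnorm[of g] opnorm_nonneg[of g]
  by (simp add: power2_eq_square)

lemma area_image_bdd_above:
  fixes g :: "real ^ 'm ^ 'm"
  shows
  "bdd_above ((\<lambda>p. area (g *v fst p) (g *v snd p)) ` {(x, y). area x y = 1})"
proof (rule bdd_aboveI2)
  fix p :: "(real ^ 'm) \<times> (real ^ 'm)" assume "p \<in> {(x, y). area x y = 1}"
  then show "area (g *v fst p) (g *v snd p) \<le> (opnorm g)\<^sup>2"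
    using area_image_le_opnorm[of g "fst p" "snd p"] by auto
qed

lemma ex_area_1:
  assumes "CARD('m) \<ge> 2"
  shows "\<exists>x y :: real ^ 'm. area x y = 1"
proof -
  obtain i j :: 'm where "i \<noteq> j" using assms
    by (metis One_nat_def card_1_singleton_iff card_le_Suc0_iff_eq finite_class.finite_UNIV
        iso_tuple_UNIV_I not_less_eq_eq numeral_2_eq_2)
  then have "area (axis i 1 :: real ^ 'm) (axis j 1) = 1"
    by (subst area_orthogonal) (auto simp: inner_axis_axis norm_axis_1)
  then show ?thesis by blast
qed

lemma area_image_le_area_norm: "area (g *v x) (g *v y) \<le> area_norm g * area x y"
proof (cases "area x y = 0")
  case True
  then show ?thesis using area_image_le_opnorm[of g x y] by simp
next
  case False
  let ?c = "1 / area x y"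
  have "area (?c *\<^sub>R x) y = 1" using False area_nonneg[of x y] by (simp add: area_scaleR_left)
  then have "area (g *v (?c *\<^sub>R x)) (g *v y) \<le> area_norm g"
    unfolding area_norm_def by (intro cSUP_upper2[OF area_image_bdd_above, of "(?c *\<^sub>R x, y)"]) auto
  then show ?thesis using False area_nonneg[of x y]
    by (simp add: matrix_vector_mult_scaleR area_scaleR_left field_simps)
qed

lemma area_norm_leI:
  assumes "CARD('m) \<ge> 2" "\<And>x y. area ((g :: real ^ 'm ^ 'm) *v x) (g *v y) \<le> c * area x y"
  shows "area_norm g \<le> c"
  unfolding area_norm_def
  using ex_area_1[OF assms(1)] assms(2) by (intro cSUP_least) (auto, metis mult.right_neutral)

lemma area_norm_nonneg:
  assumes "CARD('m) \<ge> 2"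
  shows "0 \<le> area_norm (g :: real ^ 'm ^ 'm)"
proof -
  obtain u v :: "real ^ 'm" where "area u v = 1" using ex_area_1[OF assms] by blast
  then show ?thesis using area_image_le_area_norm[of g u v] area_nonneg[of "g *v u" "g *v v"] by simp
qed

lemma area_norm_mult_le:
  assumes "CARD('m) \<ge> 2"
  shows "area_norm (g ** h) \<le> area_norm g * area_norm (h :: real ^ 'm ^ 'm)"
proof (rule area_norm_leI[OF assms])
  fix x y
  have "area ((g ** h) *v x) ((g ** h) *v y) \<le> area_norm g * area (h *v x) (h *v y)"
    by (metis area_image_le_area_norm matrix_vector_mul_assoc)
  also have "\<dots> \<le> area_norm g * (area_norm h * area x y)"
    by (intro mult_left_mono area_image_le_area_norm area_norm_nonneg assms)
  finally show "area ((g ** h) *v x) ((g ** h) *v y) \<le> area_norm g * area_norm h * area x y"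
    by (simp add: mult.assoc)
qed

lemma area_norm_le_opnorm: "CARD('m) \<ge> 2 \<Longrightarrow> area_norm (g :: real ^ 'm ^ 'm) \<le> (opnorm g)\<^sup>2"
  by (rule area_norm_leI) (auto simp: area_image_le_opnorm)

text \<open>Areas cannot collapse, since they are recovered by applying the inverse.\<close>
lemma area_norm_pos:
  assumes "CARD('m) \<ge> 2" "det (g :: real ^ 'm ^ 'm) = 1"
  shows "0 < area_norm g"
proof -
  obtain u v :: "real ^ 'm" where uv: "area u v = 1" using ex_area_1[OF assms(1)] by blast
  have inv: "g *v (matrix_inv g *v x) = x" for x
    using matrix_mult_inv(1)[of g] assms(2) by (simp add: matrix_vector_mul_assoc invertible_det_nz)
  have "1 \<le> area_norm g * area (matrix_inv g *v u) (matrix_inv g *v v)"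
    using area_image_le_area_norm[of g "matrix_inv g *v u" "matrix_inv g *v v"] uv by (simp add: inv)
  then show ?thesis using area_nonneg[of "matrix_inv g *v u" "matrix_inv g *v v"]
    by (smt (verit) mult_nonpos_nonneg)
qed

lemma borel_measurable_area_norm [measurable]:
  assumes "CARD('m) \<ge> 2"
  shows "(area_norm :: real ^ 'm ^ 'm \<Rightarrow> real) \<in> borel_measurable borel"
proof -
  have "{g :: real ^ 'm ^ 'm. c < area_norm g} \<in> sets borel" for c
  proof -
    have ne: "{(x, y). area x y = (1::real)} \<noteq> ({} :: ((real ^ 'm) \<times> (real ^ 'm)) set)"
      using ex_area_1[OF assms] by auto
    have "{g :: real ^ 'm ^ 'm. c < area_norm g}
        = (\<Union>p\<in>{(x, y). area x y = 1}. {g. c < area (g *v fst p) (g *v snd p)})"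
      unfolding area_norm_def by (simp only: less_cSUP_iff[OF ne area_image_bdd_above]) fastforce
    moreover have "open {g :: real ^ 'm ^ 'm. c < area (g *v x) (g *v y)}" for x y
      by (intro open_Collect_less continuous_intros continuous_matrix_apply)
    ultimately show ?thesis by (simp add: borel_open open_UN)
  qed
  then show ?thesis by (simp add: borel_measurable_iff_greater)
qed

lemma mem_gram_eigenspace_iff:
  "v \<in> gram_eigenspace g s \<longleftrightarrow> (\<forall>w. (g *v v) \<bullet> (g *v w) = s\<^sup>2 * (v \<bullet> w))"
proof -
  have "((transpose g ** g) *v v) \<bullet> w = (g *v v) \<bullet> (g *v w)" for w
    by (simp add: matrix_vector_mul_assoc[symmetric] dot_lmul_matrix)
  moreover have "v \<in> gram_eigenspace g s
      \<longleftrightarrow> (\<forall>w. ((transpose g ** g) *v v) \<bullet> w = (s\<^sup>2 *\<^sub>R v) \<bullet> w)"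
    unfolding gram_eigenspace_def mem_Collect_eq by (rule vector_eq_rdot[symmetric])
  ultimately show ?thesis by simp
qed

lemma subspace_gram_eigenspace: "subspace (gram_eigenspace g s)"
  by (auto simp: subspace_def mem_gram_eigenspace_iff matrix_vector_right_distrib matrix_vector_mult_scaleR inner_simps algebra_simps)

text \<open>
  First variation of the quadratic form \<open>s\<^sup>2 |v|\<^sup>2 - |g v|\<^sup>2\<close>, which is nonnegative on \<open>U\<close> and
  vanishes at \<open>u\<close>.
\<close>
lemma maximal_stretch_critical:
  fixes g :: "real ^ 'm ^ 'm"
  assumes U: "subspace U" "u \<in> U" "w \<in> U" and s: "0 \<le> s"
    and le: "\<And>v. v \<in> U \<Longrightarrow> norm (g *v v) \<le> s * norm v" and eq: "norm (g *v u) = s * norm u"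
  shows "(g *v u) \<bullet> (g *v w) = s\<^sup>2 * (u \<bullet> w)"
proof (rule ccontr)
  assume ne: "(g *v u) \<bullet> (g *v w) \<noteq> s\<^sup>2 * (u \<bullet> w)"
  define \<beta> where "\<beta> = s\<^sup>2 * (u \<bullet> w) - (g *v u) \<bullet> (g *v w)"
  define \<gamma> where "\<gamma> = s\<^sup>2 * (w \<bullet> w) - (g *v w) \<bullet> (g *v w)"
  have sq: "(g *v v) \<bullet> (g *v v) \<le> s\<^sup>2 * (v \<bullet> v)" if "v \<in> U" for v
    using power_mono[OF le[OF that], of 2] by (simp add: power_mult_distrib power2_norm_eq_inner)
  have equ: "(g *v u) \<bullet> (g *v u) = s\<^sup>2 * (u \<bullet> u)"
    using arg_cong[OF eq, of "\<lambda>x. x\<^sup>2"] by (simp add: power_mult_distrib power2_norm_eq_inner)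
  have \<gamma>: "0 \<le> \<gamma>" using sq[OF U(3)] by (simp add: \<gamma>_def)
  define t where "t = - \<beta> / (\<gamma> + 1)"
  have "u + t *\<^sub>R w \<in> U" using U by (simp add: subspace_add subspace_scale)
  from sq[OF this] have "0 \<le> 2 * t * \<beta> + t\<^sup>2 * \<gamma>"
    unfolding \<beta>_def \<gamma>_def using equ
    by (simp add: matrix_vector_right_distrib matrix_vector_mult_scaleR inner_simps
        inner_commute[of w u] inner_commute[of "g *v w" "g *v u"] power2_eq_square algebra_simps)
  also have "2 * t * \<beta> + t\<^sup>2 * \<gamma> = - (\<beta>\<^sup>2 * (\<gamma> + 2)) / (\<gamma> + 1)\<^sup>2"
    using \<gamma> by (simp add: t_def power2_eq_square divide_simps) (simp add: algebra_simps)
  finally have "\<beta>\<^sup>2 * (\<gamma> + 2) \<le> 0"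
    using \<gamma> by (simp add: divide_le_0_iff zero_le_divide_iff)
  moreover have "0 < \<beta>\<^sup>2 * (\<gamma> + 2)" using ne \<gamma> by (simp add: \<beta>_def)
  ultimately show False by simp
qed

lemma ex_maximal_stretch:
  fixes g :: "real ^ 'm ^ 'm"
  assumes U: "subspace U" "x \<in> U" "x \<noteq> 0"
  obtains u where "u \<in> U" "norm u = 1" "\<And>v. v \<in> U \<Longrightarrow> norm (g *v v) \<le> norm (g *v u) * norm v"
proof -
  let ?K = "sphere 0 1 \<inter> U"
  have "compact ?K" using closed_subspace[OF U(1)] by (intro compact_Int_closed) auto
  moreover have "(1 / norm x) *\<^sub>R x \<in> ?K" using U by (auto simp: subspace_scale)
  moreover have "continuous_on ?K (\<lambda>v. norm (g *v v))"
    by (intro continuous_intros continuous_on_subset[OF continuous_apply_vector]) auto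
  ultimately obtain u where u: "u \<in> ?K" "\<And>v. v \<in> ?K \<Longrightarrow> norm (g *v v) \<le> norm (g *v u)"
    by (metis continuous_attains_sup empty_iff)
  have "norm (g *v v) \<le> norm (g *v u) * norm v" if "v \<in> U" for v
  proof (cases "v = 0")
    case False
    then have "norm (g *v ((1 / norm v) *\<^sub>R v)) \<le> norm (g *v u)"
      using that U(1) by (intro u(2)) (auto simp: subspace_scale)
    then show ?thesis using False by (simp add: matrix_vector_mult_scaleR field_simps)
  qed simp
  then show thesis using u(1) that by auto
qed

lemma rev_sorted_list_of_multiset_two_largest:
  assumes "\<And>x. x \<in># N \<Longrightarrow> x \<le> b" "b \<le> a"
  shows "rev (sorted_list_of_multiset (add_mset a (add_mset b N))) = a # b # rev (sorted_list_of_multiset N)"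
proof -
  let ?l = "sorted_list_of_multiset N @ [b, a]"
  have "sorted ?l" using assms by (auto simp: sorted_append intro: order_trans)
  then have "sort ?l = ?l" by (rule sorted_sort_id)
  then have "sorted_list_of_multiset (mset ?l) = ?l" by (subst sorted_list_of_multiset_mset)
  also have "mset ?l = add_mset a (add_mset b N)" by (simp add: add_mset_commute)
  finally show ?thesis by simp
qed

text \<open>Eigenvectors for different eigenvalues are orthogonal, hence linearly independent.\<close>
lemma finite_gram_eigenvalues:
  fixes g :: "real ^ 'm ^ 'm"
  shows "finite {s. 0 \<le> s \<and> (\<exists>v. v \<noteq> 0 \<and> v \<in> gram_eigenspace g s)}" (is "finite ?S")
proof -
  define f where "f = (\<lambda>s. SOME v. v \<noteq> 0 \<and> v \<in> gram_eigenspace g s)"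
  have f: "f s \<noteq> 0 \<and> f s \<in> gram_eigenspace g s" if "s \<in> ?S" for s
    using that unfolding f_def mem_Collect_eq by (intro someI_ex[of "\<lambda>v. v \<noteq> 0 \<and> v \<in> gram_eigenspace g s"]) blast
  have orth: "f s \<bullet> f t = 0" if "s \<in> ?S" "t \<in> ?S" "s \<noteq> t" for s t
  proof -
    have "s\<^sup>2 * (f s \<bullet> f t) = t\<^sup>2 * (f s \<bullet> f t)"
      using f[OF that(1)] f[OF that(2)] unfolding mem_gram_eigenspace_iff
      by (metis inner_commute)
    moreover have "s\<^sup>2 \<noteq> t\<^sup>2" using that by (auto simp: power2_eq_iff)
    ultimately show ?thesis by simp
  qed
  have inj: "inj_on f ?S" using orth f by (metis (mono_tags, lifting) inj_onI inner_eq_zero_iff)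
  have "pairwise orthogonal (f ` ?S)"
    unfolding pairwise_def orthogonal_def using orth by fastforce
  moreover have "0 \<notin> f ` ?S" using f by force
  ultimately have "independent (f ` ?S)" by (rule pairwise_orthogonal_independent)
  then have "finite (f ` ?S)" by (rule independent_imp_finite)
  then show ?thesis using inj by (rule finite_imageD)
qed

text \<open>
  The two vectors are found by maximizing the stretch, first on the whole space and then on the
  orthogonal complement of the first maximizer. That the second maximum is the second entry of the list
  of singular values needs a case distinction: if it equals the first one, then the top
  eigenspace contains two orthogonal vectors; otherwise the top eigenvalue is simple and all other
  eigenvectors are orthogonal to \<open>v\<close>.
\<close>
lemma singular_vectors:
  fixes g :: "real ^ 'm ^ 'm"
  assumes "CARD('m) \<ge> 2"
  obtains v w where "norm v = 1" "norm w = 1" "v \<bullet> w = 0" "(g *v v) \<bullet> (g *v w) = 0"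
    "norm (g *v v) = opnorm g" "norm (g *v w) = second_singular_value g"
    "\<And>x. x \<bullet> v = 0 \<Longrightarrow> norm (g *v x) \<le> second_singular_value g * norm x"
proof -
  obtain v where v: "norm v = 1" "\<And>x. norm (g *v x) \<le> norm (g *v v) * norm x"
    using ex_maximal_stretch[of UNIV "axis undefined 1" g] by auto
  have op: "norm (g *v v) = opnorm g"
    using norm_mult_le_opnorm[of g v] opnorm_leI[of g "norm (g *v v)"] v by (intro antisym) auto
  let ?U = "{x. x \<bullet> v = 0}"
  have U: "subspace ?U" by (auto simp: subspace_def inner_simps)
  obtain x y :: "real ^ 'm" where "area x y = 1" using ex_area_1[OF assms] by blast
  moreover obtain x' y' where xy': "x' \<bullet> y' = 0" "y' \<bullet> v = 0"
    "\<And>g :: real ^ 'm ^ 'm. area (g *v x') (g *v y') = area (g *v x) (g *v y)"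
    by (rule area_adapted_basis[of v x y]) blast
  ultimately have "area x' y' = 1" using xy'(3)[of "mat 1"] by simp
  then have "y' \<noteq> 0" by (auto simp: area_def)
  then obtain w where w: "w \<bullet> v = 0" "norm w = 1"
    "\<And>x. x \<bullet> v = 0 \<Longrightarrow> norm (g *v x) \<le> norm (g *v w) * norm x"
    using ex_maximal_stretch[OF U, of y' g] xy'(2) by auto
  define s where "s = norm (g *v v)"
  define t where "t = norm (g *v w)"
  have ts: "0 \<le> t" "t \<le> s" using v(2)[of w] w(2) by (auto simp: s_def t_def)
  have crit_v: "(g *v v) \<bullet> (g *v x) = s\<^sup>2 * (v \<bullet> x)" for x
    by (rule maximal_stretch_critical[of UNIV]) (use v in \<open>auto simp: s_def\<close>)
  have gorth: "(g *v v) \<bullet> (g *v w) = 0" using crit_v[of w] w(1) by (simp add: inner_commute)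
  have crit_w: "(g *v w) \<bullet> (g *v x) = t\<^sup>2 * (w \<bullet> x)" for x
  proof -
    let ?c = "x \<bullet> v"
    have x: "x = ?c *\<^sub>R v + (x - ?c *\<^sub>R v)" by simp
    have vv: "v \<bullet> v = 1" using v(1) by (simp add: norm_eq_1)
    have "(g *v w) \<bullet> (g *v (x - ?c *\<^sub>R v)) = t\<^sup>2 * (w \<bullet> (x - ?c *\<^sub>R v))"
      by (rule maximal_stretch_critical[OF U]) (use w vv in \<open>auto simp: t_def inner_simps\<close>)
    moreover have "(g *v w) \<bullet> (g *v v) = 0" using gorth by (simp add: inner_commute)
    ultimately show ?thesis using w(1)
      by (simp add: matrix_vector_mult_diff_distrib matrix_vector_mult_scaleR inner_simps)
  qed
  have v_mem: "v \<in> gram_eigenspace g s" and w_mem: "w \<in> gram_eigenspace g t"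
    using crit_v crit_w by (auto simp: mem_gram_eigenspace_iff)
  define S where "S = {s. 0 \<le> s \<and> (\<exists>v. v \<noteq> 0 \<and> v \<in> gram_eigenspace g s)}"
  define M where "M = (\<Sum>s \<in> S. replicate_mset (dim (gram_eigenspace g s)) s)"
  have fin: "finite S" unfolding S_def by (rule finite_gram_eigenvalues)
  have count: "count M r = (if r \<in> S then dim (gram_eigenspace g r) else 0)" for r
    using fin by (simp add: M_def count_sum if_distrib cong: if_cong)
  have "v \<noteq> 0" "w \<noteq> 0" using v(1) w(2) by auto
  then have s_mem: "s \<in> S" "t \<in> S" using v_mem w_mem ts unfolding S_def by fastforce+
  have eig_norm: "norm (g *v x) = r * norm x" if "x \<in> gram_eigenspace g r" "0 \<le> r" for x r
  proof -
    have "(norm (g *v x))\<^sup>2 = (r * norm x)\<^sup>2"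
      using that(1) by (simp add: mem_gram_eigenspace_iff power_mult_distrib power2_norm_eq_inner)
    then show ?thesis using that(2) by (simp add: power2_eq_iff_nonneg)
  qed
  have le_s: "r \<le> s" if r: "r \<in> S" for r
  proof -
    obtain x where "x \<noteq> 0" "x \<in> gram_eigenspace g r" using r by (auto simp: S_def)
    moreover have "0 \<le> r" using r by (simp add: S_def)
    ultimately show ?thesis using eig_norm[of x r] v(2)[of x] by (auto simp: s_def)
  qed
  have le_t: "r \<le> t" if r: "r \<in> S" "r \<noteq> s" for r
  proof -
    obtain x where x: "x \<noteq> 0" "x \<in> gram_eigenspace g r" using r by (auto simp: S_def)
    have "r\<^sup>2 * (x \<bullet> v) = s\<^sup>2 * (x \<bullet> v)"
      using x(2) v_mem unfolding mem_gram_eigenspace_iff by (metis inner_commute)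
    moreover have "r\<^sup>2 \<noteq> s\<^sup>2" using r ts by (auto simp: power2_eq_iff S_def)
    ultimately have "x \<bullet> v = 0" by simp
    moreover have "0 \<le> r" using r by (simp add: S_def)
    ultimately show ?thesis using eig_norm[of x r] w(3)[of x] x by (auto simp: t_def)
  qed
  have sub: "\<exists>N. M = add_mset s (add_mset t N) \<and> (\<forall>r\<in>#N. r \<le> t)"
  proof (cases "s = t")
    case True
    have "v \<noteq> w" using v(1) w by (auto simp: norm_eq_1)
    moreover have "independent {v, w}"
      by (rule pairwise_orthogonal_independent)
        (use v(1) w in \<open>auto simp: pairwise_def orthogonal_def inner_commute\<close>)
    ultimately have "2 \<le> dim (gram_eigenspace g s)"
      using v_mem w_mem True independent_card_le_dim[of "{v, w}" "gram_eigenspace g s"] by simp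
    then have "2 \<le> count M s" using s_mem by (simp add: count)
    then have "replicate_mset 2 s \<subseteq># M" by (simp add: count_le_replicate_mset_subset_eq)
    then obtain N where N: "M = replicate_mset 2 s + N" using subset_mset.add_diff_inverse by metis
    have "r \<le> t" if "r \<in># N" for r
    proof -
      have "r \<in># M" using that N by simp
      then have "r \<in> S" using count[of r] by (metis count_eq_zero_iff)
      then show ?thesis using le_s[of r] True by simp
    qed
    then show ?thesis using N True by (auto simp: numeral_2_eq_2)
  next
    case False
    have "gram_eigenspace g s \<subseteq> span {v}"
    proof
      fix x assume x: "x \<in> gram_eigenspace g s"
      define y where "y = x - (x \<bullet> v) *\<^sub>R v"
      have "y \<in> gram_eigenspace g s"
        unfolding y_def using x v_mem subspace_gram_eigenspace by (intro subspace_diff subspace_scale)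
      then have "norm (g *v y) = s * norm y" using ts by (intro eig_norm) auto
      moreover have "y \<bullet> v = 0" using v(1) by (simp add: y_def inner_simps norm_eq_1)
      then have "norm (g *v y) \<le> t * norm y" unfolding t_def by (rule w(3))
      ultimately have "y = 0" using False ts
        by (metis antisym mult_le_cancel_right norm_eq_zero norm_ge_zero less_le)
      then have "x = (x \<bullet> v) *\<^sub>R v" by (simp add: y_def)
      then show "x \<in> span {v}" by (metis insertI1 span_base span_scale)
    qed
    then have "dim (gram_eigenspace g s) \<le> card {v}" by (intro dim_le_card) auto
    then have count_s: "count M s \<le> 1" by (simp add: count)
    have dim_pos: "0 < dim (gram_eigenspace g r)" if "r \<in> S" for r
      using that by (auto simp: dim_eq_0 zero_less_iff_neq_zero S_def)
    have "r \<in># M" if "r \<in> S" for r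
      using dim_pos[OF that] that by (simp add: count count_greater_zero_iff[symmetric] del: count_greater_zero_iff)
    then have "s \<in># M" "t \<in># M" using s_mem by auto
    then have "t \<in># M - {#s#}" using False by (simp add: in_diff_count)
    then have "M = add_mset s (add_mset t (M - {#s#} - {#t#}))" using \<open>s \<in># M\<close>
      by (metis insert_DiffM)
    then obtain N where N: "M = add_mset s (add_mset t N)" ..
    have "r \<le> t" if "r \<in># N" for r
    proof -
      have "r \<in># M" using that N by simp
      then have "r \<in> S" using count[of r] by (metis count_eq_zero_iff)
      moreover have "r \<noteq> s" using count_s that N False by (auto simp: count_eq_zero_iff)
      ultimately show ?thesis by (rule le_t)
    qed
    with N show ?thesis by (intro exI[of _ N]) simp
  qed
  then obtain N where N: "M = add_mset s (add_mset t N)" "\<And>r. r \<in># N \<Longrightarrow> r \<le> t" by blast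
  have "singular_values g = s # t # rev (sorted_list_of_multiset N)"
    unfolding singular_values_def S_def[symmetric] M_def[symmetric] N(1)
    by (rule rev_sorted_list_of_multiset_two_largest) (use N ts in auto)
  then have "second_singular_value g = t" by (simp add: second_singular_value_def)
  then show thesis
    using that[of v w] v w op gorth unfolding t_def by (auto simp: inner_commute)
qed

text \<open>
  In every plane there is a vector orthogonal to the top singular vector, which is stretched by at most
  the second singular value; the plane of the first two singular vectors is extremal.
\<close>
lemma area_norm_eq_singular_values:
  fixes g :: "real ^ 'm ^ 'm"
  assumes "CARD('m) \<ge> 2"
  shows "area_norm g = opnorm g * second_singular_value g"
proof -
  obtain v w where vw: "norm v = 1" "norm w = 1" "v \<bullet> w = 0" "(g *v v) \<bullet> (g *v w) = 0"
    "norm (g *v v) = opnorm g" "norm (g *v w) = second_singular_value g"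
    "\<And>x. x \<bullet> v = 0 \<Longrightarrow> norm (g *v x) \<le> second_singular_value g * norm x"
    by (rule singular_vectors[OF assms, of g]) blast
  have "area_norm g \<le> opnorm g * second_singular_value g"
    by (intro area_norm_leI[OF assms] area_image_le[of _ _ v])
      (use vw in \<open>auto simp: norm_mult_le_opnorm opnorm_nonneg\<close>)
  moreover have "opnorm g * second_singular_value g \<le> area_norm g"
    using area_image_le_area_norm[of g v w] vw by (simp add: area_orthogonal)
  ultimately show ?thesis by simp
qed

section \<open>Sequences of independent letters\<close>

definition drop_seq :: "nat \<Rightarrow> (nat \<Rightarrow> 'a) \<Rightarrow> nat \<Rightarrow> 'a" where
  "drop_seq k \<omega> = (\<lambda>i. \<omega> (k + i))"

lemma drop_seq_0 [simp]: "drop_seq 0 \<omega> = \<omega>"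
  by (simp add: drop_seq_def)

lemma drop_seq_drop_seq: "drop_seq j (drop_seq k \<omega>) = drop_seq (k + j) \<omega>"
  by (simp add: drop_seq_def add.assoc)

lemma drop_seq_apply: "drop_seq k \<omega> i = \<omega> (k + i)"
  by (simp add: drop_seq_def)

lemma drop_seq_comb_seq [simp]: "drop_seq k (comb_seq k \<omega> \<omega>') = \<omega>'"
  by (simp add: drop_seq_def comb_seq_def)

lemma comb_seq_less: "i < k \<Longrightarrow> comb_seq k \<omega> \<omega>' i = \<omega> i"
  by (simp add: comb_seq_def)

lemma comb_seq_add: "comb_seq k \<omega> \<omega>' (k + i) = \<omega>' i"
  by (simp add: comb_seq_def)

lemma drop_seq_Suc_case_nat [simp]: "drop_seq (Suc 0) (case_nat s \<omega>) = \<omega>"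
  by (simp add: drop_seq_def)

locale letters = sequence_space M for M :: "'s measure" +
  assumes space_M: "space M = UNIV"
begin

lemma space_S [simp]: "space S = UNIV"
  by (simp add: space_PiM space_M)

lemma measurable_drop_seq [measurable]: "drop_seq k \<in> measurable S S"
  unfolding drop_seq_def by (rule measurable_PiM_single') (auto simp: space_M)

lemma nn_integral_comb_seq:
  assumes [measurable]: "f \<in> borel_measurable S"
  shows "(\<integral>\<^sup>+\<omega>. f \<omega> \<partial>S) = (\<integral>\<^sup>+\<omega>. \<integral>\<^sup>+\<omega>'. f (comb_seq k \<omega> \<omega>') \<partial>S \<partial>S)"
proof -
  have "(\<integral>\<^sup>+\<omega>. f \<omega> \<partial>S) = (\<integral>\<^sup>+\<omega>. f \<omega> \<partial>distr (S \<Otimes>\<^sub>M S) S (\<lambda>(\<omega>, \<omega>'). comb_seq k \<omega> \<omega>'))"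
    by (simp add: PiM_comb_seq)
  also have "\<dots> = (\<integral>\<^sup>+p. f (comb_seq k (fst p) (snd p)) \<partial>(S \<Otimes>\<^sub>M S))"
    by (subst nn_integral_distr) (auto simp: case_prod_beta)
  also have "\<dots> = (\<integral>\<^sup>+\<omega>. \<integral>\<^sup>+\<omega>'. f (comb_seq k \<omega> \<omega>') \<partial>S \<partial>S)"
    by (subst P.nn_integral_fst[symmetric]) auto
  finally show ?thesis .
qed

lemma nn_integral_case_nat:
  assumes [measurable]: "f \<in> borel_measurable S"
  shows "(\<integral>\<^sup>+\<omega>. f \<omega> \<partial>S) = (\<integral>\<^sup>+s. \<integral>\<^sup>+\<omega>. f (case_nat s \<omega>) \<partial>S \<partial>M)"
proof -
  have "(\<integral>\<^sup>+\<omega>. f \<omega> \<partial>S) = (\<integral>\<^sup>+\<omega>. f \<omega> \<partial>distr (M \<Otimes>\<^sub>M S) S (\<lambda>(s, \<omega>). case_nat s \<omega>))"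
    by (simp add: PiM_iter)
  also have "\<dots> = (\<integral>\<^sup>+p. f (case_nat (fst p) (snd p)) \<partial>(M \<Otimes>\<^sub>M S))"
    by (subst nn_integral_distr) (auto simp: case_prod_beta)
  also have "\<dots> = (\<integral>\<^sup>+s. \<integral>\<^sup>+\<omega>. f (case_nat s \<omega>) \<partial>S \<partial>M)"
    by (subst P.nn_integral_fst[symmetric]) auto
  finally show ?thesis .
qed

lemma integral_case_nat:
  fixes f :: "(nat \<Rightarrow> 's) \<Rightarrow> real"
  assumes f: "integrable S f"
  shows "(\<integral>\<omega>. f \<omega> \<partial>S) = (\<integral>s. (\<integral>\<omega>. f (case_nat s \<omega>) \<partial>S) \<partial>M)"
    and "integrable M (\<lambda>s. \<integral>\<omega>. f (case_nat s \<omega>) \<partial>S)"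
proof -
  interpret pair_sigma_finite M S ..
  have [measurable]: "f \<in> borel_measurable S" using f by simp
  have f': "integrable (distr (M \<Otimes>\<^sub>M S) S (\<lambda>(s, \<omega>). case_nat s \<omega>)) f"
    using f by (simp add: PiM_iter)
  then have int: "integrable (M \<Otimes>\<^sub>M S) (\<lambda>p. f (case_nat (fst p) (snd p)))"
    by (subst (asm) integrable_distr_eq) (auto simp: case_prod_beta)
  have "(\<integral>\<omega>. f \<omega> \<partial>S) = (\<integral>\<omega>. f \<omega> \<partial>distr (M \<Otimes>\<^sub>M S) S (\<lambda>(s, \<omega>). case_nat s \<omega>))"
    by (simp add: PiM_iter)
  also have "\<dots> = (\<integral>p. f (case_nat (fst p) (snd p)) \<partial>(M \<Otimes>\<^sub>M S))"
    by (subst integral_distr) (auto simp: case_prod_beta)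
  also have "\<dots> = (\<integral>s. (\<integral>\<omega>. f (case_nat s \<omega>) \<partial>S) \<partial>M)"
    using integral_fst'[OF int] by simp
  finally show "(\<integral>\<omega>. f \<omega> \<partial>S) = (\<integral>s. (\<integral>\<omega>. f (case_nat s \<omega>) \<partial>S) \<partial>M)" .
  show "integrable M (\<lambda>s. \<integral>\<omega>. f (case_nat s \<omega>) \<partial>S)"
    using integrable_fst'[OF int] by simp
qed

lemma AE_case_nat:
  assumes "AE \<omega> in S. Q \<omega>"
  shows "AE s in M. AE \<omega> in S. Q (case_nat s \<omega>)"
proof -
  interpret pair_sigma_finite M S ..
  have "AE \<omega> in distr (M \<Otimes>\<^sub>M S) S (\<lambda>(s, \<omega>). case_nat s \<omega>). Q \<omega>"
    using assms unfolding PiM_iter .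
  then have "AE p in M \<Otimes>\<^sub>M S. Q (case_nat (fst p) (snd p))"
    by (drule_tac AE_distrD[rotated]) (auto simp: case_prod_beta)
  then show ?thesis using AE_pair by fastforce
qed

lemma nn_integral_drop_seq:
  assumes [measurable]: "f \<in> borel_measurable S"
  shows "(\<integral>\<^sup>+\<omega>. f (drop_seq k \<omega>) \<partial>S) = (\<integral>\<^sup>+\<omega>. f \<omega> \<partial>S)"
  by (subst nn_integral_comb_seq[where k = k]) (simp_all add: P.emeasure_space_1[simplified])

lemma integral_coord:
  fixes f :: "'s \<Rightarrow> real"
  assumes [measurable]: "f \<in> borel_measurable M"
  shows "(\<integral>\<omega>. f (\<omega> i) \<partial>S) = (\<integral>s. f s \<partial>M)"
proof -
  have "(\<integral>s. f s \<partial>distr S M (\<lambda>\<omega>. \<omega> i)) = (\<integral>\<omega>. f (\<omega> i) \<partial>S)"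
    by (rule integral_distr) auto
  then show ?thesis by (simp add: PiM_component)
qed

lemma integrable_coord:
  fixes f :: "'s \<Rightarrow> real"
  assumes "integrable M f"
  shows "integrable S (\<lambda>\<omega>. f (\<omega> i))"
proof -
  have "integrable (distr S M (\<lambda>\<omega>. \<omega> i)) f" using assms by (simp add: PiM_component)
  then show ?thesis by (rule integrable_distr[rotated]) auto
qed

section \<open>Subadditive processes that are often small\<close>

text \<open>
  The state \<open>x\<close> moves under \<open>T\<close>, and \<open>h n \<omega> x\<close> is the cost of \<open>n\<close> steps. Cut the orbit greedily: as long as the current point has an \<open>n \<le> N\<close> with \<open>h n \<le> l n\<close>, jump ahead
  by that \<open>n\<close>; otherwise pay \<open>\<psi> + |l|\<close> and move one step. The last at most \<open>N\<close> steps cannot be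
  controlled and are paid for in full.
\<close>
lemma greedy_cutting:
  fixes h :: "nat \<Rightarrow> (nat \<Rightarrow> 's) \<Rightarrow> 'x \<Rightarrow> real"
  assumes sub: "\<And>n k \<omega> x. x \<in> X \<Longrightarrow> h (n + k) \<omega> x \<le> h n \<omega> x + h k (drop_seq n \<omega>) (T n \<omega> x)"
    and T: "\<And>n k \<omega> x. x \<in> X \<Longrightarrow> T (n + k) \<omega> x = T k (drop_seq n \<omega>) (T n \<omega> x)"
      "\<And>n \<omega> x. x \<in> X \<Longrightarrow> T n \<omega> x \<in> X"
    and T0: "\<And>\<omega> x. x \<in> X \<Longrightarrow> T 0 \<omega> x = x"
    and bound: "\<And>n \<omega> x. x \<in> X \<Longrightarrow> \<bar>h n \<omega> x\<bar> \<le> (\<Sum>i<n. \<psi> (\<omega> i))"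
    and \<psi>: "\<And>s. 0 \<le> \<psi> s"
    and F: "\<And>i \<omega> x. F i \<omega> x = (\<psi> (\<omega> i) + \<bar>l\<bar>) *
        indicator {(\<omega>, x). \<forall>n\<in>{1..N}. l * real n < h n \<omega> x} (drop_seq i \<omega>, T i \<omega> x)"
    and x: "x \<in> X"
  shows "h m \<omega> x \<le> l * real m + (\<Sum>i<m. F i \<omega> x) + (\<Sum>i\<in>{m-N..<m}. \<psi> (\<omega> i) + \<bar>l\<bar>)"
  using x
proof (induction m arbitrary: \<omega> x rule: less_induct)
  case (less m)
  have F_nonneg: "0 \<le> F i \<omega> x" for i \<omega> x
    by (simp add: F \<psi>)
  have F_shift: "F i (drop_seq n \<omega>) (T n \<omega> x) = F (n + i) \<omega> x" for i n
    using less.prems by (simp add: F drop_seq_drop_seq drop_seq_apply T)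
  have jump: ?case if n: "1 \<le> n" "n \<le> m" "h n \<omega> x \<le> l * real n + (\<Sum>i<n. F i \<omega> x)" for n
  proof -
    have "h m \<omega> x \<le> h n \<omega> x + h (m - n) (drop_seq n \<omega>) (T n \<omega> x)"
      using sub[OF less.prems, of n "m - n" \<omega>] n by simp
    also have "h (m - n) (drop_seq n \<omega>) (T n \<omega> x)
        \<le> l * real (m - n) + (\<Sum>i<m-n. F (n + i) \<omega> x)
          + (\<Sum>i\<in>{m-n-N..<m-n}. \<psi> (drop_seq n \<omega> i) + \<bar>l\<bar>)"
      using less.IH[of "m - n" "T n \<omega> x" "drop_seq n \<omega>"] n T(2)[OF less.prems]
      unfolding F_shift by simp
    also have "(\<Sum>i<m-n. F (n + i) \<omega> x) = (\<Sum>i\<in>{n..<m}. F i \<omega> x)"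
      using n by (intro sum.reindex_bij_witness[of _ "\<lambda>i. i - n" "\<lambda>i. i + n"]) (auto simp: add.commute)
    also have "(\<Sum>i\<in>{m-n-N..<m-n}. \<psi> (drop_seq n \<omega> i) + \<bar>l\<bar>) = (\<Sum>i\<in>{m-n-N+n..<m}. \<psi> (\<omega> i) + \<bar>l\<bar>)"
      using n by (intro sum.reindex_bij_witness[of _ "\<lambda>i. i - n" "\<lambda>i. i + n"])
        (auto simp: add.commute drop_seq_apply)
    also have "\<dots> \<le> (\<Sum>i\<in>{m-N..<m}. \<psi> (\<omega> i) + \<bar>l\<bar>)"
      by (intro sum_mono2) (auto simp: \<psi>)
    finally have "h m \<omega> x \<le> (l * real n + (\<Sum>i<n. F i \<omega> x)) + (l * real (m - n)
        + (\<Sum>i\<in>{n..<m}. F i \<omega> x) + (\<Sum>i\<in>{m-N..<m}. \<psi> (\<omega> i) + \<bar>l\<bar>))"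
      using n(3) by simp
    also have "real (m - n) = real m - real n" using n by (simp add: of_nat_diff)
    finally have "h m \<omega> x \<le> l * real m + ((\<Sum>i<n. F i \<omega> x) + (\<Sum>i\<in>{n..<m}. F i \<omega> x))
        + (\<Sum>i\<in>{m-N..<m}. \<psi> (\<omega> i) + \<bar>l\<bar>)" by (simp add: algebra_simps)
    also have "(\<Sum>i<n. F i \<omega> x) + (\<Sum>i\<in>{n..<m}. F i \<omega> x) = (\<Sum>i<m. F i \<omega> x)"
      using n by (simp add: sum.atLeastLessThan_concat lessThan_atLeast0)
    finally show ?thesis .
  qed
  show ?case
  proof (cases "m = 0")
    case True
    then show ?thesis using bound[OF less.prems, of 0 \<omega>] by simp
  next
    case m: False
    show ?thesis
    proof (cases "\<forall>n\<in>{1..N}. l * real n < h n \<omega> x")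
      case True

      have "F 0 \<omega> x = \<psi> (\<omega> 0) + \<bar>l\<bar>" using True by (simp add: F T0[OF less.prems])
      then show ?thesis using bound[OF less.prems, of 1 \<omega>] m by (intro jump[of 1]) auto
    next
      case False
      then obtain n where n: "1 \<le> n" "n \<le> N" "h n \<omega> x \<le> l * real n" by auto
      show ?thesis
      proof (cases "n \<le> m")
        case True
        have "0 \<le> (\<Sum>i<n. F i \<omega> x)" by (intro sum_nonneg F_nonneg)
        then show ?thesis using n by (intro jump[OF n(1) True]) auto
      next
        case False
        then have "{m-N..<m} = {..<m}" using n by auto
        then have "(\<Sum>i\<in>{m-N..<m}. \<psi> (\<omega> i) + \<bar>l\<bar>) = (\<Sum>i<m. \<psi> (\<omega> i)) + real m * \<bar>l\<bar>"
          by (simp add: sum.distrib)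
        moreover have "0 \<le> l * real m + real m * \<bar>l\<bar>" by (cases "0 \<le> l") auto
        moreover have "h m \<omega> x \<le> (\<Sum>i<m. \<psi> (\<omega> i))" using bound[OF less.prems, of m \<omega>] by simp
        moreover have "0 \<le> (\<Sum>i<m. F i \<omega> x)" by (intro sum_nonneg F_nonneg)
        ultimately show ?thesis by simp
      qed
    qed
  qed
qed


text \<open>
  Integrating the greedy bound: the cost of the bad steps has expectation at most \<open>\<epsilon>\<close> per step
  because the position of the orbit at time \<open>i\<close> is independent of the letters from \<open>i\<close> on.
\<close>
lemma integral_le_of_often_small:
  fixes h :: "nat \<Rightarrow> (nat \<Rightarrow> 's) \<Rightarrow> 'x \<Rightarrow> real"
  assumes sub: "\<And>n k \<omega> x. x \<in> X \<Longrightarrow> h (n + k) \<omega> x \<le> h n \<omega> x + h k (drop_seq n \<omega>) (T n \<omega> x)"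
    and T: "\<And>n k \<omega> x. x \<in> X \<Longrightarrow> T (n + k) \<omega> x = T k (drop_seq n \<omega>) (T n \<omega> x)"
      "\<And>n \<omega> x. x \<in> X \<Longrightarrow> T n \<omega> x \<in> X"
    and T0: "\<And>\<omega> x. x \<in> X \<Longrightarrow> T 0 \<omega> x = x"
    and T_local: "\<And>n \<omega> \<omega>' x. x \<in> X \<Longrightarrow> T n (comb_seq n \<omega> \<omega>') x = T n \<omega> x"
    and meas: "\<And>n i x. x \<in> X \<Longrightarrow> (\<lambda>\<omega>. h n (drop_seq i \<omega>) (T i \<omega> x)) \<in> borel_measurable S"
    and bound: "\<And>n \<omega> x. x \<in> X \<Longrightarrow> \<bar>h n \<omega> x\<bar> \<le> (\<Sum>i<n. \<psi> (\<omega> i))"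
    and \<psi>: "\<And>s. 0 \<le> \<psi> s" "integrable M \<psi>" "integrable M (\<lambda>s. (\<psi> s)\<^sup>2)"
    and small: "\<And>\<epsilon>. 0 < \<epsilon> \<Longrightarrow> \<exists>N. \<forall>x\<in>X. measure S {\<omega>. \<forall>n\<in>{1..N}. l * real n < h n \<omega> x} \<le> \<epsilon>"
    and "0 < \<epsilon>"
  shows "\<exists>c. \<forall>m. \<forall>x\<in>X. (\<integral>\<omega>. h m \<omega> x \<partial>S) \<le> (l + \<epsilon>) * real m + c"
proof -
  have [measurable]: "\<psi> \<in> borel_measurable M" using \<psi>(2) by simp
  define B where "B = (\<integral>s. (\<psi> s + \<bar>l\<bar>)\<^sup>2 \<partial>M)"
  have B_int: "integrable M (\<lambda>s. (\<psi> s + \<bar>l\<bar>)\<^sup>2)"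
    using \<psi>(2,3) by (simp add: power2_sum)
  have B: "0 \<le> B" unfolding B_def by simp
  define t where "t = \<epsilon> / (B + 1)"
  have t: "0 < t" "t * B \<le> \<epsilon>" using B \<open>0 < \<epsilon>\<close> by (simp_all add: t_def field_simps)
  obtain N where N: "\<And>x. x \<in> X \<Longrightarrow> measure S {\<omega>. \<forall>n\<in>{1..N}. l * real n < h n \<omega> x} \<le> t * \<epsilon>"
    using small[OF mult_pos_pos[OF t(1) \<open>0 < \<epsilon>\<close>]] by blast
  define bad where "bad = {(\<omega>, x). \<forall>n\<in>{1..N}. l * real n < h n \<omega> x}"
  define F where "F i \<omega> x = (\<psi> (\<omega> i) + \<bar>l\<bar>) * indicator bad (drop_seq i \<omega>, T i \<omega> x)" for i \<omega> x
  have F_meas: "(\<lambda>\<omega>. F i \<omega> x) \<in> borel_measurable S" if "x \<in> X" for i x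
  proof -
    note [measurable] = meas[OF that]
    have "{\<omega> \<in> space S. \<forall>n\<in>{1..N}. l * real n < h n (drop_seq i \<omega>) (T i \<omega> x)} \<in> sets S"
      by measurable
    moreover have "indicator bad (drop_seq i \<omega>, T i \<omega> x) =
        (indicator {\<omega> \<in> space S. \<forall>n\<in>{1..N}. l * real n < h n (drop_seq i \<omega>) (T i \<omega> x)} \<omega> :: real)" for \<omega>
      by (simp add: bad_def indicator_def)
    ultimately show ?thesis unfolding F_def by simp
  qed
  have F_bounds: "0 \<le> F i \<omega> x" "F i \<omega> x \<le> \<psi> (\<omega> i) + \<bar>l\<bar>" for i \<omega> x
    using \<psi>(1)[of "\<omega> i"] by (auto simp: F_def indicator_def)
  have \<psi>_int: "integrable S (\<lambda>\<omega>. \<psi> (\<omega> i))" for i by (rule integrable_coord[OF \<psi>(2)])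
  have F_int: "integrable S (\<lambda>\<omega>. F i \<omega> x)" if "x \<in> X" for i x
    by (rule Bochner_Integration.integrable_bound[of S "\<lambda>\<omega>. \<psi> (\<omega> i) + \<bar>l\<bar>"])
      (use F_meas[OF that] F_bounds \<psi>_int \<psi>(1) in \<open>auto simp: abs_of_nonneg\<close>)
  have F0: "(\<integral>\<^sup>+\<omega>. ennreal (F 0 \<omega> x) \<partial>S) \<le> ennreal \<epsilon>" if x: "x \<in> X" for x
  proof -
    define A where "A = {\<omega>. \<forall>n\<in>{1..N}. l * real n < h n \<omega> x}"
    have A: "A \<in> sets S"
    proof -
      have [measurable]: "(\<lambda>\<omega>. h n \<omega> x) \<in> borel_measurable S" for n
        using meas[OF x, of n 0] x by (simp add: T0)
      have "{\<omega> \<in> space S. \<forall>n\<in>{1..N}. l * real n < h n \<omega> x} \<in> sets S" by measurable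
      then show ?thesis by (simp add: A_def)
    qed
    \<comment> \<open>The arithmetic-geometric mean inequality with weight \<open>t\<close> replaces Cauchy-Schwarz.\<close>
    have pw: "F 0 \<omega> x \<le> (t * (\<psi> (\<omega> 0) + \<bar>l\<bar>)\<^sup>2 + indicator A \<omega> / t) / 2" for \<omega>
    proof (cases "\<omega> \<in> A")
      case True
      have "0 \<le> (t * (\<psi> (\<omega> 0) + \<bar>l\<bar>) - 1)\<^sup>2 / t" using t by simp
      also have "\<dots> = t * (\<psi> (\<omega> 0) + \<bar>l\<bar>)\<^sup>2 - 2 * (\<psi> (\<omega> 0) + \<bar>l\<bar>) + 1 / t"
        using t by (simp add: power2_eq_square field_simps)
      finally show ?thesis using True F_bounds(2)[of 0 \<omega> x] by simp
    next
      case False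
      then show ?thesis using x t by (simp add: F_def A_def bad_def T0)
    qed
    have "(\<integral>\<omega>. F 0 \<omega> x \<partial>S) \<le> (\<integral>\<omega>. (t * (\<psi> (\<omega> 0) + \<bar>l\<bar>)\<^sup>2 + indicator A \<omega> / t) / 2 \<partial>S)"
      by (intro integral_mono F_int x pw)
        (use A integrable_coord[OF B_int, of 0] in \<open>auto intro!: integrable_real_indicator simp: emeasure_eq_measure\<close>)
    also have "\<dots> = (t * B + measure S A / t) / 2"
      using A integrable_coord[OF B_int, of 0] integral_coord[of "\<lambda>s. (\<psi> s + \<bar>l\<bar>)\<^sup>2" 0]
      by (subst Bochner_Integration.integral_divide_zero, subst Bochner_Integration.integral_add)
        (auto simp: B_def emeasure_eq_measure)
    also have "\<dots> \<le> (\<epsilon> + \<epsilon>) / 2"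
      using t N[OF x] by (intro divide_right_mono add_mono) (auto simp: A_def field_simps)
    finally have "(\<integral>\<omega>. F 0 \<omega> x \<partial>S) \<le> \<epsilon>" by simp
    then show ?thesis
      by (subst nn_integral_eq_integral[OF F_int[OF x]]) (auto simp: F_bounds ennreal_leI)
  qed
  have F_le: "(\<integral>\<omega>. F i \<omega> x \<partial>S) \<le> \<epsilon>" if x: "x \<in> X" for i x
  proof -
    have [measurable]: "(\<lambda>\<omega>. F i \<omega> x) \<in> borel_measurable S" by (rule F_meas[OF x])
    have shift: "F i (comb_seq i \<omega> \<omega>') x = F 0 \<omega>' (T i \<omega> x)" for \<omega> \<omega>'
      using T_local[OF x, of i \<omega> \<omega>'] T(2)[OF x, of i \<omega>] comb_seq_add[of i \<omega> \<omega>' 0]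
      by (simp add: F_def T0)
    have "(\<integral>\<^sup>+\<omega>. ennreal (F i \<omega> x) \<partial>S) = (\<integral>\<^sup>+\<omega>. \<integral>\<^sup>+\<omega>'. ennreal (F 0 \<omega>' (T i \<omega> x)) \<partial>S \<partial>S)"
      by (subst nn_integral_comb_seq[where k = i]) (auto simp: shift)
    also have "\<dots> \<le> (\<integral>\<^sup>+\<omega>. ennreal \<epsilon> \<partial>S)"
      by (intro nn_integral_mono F0 T(2) x)
    also have "\<dots> = ennreal \<epsilon>" by (simp add: P.emeasure_space_1[simplified])
    finally show ?thesis using \<open>0 < \<epsilon>\<close>
      by (subst (asm) nn_integral_eq_integral[OF F_int[OF x]]) (auto simp: F_bounds ennreal_le_iff)
  qed
  define c where "c = real N * ((\<integral>s. \<psi> s \<partial>M) + \<bar>l\<bar>)"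
  have "(\<integral>\<omega>. h m \<omega> x \<partial>S) \<le> (l + \<epsilon>) * real m + c" if x: "x \<in> X" for m x
  proof -
    have h_meas: "(\<lambda>\<omega>. h m \<omega> x) \<in> borel_measurable S" using meas[OF x, of m 0] x by (simp add: T0)
    have h_int: "integrable S (\<lambda>\<omega>. h m \<omega> x)"
      by (rule Bochner_Integration.integrable_bound[of S "\<lambda>\<omega>. \<Sum>i<m. \<psi> (\<omega> i)"])
        (use h_meas bound[OF x] \<psi>_int \<psi>(1) in \<open>auto simp: sum_nonneg abs_of_nonneg\<close>)
    have "(\<integral>\<omega>. h m \<omega> x \<partial>S)
        \<le> (\<integral>\<omega>. l * real m + (\<Sum>i<m. F i \<omega> x) + (\<Sum>i\<in>{m-N..<m}. \<psi> (\<omega> i) + \<bar>l\<bar>) \<partial>S)"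
    proof (rule integral_mono[OF h_int])
      show "integrable S (\<lambda>\<omega>. l * real m + (\<Sum>i<m. F i \<omega> x) + (\<Sum>i\<in>{m-N..<m}. \<psi> (\<omega> i) + \<bar>l\<bar>))"
        using F_int[OF x] \<psi>_int by simp
      show "h m \<omega> x \<le> l * real m + (\<Sum>i<m. F i \<omega> x) + (\<Sum>i\<in>{m-N..<m}. \<psi> (\<omega> i) + \<bar>l\<bar>)" for \<omega>
        by (rule greedy_cutting[of X h T]) (use sub T T0 bound \<psi>(1) x in \<open>auto simp: F_def bad_def\<close>)
    qed
    also have "\<dots> = l * real m + (\<Sum>i<m. \<integral>\<omega>. F i \<omega> x \<partial>S) + (\<Sum>i\<in>{m-N..<m}. (\<integral>s. \<psi> s \<partial>M) + \<bar>l\<bar>)"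
      using F_int[OF x] \<psi>_int by (simp add: integral_coord P.prob_space[simplified])
    also have "\<dots> \<le> l * real m + (\<Sum>i<m. \<epsilon>) + c"
    proof (intro add_mono order_refl sum_mono F_le x)
      have "0 \<le> (\<integral>s. \<psi> s \<partial>M)" using \<psi>(1) by simp
      then show "(\<Sum>i\<in>{m-N..<m}. (\<integral>s. \<psi> s \<partial>M) + \<bar>l\<bar>) \<le> c"
        by (simp add: c_def mult_right_mono)
    qed
    finally show ?thesis by (simp add: algebra_simps)
  qed
  then show ?thesis by blast
qed

end

section \<open>Furstenberg-Kesten for subadditive functions of independent letters\<close>

lemma exp_le_quadratic: "exp w \<le> 1 + w + w\<^sup>2 * exp \<bar>w :: real\<bar>"
proof -
  have conv: "exp v - 1 \<le> v * exp v" for v :: real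
  proof -
    have "exp v * (1 - v) \<le> exp v * exp (- v)"
      using exp_ge_add_one_self[of "- v"] by (intro mult_left_mono) auto
    then show ?thesis by (simp add: exp_minus algebra_simps)
  qed
  have "exp w - 1 - w \<le> w * (exp w - 1)" using conv[of w] by (simp add: algebra_simps)
  also have "\<dots> \<le> w\<^sup>2 * exp \<bar>w\<bar>"
  proof (cases "0 \<le> w")
    case True
    then have "w * (exp w - 1) \<le> w * (w * exp w)" by (intro mult_left_mono conv)
    then show ?thesis using True by (simp add: power2_eq_square mult.assoc)
  next
    case False
    then have "w * (exp w - 1) \<le> w * w"
      using exp_ge_add_one_self[of w] by (intro mult_left_mono_neg) linarith+
    also have "\<dots> = w\<^sup>2 * 1" by (simp add: power2_eq_square)
    also have "\<dots> \<le> w\<^sup>2 * exp \<bar>w\<bar>" by (intro mult_left_mono) auto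
    finally show ?thesis .
  qed
  finally show ?thesis by simp
qed

lemma square_le_exp:
  assumes "0 < \<eta>"
  shows "x\<^sup>2 \<le> 2 / \<eta>\<^sup>2 * exp (\<eta> * \<bar>x :: real\<bar>)"
proof -
  have "1 + \<eta> * \<bar>x\<bar> + (\<eta> * \<bar>x\<bar>)\<^sup>2 / 2 \<le> exp (\<eta> * \<bar>x\<bar>)"
    using assms by (intro exp_lower_Taylor_quadratic) simp
  moreover have "0 \<le> \<eta> * \<bar>x\<bar>" using assms by simp
  ultimately have "(\<eta> * \<bar>x\<bar>)\<^sup>2 / 2 \<le> exp (\<eta> * \<bar>x\<bar>)" by linarith
  then show ?thesis using assms by (simp add: power_mult_distrib field_simps)
qed

text \<open>
  Expanding \<open>exp (\<theta> X)\<close> to second order; the remainder is bounded by a two-sided exponential moment,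
  since squares are dominated by exponentials. When the mean is negative, the moment is less than one for
  small \<open>\<theta>\<close>, with a margin that depends on \<open>X\<close> only through its mean and \<open>C\<close>.
\<close>
lemma (in prob_space) small_exponential_moment:
  fixes X :: "'a \<Rightarrow> real"
  assumes [measurable]: "X \<in> borel_measurable M"
    and C: "(\<integral>\<^sup>+\<omega>. ennreal (exp (2 * \<eta> * \<bar>X \<omega>\<bar>)) \<partial>M) \<le> ennreal C" "0 \<le> C"
    and \<theta>: "0 \<le> \<theta>" "\<theta> \<le> \<eta>" "0 < \<eta>"
  shows "integrable M X"
    and "(\<integral>\<^sup>+\<omega>. ennreal (exp (\<theta> * X \<omega>)) \<partial>M) \<le> ennreal (1 + \<theta> * expectation X + \<theta>\<^sup>2 * (2 * C / \<eta>\<^sup>2))"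
proof -
  let ?E = "\<lambda>\<omega>. exp (2 * \<eta> * \<bar>X \<omega>\<bar>)"
  have E_int: "integrable M ?E"
    using C by (intro integrableI_bounded) (auto intro: le_less_trans)
  have "\<bar>X \<omega>\<bar> \<le> ?E \<omega> / \<eta>" for \<omega>
  proof -
    have "2 * \<eta> * \<bar>X \<omega>\<bar> \<le> ?E \<omega>" using exp_ge_add_one_self[of "2 * \<eta> * \<bar>X \<omega>\<bar>"] by linarith
    moreover have "\<eta> * \<bar>X \<omega>\<bar> \<le> 2 * \<eta> * \<bar>X \<omega>\<bar>" using \<theta> by simp
    ultimately have "\<eta> * \<bar>X \<omega>\<bar> \<le> ?E \<omega>" by linarith
    then show ?thesis using \<theta>(3) by (simp add: field_simps)
  qed
  then show X_int: "integrable M X"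
    using E_int \<theta>(3) by (intro Bochner_Integration.integrable_bound[of M "\<lambda>\<omega>. ?E \<omega> / \<eta>" X]) auto
  have E_le: "(\<integral>\<omega>. ?E \<omega> \<partial>M) \<le> C"
    using C E_int by (subst (asm) nn_integral_eq_integral) (auto simp: ennreal_le_iff)
  have pw: "exp (\<theta> * X \<omega>) \<le> 1 + \<theta> * X \<omega> + \<theta>\<^sup>2 * (2 / \<eta>\<^sup>2 * ?E \<omega>)" for \<omega>
  proof -
    have "exp (\<theta> * X \<omega>) \<le> 1 + \<theta> * X \<omega> + (\<theta> * X \<omega>)\<^sup>2 * exp \<bar>\<theta> * X \<omega>\<bar>" by (rule exp_le_quadratic)
    also have "(\<theta> * X \<omega>)\<^sup>2 * exp \<bar>\<theta> * X \<omega>\<bar> = \<theta>\<^sup>2 * ((X \<omega>)\<^sup>2 * exp \<bar>\<theta> * X \<omega>\<bar>)"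
      by (simp add: power_mult_distrib)
    also have "(X \<omega>)\<^sup>2 * exp \<bar>\<theta> * X \<omega>\<bar> \<le> (2 / \<eta>\<^sup>2 * exp (\<eta> * \<bar>X \<omega>\<bar>)) * exp (\<eta> * \<bar>X \<omega>\<bar>)"
      using \<theta> by (intro mult_mono square_le_exp) (auto simp: abs_mult mult_right_mono)
    also have "\<dots> = 2 / \<eta>\<^sup>2 * ?E \<omega>" by (simp add: exp_add[symmetric] mult.assoc)
    finally show ?thesis by (simp add: mult_left_mono)
  qed
  have "(\<integral>\<^sup>+\<omega>. ennreal (exp (\<theta> * X \<omega>)) \<partial>M)
      \<le> (\<integral>\<^sup>+\<omega>. ennreal (1 + \<theta> * X \<omega> + \<theta>\<^sup>2 * (2 / \<eta>\<^sup>2 * ?E \<omega>)) \<partial>M)"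
    by (intro nn_integral_mono ennreal_leI pw)
  also have "\<dots> = ennreal (\<integral>\<omega>. 1 + \<theta> * X \<omega> + \<theta>\<^sup>2 * (2 / \<eta>\<^sup>2 * ?E \<omega>) \<partial>M)"
    using X_int E_int pw by (intro nn_integral_eq_integral) (auto intro!: AE_I2 order_trans[OF exp_ge_zero])
  also have "(\<integral>\<omega>. 1 + \<theta> * X \<omega> + \<theta>\<^sup>2 * (2 / \<eta>\<^sup>2 * ?E \<omega>) \<partial>M)
      = 1 + \<theta> * expectation X + \<theta>\<^sup>2 * (2 / \<eta>\<^sup>2 * (\<integral>\<omega>. ?E \<omega> \<partial>M))"
    using X_int E_int by (simp add: prob_space)
  also have "\<dots> \<le> 1 + \<theta> * expectation X + \<theta>\<^sup>2 * (2 / \<eta>\<^sup>2 * C)"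
    using E_le by (intro add_left_mono mult_left_mono) auto
  finally show "(\<integral>\<^sup>+\<omega>. ennreal (exp (\<theta> * X \<omega>)) \<partial>M)
      \<le> ennreal (1 + \<theta> * expectation X + \<theta>\<^sup>2 * (2 * C / \<eta>\<^sup>2))"
    by (simp add: ennreal_leI)
qed

context letters
begin

lemma nn_integral_prod_coord:
  fixes f :: "'s \<Rightarrow> ennreal"
  assumes [measurable]: "f \<in> borel_measurable M"
  shows "(\<integral>\<^sup>+\<omega>. (\<Prod>i<n. f (\<omega> i)) \<partial>S) = (\<integral>\<^sup>+s. f s \<partial>M) ^ n"
proof (induction n)
  case 0
  then show ?case by (simp add: P.emeasure_space_1[simplified])
next
  case (Suc n)
  have "(\<integral>\<^sup>+\<omega>. (\<Prod>i<Suc n. f (\<omega> i)) \<partial>S) = (\<integral>\<^sup>+s. \<integral>\<^sup>+\<omega>. f s * (\<Prod>i<n. f (\<omega> i)) \<partial>S \<partial>M)"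
    by (subst nn_integral_case_nat) (simp_all add: prod.lessThan_Suc_shift del: prod.lessThan_Suc)
  also have "\<dots> = (\<integral>\<^sup>+s. f s \<partial>M) * (\<integral>\<^sup>+s. f s \<partial>M) ^ n"
    by (simp add: nn_integral_cmult nn_integral_multc Suc)
  finally show ?case by simp
qed

text \<open>
  The events that can be approximated by cylinders form a \<open>\<sigma>\<close>-algebra: a countable union is
  exhausted up to small probability by finitely many of its members, and finitely many cylinders depend
  on finitely many letters together.
\<close>
lemma cylinder_approximation:
  assumes "V \<in> sets S" "0 < \<epsilon>"
  shows "\<exists>k U. U \<in> sets S \<and> (\<forall>\<omega> \<omega>'. (\<forall>i<k. \<omega> i = \<omega>' i) \<longrightarrow> (\<omega> \<in> U \<longleftrightarrow> \<omega>' \<in> U))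
    \<and> measure S (sym_diff U V) \<le> \<epsilon>"
proof -
  let ?G = "{{f \<in> \<Pi>\<^sub>E i\<in>UNIV. space M. f i \<in> A} |i A. i \<in> (UNIV :: nat set) \<and> A \<in> sets M}"
  have sets_S: "sets S = sigma_sets (\<Pi>\<^sub>E i\<in>UNIV. space M) ?G" by (rule sets_PiM_single)
  have "V \<in> sigma_sets (\<Pi>\<^sub>E i\<in>UNIV. space M) ?G" using assms(1) sets_S by blast
  then show ?thesis using assms(2)
  proof (induction V arbitrary: \<epsilon> rule: sigma_sets.induct)
    case (Basic V)
    then obtain i A where V: "V = {f \<in> \<Pi>\<^sub>E i\<in>UNIV. space M. f i \<in> A}" "A \<in> sets M" by blast
    have "V \<in> sets S" using Basic(1) sets_S by blast
    then show ?case
      by (intro exI[of _ "Suc i"] exI[of _ V]) (use Basic V in \<open>auto simp: space_M\<close>)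
  next
    case Empty
    then show ?case by (intro exI[of _ 0] exI[of _ "{}"]) auto
  next
    case (Compl V)
    obtain k U where U: "U \<in> sets S" "\<And>\<omega> \<omega>'. (\<forall>i<k. \<omega> i = \<omega>' i) \<Longrightarrow> (\<omega> \<in> U \<longleftrightarrow> \<omega>' \<in> U)"
      "measure S (sym_diff U V) \<le> \<epsilon>" using Compl.IH[OF Compl.prems] by blast
    have "sym_diff (UNIV - U) (UNIV - V) = sym_diff U V" by blast
    moreover have "(\<Pi>\<^sub>E i\<in>(UNIV :: nat set). space M) = UNIV" by (auto simp: space_M)
    moreover have "UNIV - U \<in> sets S" using sets.compl_sets[OF U(1)] by simp
    ultimately show ?case using U by (intro exI[of _ k] exI[of _ "UNIV - U"]) auto
  next
    case (Union a)
    have a_sets: "a i \<in> sets S" for i using Union.hyps sets_S by blast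
    have "(\<lambda>n. measure S (\<Union>i<n. a i)) \<longlonglongrightarrow> measure S (\<Union>n. \<Union>i<n. a i)"
      using a_sets by (intro finite_Lim_measure_incseq) (auto simp: incseq_def intro: less_le_trans)
    moreover have "(\<Union>n. \<Union>i<n. a i) = (\<Union>i. a i)" by auto
    ultimately have lim: "(\<lambda>n. measure S (\<Union>i<n. a i)) \<longlonglongrightarrow> measure S (\<Union>i. a i)" by simp
    then have "\<forall>\<^sub>F n in sequentially. measure S (\<Union>i. a i) - \<epsilon> / 2 < measure S (\<Union>i<n. a i)"
      using \<open>0 < \<epsilon>\<close> by (intro order_tendstoD(1)[OF lim]) simp
    then obtain n where n: "measure S (\<Union>i. a i) - \<epsilon> / 2 < measure S (\<Union>i<n. a i)"
      using eventually_sequentially by auto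
    let ?e = "\<epsilon> / (2 * real (Suc n))"
    have e: "0 < ?e" using \<open>0 < \<epsilon>\<close> by simp
    define Q where "Q i kU \<longleftrightarrow> snd kU \<in> sets S \<and>
        (\<forall>\<omega> \<omega>'. (\<forall>i<fst kU. \<omega> i = \<omega>' i) \<longrightarrow> (\<omega> \<in> snd kU \<longleftrightarrow> \<omega>' \<in> snd kU))
        \<and> measure S (sym_diff (snd kU) (a i)) \<le> ?e" for i and kU :: "nat \<times> (nat \<Rightarrow> 's) set"
    have "\<exists>kU. Q i kU" for i
    proof -
      obtain k U where "Q i (k, U)" unfolding Q_def fst_conv snd_conv using Union.IH[OF e, of i] by blast
      then show ?thesis by blast
    qed
    then have "\<exists>kU. \<forall>i. Q i (kU i)" by (intro choice) simp
    then obtain kU where kU_Q: "\<And>i. Q i (kU i)" by blast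
    have kU: "\<And>i. snd (kU i) \<in> sets S"
        "\<And>i \<omega> \<omega>'. (\<forall>j<fst (kU i). \<omega> j = \<omega>' j) \<Longrightarrow> (\<omega> \<in> snd (kU i) \<longleftrightarrow> \<omega>' \<in> snd (kU i))"
        "\<And>i. measure S (sym_diff (snd (kU i)) (a i)) \<le> ?e"
      using kU_Q unfolding Q_def by blast+
    define k where "k = (\<Sum>i<n. fst (kU i))"
    define U where "U = (\<Union>i<n. snd (kU i))"
    have U: "U \<in> sets S" unfolding U_def using kU(1) by auto
    have kle: "fst (kU i) \<le> k" if "i < n" for i
      unfolding k_def using that by (intro member_le_sum) auto
    have cyl: "\<omega> \<in> U \<longleftrightarrow> \<omega>' \<in> U" if "\<forall>i<k. \<omega> i = \<omega>' i" for \<omega> \<omega>'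
    proof -
      have "\<omega> \<in> snd (kU i) \<longleftrightarrow> \<omega>' \<in> snd (kU i)" if "i < n" for i
        using kle[OF that] \<open>\<forall>i<k. \<omega> i = \<omega>' i\<close> by (intro kU(2)) auto
      then show ?thesis by (auto simp: U_def)
    qed
    have "measure S (sym_diff U (\<Union>i. a i))
        \<le> measure S (((\<Union>i. a i) - (\<Union>i<n. a i)) \<union> (\<Union>i<n. sym_diff (snd (kU i)) (a i)))"
      using a_sets kU(1) by (intro finite_measure_mono) (auto simp: U_def)
    also have "\<dots> \<le> measure S ((\<Union>i. a i) - (\<Union>i<n. a i)) + measure S (\<Union>i<n. sym_diff (snd (kU i)) (a i))"
      using a_sets kU(1) by (intro measure_Un_le) auto
    also have "measure S ((\<Union>i. a i) - (\<Union>i<n. a i)) \<le> \<epsilon> / 2"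
      using n a_sets by (subst finite_measure_Diff) auto
    also have "measure S (\<Union>i<n. sym_diff (snd (kU i)) (a i)) \<le> (\<Sum>i<n. measure S (sym_diff (snd (kU i)) (a i)))"
      using a_sets kU(1) by (intro measure_UNION_le) auto
    also have "\<dots> \<le> (\<Sum>i<n. ?e)" by (intro sum_mono kU(3))
    also have "\<dots> \<le> \<epsilon> / 2" using \<open>0 < \<epsilon>\<close> by (simp add: field_simps)
    finally have "measure S (sym_diff U (\<Union>i. a i)) \<le> \<epsilon>" by simp
    then show ?case using U cyl by blast
  qed
qed

text \<open>
  The part of Levy's zero-one law that is needed. For a cylinder \<open>U\<close> close to \<open>V\<close>, the average of the
  conditional probabilities of \<open>V\<close> over the words in \<open>U\<close> is close to one, so one of them is.
\<close>
lemma almost_certain_after_word: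
  assumes V: "V \<in> sets S" "0 < measure S V" and \<epsilon>: "0 < \<epsilon>"
  shows "\<exists>k \<omega>. 1 - \<epsilon> \<le> measure S {\<omega>'. comb_seq k \<omega> \<omega>' \<in> V}"
proof (rule ccontr)
  assume "\<not> ?thesis"
  then have small: "measure S {\<omega>'. comb_seq k \<omega> \<omega>' \<in> V} < 1 - \<epsilon>" for k \<omega>
    by (meson not_le)
  have \<epsilon>1: "\<epsilon> < 1" using le_less_trans[OF measure_nonneg small] by simp
  define \<eta> where "\<eta> = \<epsilon> * measure S V / 4"
  obtain k U where U: "U \<in> sets S" "\<And>\<omega> \<omega>'. (\<forall>i<k. \<omega> i = \<omega>' i) \<Longrightarrow> (\<omega> \<in> U \<longleftrightarrow> \<omega>' \<in> U)"
    "measure S (sym_diff U V) \<le> \<eta>"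
    using cylinder_approximation[OF V(1), of \<eta>] V \<epsilon> by (auto simp: \<eta>_def)
  have comb: "comb_seq k \<omega> \<omega>' \<in> U \<longleftrightarrow> \<omega> \<in> U" for \<omega> \<omega>'
    by (rule U(2)) (simp add: comb_seq_less)
  have [measurable]: "Measurable.pred S (\<lambda>\<omega>. \<omega> \<in> V)" "Measurable.pred S (\<lambda>\<omega>. \<omega> \<in> U)"
    using V(1) U(1) by (simp_all add: pred_def)
  have ind: "indicator (U \<inter> V) (comb_seq k \<omega> \<omega>')
      = (indicator U \<omega> * indicator {\<omega>'. comb_seq k \<omega> \<omega>' \<in> V} \<omega>' :: ennreal)" for \<omega> \<omega>'
    by (auto simp: indicator_def comb)
  have sec: "{\<omega>'. comb_seq k \<omega> \<omega>' \<in> V} \<in> sets S" for \<omega>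
  proof -
    have "{\<omega>' \<in> space S. comb_seq k \<omega> \<omega>' \<in> V} \<in> sets S" by measurable
    then show ?thesis by simp
  qed
  have "emeasure S (U \<inter> V) = (\<integral>\<^sup>+\<omega>. indicator (U \<inter> V) \<omega> \<partial>S)" using U V by simp
  also have "\<dots> = (\<integral>\<^sup>+\<omega>. \<integral>\<^sup>+\<omega>'. indicator (U \<inter> V) (comb_seq k \<omega> \<omega>') \<partial>S \<partial>S)"
    using U V by (intro nn_integral_comb_seq) auto
  also have "\<dots> = (\<integral>\<^sup>+\<omega>. indicator U \<omega> * emeasure S {\<omega>'. comb_seq k \<omega> \<omega>' \<in> V} \<partial>S)"
    unfolding ind using sec by (intro nn_integral_cong) (simp add: nn_integral_cmult)
  also have "\<dots> \<le> (\<integral>\<^sup>+\<omega>. indicator U \<omega> * ennreal (1 - \<epsilon>) \<partial>S)"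
    unfolding emeasure_eq_measure
    by (intro nn_integral_mono mult_left_mono ennreal_leI less_imp_le[OF small]) simp
  also have "\<dots> = ennreal (1 - \<epsilon>) * emeasure S U"
    using U by (simp add: nn_integral_multc mult.commute)
  finally have "measure S (U \<inter> V) \<le> (1 - \<epsilon>) * measure S U"
    using \<epsilon>1 by (simp add: emeasure_eq_measure ennreal_mult'[symmetric] ennreal_le_iff)
  moreover have "measure S U \<le> measure S (U \<inter> V) + \<eta>"
  proof -
    have "measure S U \<le> measure S ((U \<inter> V) \<union> sym_diff U V)"
      using U V by (intro finite_measure_mono) auto
    also have "\<dots> \<le> measure S (U \<inter> V) + measure S (sym_diff U V)"
      using U V by (intro measure_Un_le) auto
    finally show ?thesis using U(3) by simp
  qed
  moreover have "measure S V \<le> measure S U + \<eta>"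
  proof -
    have "measure S V \<le> measure S (U \<union> sym_diff U V)"
      using U V by (intro finite_measure_mono) auto
    also have "\<dots> \<le> measure S U + measure S (sym_diff U V)"
      using U V by (intro measure_Un_le) auto
    finally show ?thesis using U(3) by simp
  qed
  ultimately have "\<epsilon> * measure S U \<le> \<eta>" "measure S V \<le> measure S U + \<eta>"
    by (simp_all add: algebra_simps)
  then have "\<epsilon> * measure S V \<le> \<eta> + \<epsilon> * \<eta>"
    using \<epsilon> by (smt (verit) distrib_left mult_left_mono)
  moreover have "\<epsilon> * \<eta> \<le> 1 * \<eta>" using \<epsilon>1 V \<epsilon> by (intro mult_right_mono) (auto simp: \<eta>_def)
  ultimately have "\<epsilon> * measure S V \<le> \<epsilon> * measure S V / 2" by (simp add: \<eta>_def)
  then show False using \<epsilon> V by simp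
qed


lemma distr_drop_seq: "distr S S (drop_seq k) = S"
proof (rule measure_eqI)
  fix A assume A: "A \<in> sets (distr S S (drop_seq k))"
  then have "emeasure (distr S S (drop_seq k)) A = (\<integral>\<^sup>+\<omega>. indicator A \<omega> \<partial>distr S S (drop_seq k))"
    by (subst nn_integral_indicator) auto
  also have "\<dots> = (\<integral>\<^sup>+\<omega>. indicator A (drop_seq k \<omega>) \<partial>S)"
    using A by (intro nn_integral_distr) auto
  also have "\<dots> = (\<integral>\<^sup>+\<omega>. indicator A \<omega> \<partial>S)"
    using A by (intro nn_integral_drop_seq) auto
  finally show "emeasure (distr S S (drop_seq k)) A = emeasure S A"
    using A by simp
qed simp

lemma integral_drop_seq:
  fixes f :: "(nat \<Rightarrow> 's) \<Rightarrow> real"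
  assumes [measurable]: "f \<in> borel_measurable S"
  shows "(\<integral>\<omega>. f (drop_seq k \<omega>) \<partial>S) = (\<integral>\<omega>. f \<omega> \<partial>S)"
proof -
  have "(\<integral>\<omega>. f \<omega> \<partial>distr S S (drop_seq k)) = (\<integral>\<omega>. f (drop_seq k \<omega>) \<partial>S)"
    by (rule integral_distr) auto
  then show ?thesis by (simp add: distr_drop_seq)
qed

lemma integrable_drop_seq:
  fixes f :: "(nat \<Rightarrow> 's) \<Rightarrow> real"
  assumes "integrable S f"
  shows "integrable S (\<lambda>\<omega>. f (drop_seq k \<omega>))"
proof -
  have "integrable (distr S S (drop_seq k)) f" using assms by (simp add: distr_drop_seq)
  then show ?thesis by (rule integrable_distr[rotated]) auto
qed

end

text \<open>
  The hypothesis \<open>drop\<close> complements subadditivity: forgetting some initial letters changes the process only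
  by a bounded amount, so that its asymptotic behaviour is determined by the tail.
\<close>
locale subadditive_process = letters M for M :: "'s measure" +
  fixes h :: "nat \<Rightarrow> (nat \<Rightarrow> 's) \<Rightarrow> real" and \<psi> :: "'s \<Rightarrow> real" and \<eta> :: real
  assumes h_meas [measurable]: "\<And>n. h n \<in> borel_measurable S"
    and sub: "\<And>n k \<omega>. h (n + k) \<omega> \<le> h n \<omega> + h k (drop_seq n \<omega>)"
    and local: "\<And>n \<omega> \<omega>'. h n (comb_seq n \<omega> \<omega>') = h n \<omega>"
    and bound: "\<And>n \<omega>. \<bar>h n \<omega>\<bar> \<le> (\<Sum>i<n. \<psi> (\<omega> i))"
    and drop: "\<And>n k \<omega>. h k (drop_seq n \<omega>) \<le> h (n + k) \<omega> + (\<Sum>i<n. \<psi> (\<omega> i))"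
    and \<psi>: "\<And>s. 0 \<le> \<psi> s" "\<psi> \<in> borel_measurable M"
    and \<eta>: "0 < \<eta>" "integrable M (\<lambda>s. exp (\<eta> * \<psi> s))"
begin

lemma \<psi>_int: "integrable M \<psi>" "integrable M (\<lambda>s. (\<psi> s)\<^sup>2)"
proof -
  note [measurable] = \<psi>(2)
  have 1: "\<psi> s \<le> exp (\<eta> * \<psi> s) / \<eta>" for s
  proof -
    have "\<eta> * \<psi> s \<le> exp (\<eta> * \<psi> s)" using exp_ge_add_one_self[of "\<eta> * \<psi> s"] by linarith
    then show ?thesis using \<eta>(1) by (simp add: field_simps)
  qed
  show "integrable M \<psi>"
    using \<eta> \<psi>(1) 1 by (intro Bochner_Integration.integrable_bound[of M "\<lambda>s. exp (\<eta> * \<psi> s) / \<eta>" \<psi>]) auto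
  have 2: "(\<psi> s)\<^sup>2 \<le> 2 / \<eta>\<^sup>2 * exp (\<eta> * \<psi> s)" for s
    using square_le_exp[OF \<eta>(1), of "\<psi> s"] \<psi>(1)[of s] by simp
  show "integrable M (\<lambda>s. (\<psi> s)\<^sup>2)"
  proof (rule Bochner_Integration.integrable_bound)
    show "integrable M (\<lambda>s. 2 / \<eta>\<^sup>2 * exp (\<eta> * \<psi> s))"
      by (rule integrable_mult_right) (rule \<eta>(2))
    show "AE s in M. norm ((\<psi> s)\<^sup>2) \<le> norm (2 / \<eta>\<^sup>2 * exp (\<eta> * \<psi> s))"
      by (rule AE_I2) (use 2 in \<open>auto intro: order_trans[OF _ abs_ge_self]\<close>)
  qed measurable
qed

lemma h_int: "integrable S (h n)"
proof (rule Bochner_Integration.integrable_bound)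
  show "integrable S (\<lambda>\<omega>. \<Sum>i<n. \<psi> (\<omega> i))"
    by (intro Bochner_Integration.integrable_sum integrable_coord \<psi>_int)
  show "AE \<omega> in S. norm (h n \<omega>) \<le> norm (\<Sum>i<n. \<psi> (\<omega> i))"
    unfolding real_norm_def by (intro AE_I2 order_trans[OF bound abs_ge_self])
qed measurable

definition mean :: "nat \<Rightarrow> real" where
  "mean n = (\<integral>\<omega>. h n \<omega> \<partial>S)"

definition rate :: real where
  "rate = (INF n\<in>{1..}. mean n / real n)"

lemma abs_mean_le: "\<bar>mean n\<bar> \<le> real n * (\<integral>s. \<psi> s \<partial>M)"
proof -
  have "\<bar>mean n\<bar> \<le> (\<integral>\<omega>. \<bar>h n \<omega>\<bar> \<partial>S)" unfolding mean_def by (rule integral_abs_bound)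
  also have "\<dots> \<le> (\<integral>\<omega>. (\<Sum>i<n. \<psi> (\<omega> i)) \<partial>S)"
    by (intro integral_mono bound integrable_abs h_int Bochner_Integration.integrable_sum
        integrable_coord \<psi>_int)
  also have "\<dots> = real n * (\<integral>s. \<psi> s \<partial>M)"
    using integrable_coord[OF \<psi>_int(1)] integral_coord[OF \<psi>(2)] by simp
  finally show ?thesis .
qed

lemma mean_add_le: "mean (n + k) \<le> mean n + mean k"
proof -
  have "mean (n + k) \<le> (\<integral>\<omega>. h n \<omega> + h k (drop_seq n \<omega>) \<partial>S)"
    unfolding mean_def
    by (intro integral_mono sub h_int Bochner_Integration.integrable_add integrable_drop_seq)
  also have "\<dots> = mean n + mean k"
    using h_int integrable_drop_seq[OF h_int] by (simp add: mean_def integral_drop_seq)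
  finally show ?thesis .
qed

lemma mean_ratio_bdd_below: "bdd_below ((\<lambda>n. mean n / real n) ` {1..})"
proof (rule bdd_belowI2)
  fix n :: nat assume "n \<in> {1..}"
  then show "- (\<integral>s. \<psi> s \<partial>M) \<le> mean n / real n" using abs_mean_le[of n] by (simp add: field_simps)
qed

lemma rate_le: "rate * real n \<le> mean n"
proof (cases "n = 0")
  case True
  then show ?thesis using abs_mean_le[of 0] by simp
next
  case False
  then have "rate \<le> mean n / real n"
    unfolding rate_def by (intro cINF_lower mean_ratio_bdd_below) auto
  then show ?thesis using False by (simp add: field_simps)
qed

lemma ex_mean_less:
  assumes "0 < \<epsilon>"
  obtains k where "1 \<le> k" "mean k < (rate + \<epsilon>) * real k"
proof -
  have "(INF n\<in>{1..}. mean n / real n) < rate + \<epsilon>" using assms by (simp add: rate_def)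
  then obtain k where "k \<in> {1..}" "mean k / real k < rate + \<epsilon>"
    using cINF_less_iff[OF _ mean_ratio_bdd_below] by blast
  then show thesis using that[of k] by (simp add: field_simps)
qed

lemma mean_limit: "(\<lambda>n. mean n / real n) \<longlonglongrightarrow> rate"
proof (rule order_tendstoI)
  fix a assume "a < rate"
  then show "\<forall>\<^sub>F n in sequentially. a < mean n / real n"
  proof (intro eventually_sequentiallyI[of 1])
    fix n :: nat assume "1 \<le> n"
    then have "rate \<le> mean n / real n" using rate_le[of n] by (simp add: field_simps)
    then show "a < mean n / real n" using \<open>a < rate\<close> by simp
  qed
next
  fix a assume a: "rate < a"
  define \<epsilon> where "\<epsilon> = (a - rate) / 2"
  have \<epsilon>: "0 < \<epsilon>" using a by (simp add: \<epsilon>_def)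
  obtain k where k: "1 \<le> k" "mean k < (rate + \<epsilon>) * real k" by (rule ex_mean_less[OF \<epsilon>])
  define c where "c = real k * \<bar>rate + \<epsilon>\<bar> + real k * (\<integral>s. \<psi> s \<partial>M)"
  have le: "mean n \<le> (rate + \<epsilon>) * real n + c" for n
  proof -
    have q: "mean (q * k + r) \<le> real q * mean k + mean r" for q r
    proof (induction q)
      case (Suc q)
      have "mean (Suc q * k + r) \<le> mean k + mean (q * k + r)"
        using mean_add_le[of k "q * k + r"] by (simp add: add.assoc)
      then show ?case using Suc by (simp add: algebra_simps)
    qed simp
    define q r where "q = n div k" and "r = n mod k"
    have n: "n = q * k + r" "r < k" using k(1) by (simp_all add: q_def r_def)
    have nr: "real n = real q * real k + real r" by (simp add: n(1))
    have "mean n \<le> real q * mean k + mean r" unfolding n(1) by (rule q)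
    also have "\<dots> \<le> real q * ((rate + \<epsilon>) * real k) + real k * (\<integral>s. \<psi> s \<partial>M)"
    proof (intro add_mono mult_left_mono)
      have "mean r \<le> real r * (\<integral>s. \<psi> s \<partial>M)" using abs_mean_le[of r] by simp
      also have "\<dots> \<le> real k * (\<integral>s. \<psi> s \<partial>M)" using n(2) \<psi>(1) by (intro mult_right_mono) auto
      finally show "mean r \<le> real k * (\<integral>s. \<psi> s \<partial>M)" .
    qed (use k in auto)
    also have "real q * ((rate + \<epsilon>) * real k) = (rate + \<epsilon>) * real n - (rate + \<epsilon>) * real r"
      by (simp add: nr algebra_simps)
    finally have "mean n \<le> (rate + \<epsilon>) * real n - (rate + \<epsilon>) * real r + real k * (\<integral>s. \<psi> s \<partial>M)" .
    moreover have "- ((rate + \<epsilon>) * real r) \<le> \<bar>rate + \<epsilon>\<bar> * real r"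
      by (metis abs_ge_minus_self abs_mult abs_of_nat)
    moreover have "\<bar>rate + \<epsilon>\<bar> * real r \<le> \<bar>rate + \<epsilon>\<bar> * real k" using n(2) by (intro mult_left_mono) auto
    ultimately show ?thesis by (simp add: c_def mult.commute)
  qed
  have "(\<lambda>n. c / real n) \<longlonglongrightarrow> 0" by (rule lim_const_over_n)
  then have "\<forall>\<^sub>F n in sequentially. c / real n < \<epsilon>" using \<epsilon> by (rule order_tendstoD)
  moreover have "\<forall>\<^sub>F n in sequentially. 1 \<le> n" by (rule eventually_ge_at_top)
  ultimately show "\<forall>\<^sub>F n in sequentially. mean n / real n < a"
  proof eventually_elim
    case (elim n)
    then have "mean n / real n \<le> (rate + \<epsilon>) + c / real n" using le[of n] by (simp add: field_simps)
    also have "\<dots> < rate + \<epsilon> + \<epsilon>" using elim by simp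
    also have "\<dots> = a" by (simp add: \<epsilon>_def)
    finally show ?case .
  qed
qed

lemma exp_moment_add_le:
  assumes "0 \<le> \<theta>"
  shows "(\<integral>\<^sup>+\<omega>. ennreal (exp (\<theta> * h (n + k) \<omega>)) \<partial>S)
    \<le> (\<integral>\<^sup>+\<omega>. ennreal (exp (\<theta> * h n \<omega>)) \<partial>S) * (\<integral>\<^sup>+\<omega>. ennreal (exp (\<theta> * h k \<omega>)) \<partial>S)"
proof -
  have "(\<integral>\<^sup>+\<omega>. ennreal (exp (\<theta> * h (n + k) \<omega>)) \<partial>S)
      = (\<integral>\<^sup>+\<omega>. \<integral>\<^sup>+\<omega>'. ennreal (exp (\<theta> * h (n + k) (comb_seq n \<omega> \<omega>'))) \<partial>S \<partial>S)"
    by (intro nn_integral_comb_seq) auto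
  also have "\<dots> \<le> (\<integral>\<^sup>+\<omega>. \<integral>\<^sup>+\<omega>'. ennreal (exp (\<theta> * h n \<omega>)) * ennreal (exp (\<theta> * h k \<omega>')) \<partial>S \<partial>S)"
  proof (intro nn_integral_mono)
    fix \<omega> \<omega>'
    have "\<theta> * h (n + k) (comb_seq n \<omega> \<omega>') \<le> \<theta> * (h n \<omega> + h k \<omega>')"
      using sub[of n k "comb_seq n \<omega> \<omega>'"] assms by (intro mult_left_mono) (auto simp: local)
    then show "ennreal (exp (\<theta> * h (n + k) (comb_seq n \<omega> \<omega>')))
        \<le> ennreal (exp (\<theta> * h n \<omega>)) * ennreal (exp (\<theta> * h k \<omega>'))"
      by (simp add: ennreal_mult'[symmetric] exp_add[symmetric] ring_distribs ennreal_leI)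
  qed
  also have "\<dots> = (\<integral>\<^sup>+\<omega>. ennreal (exp (\<theta> * h n \<omega>)) \<partial>S) * (\<integral>\<^sup>+\<omega>. ennreal (exp (\<theta> * h k \<omega>)) \<partial>S)"
    by (simp add: nn_integral_cmult nn_integral_multc)
  finally show ?thesis .
qed

lemma exp_moment_bound:
  assumes "0 \<le> \<theta>" "\<theta> \<le> \<eta>"
  shows "(\<integral>\<^sup>+\<omega>. ennreal (exp (\<theta> * \<bar>h n \<omega>\<bar>)) \<partial>S) \<le> ennreal ((\<integral>s. exp (\<eta> * \<psi> s) \<partial>M) ^ n)"
proof -
  note [measurable] = \<psi>(2)
  have "(\<integral>\<^sup>+\<omega>. ennreal (exp (\<theta> * \<bar>h n \<omega>\<bar>)) \<partial>S) \<le> (\<integral>\<^sup>+\<omega>. (\<Prod>i<n. ennreal (exp (\<eta> * \<psi> (\<omega> i)))) \<partial>S)"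
  proof (intro nn_integral_mono)
    fix \<omega>
    have "\<theta> * \<bar>h n \<omega>\<bar> \<le> \<eta> * (\<Sum>i<n. \<psi> (\<omega> i))"
      using assms bound by (intro mult_mono) (auto intro: order_trans)
    then have "exp (\<theta> * \<bar>h n \<omega>\<bar>) \<le> (\<Prod>i<n. exp (\<eta> * \<psi> (\<omega> i)))"
      by (simp add: sum_distrib_left exp_sum[symmetric])
    then show "ennreal (exp (\<theta> * \<bar>h n \<omega>\<bar>)) \<le> (\<Prod>i<n. ennreal (exp (\<eta> * \<psi> (\<omega> i))))"
      by (simp add: prod_ennreal ennreal_leI)
  qed
  also have "\<dots> = (\<integral>\<^sup>+s. ennreal (exp (\<eta> * \<psi> s)) \<partial>M) ^ n"
    by (rule nn_integral_prod_coord) measurable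
  also have "(\<integral>\<^sup>+s. ennreal (exp (\<eta> * \<psi> s)) \<partial>M) = ennreal (\<integral>s. exp (\<eta> * \<psi> s) \<partial>M)"
    using \<eta> by (intro nn_integral_eq_integral) auto
  finally show ?thesis by (simp add: ennreal_power)
qed

text \<open>
  The upper half by Chernoff's bound: exponential moments are submultiplicative along the process
  and, at a time \<open>k\<close> where the mean is below \<open>a = (rate + \<epsilon>) k\<close>, an exponential moment of small order
  of \<open>h k - a\<close> is at most one.
\<close>
lemma eventually_less_rate:
  assumes "0 < \<epsilon>"
  shows "AE \<omega> in S. \<forall>\<^sub>F n in sequentially. h n \<omega> < (rate + 2 * \<epsilon>) * real n"
proof -
  obtain k where k: "1 \<le> k" "mean k < (rate + \<epsilon> / 2) * real k"
    using ex_mean_less[of "\<epsilon> / 2"] assms by auto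
  define K where "K = (\<integral>s. exp (\<eta> * \<psi> s) \<partial>M)"
  have K0: "0 \<le> K" by (simp add: K_def)
  define a where "a = (rate + \<epsilon>) * real k"
  define C where "C = exp (\<eta> * \<bar>a\<bar>) * K ^ k"
  define D where "D = 2 * C / (\<eta> / 2)\<^sup>2"
  \<comment> \<open>The order \<open>\<theta>\<close> of the moment is so small that the negative mean \<open>- \<gamma>\<close> of \<open>X\<close> outweighs the remainder
    \<open>\<theta> D\<close> of the expansion.\<close>
  have C0: "0 \<le> C" "0 \<le> D" using K0 by (auto simp: C_def D_def)
  define \<gamma> where "\<gamma> = \<epsilon> / 2 * real k"
  have \<gamma>: "0 < \<gamma>" using assms k by (simp add: \<gamma>_def)
  define \<theta> where "\<theta> = min (\<eta> / 2) (\<gamma> / (D + 1))"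
  have \<theta>: "0 < \<theta>" "\<theta> \<le> \<eta> / 2"
    using \<gamma> \<eta>(1) C0 min.cobounded1[of "\<eta> / 2" "\<gamma> / (D + 1)"] by (simp_all add: \<theta>_def del: min.cobounded1)
  have "\<theta> * D \<le> \<gamma> / (D + 1) * (D + 1)" using C0 \<gamma> by (intro mult_mono) (auto simp: \<theta>_def)
  then have \<theta>D: "\<theta> * D \<le> \<gamma>" using C0 by simp
  define X where "X \<omega> = h k \<omega> - a" for \<omega>
  have [measurable]: "X \<in> borel_measurable S" unfolding X_def by measurable
  have X_exp: "(\<integral>\<^sup>+\<omega>. ennreal (exp (2 * (\<eta> / 2) * \<bar>X \<omega>\<bar>)) \<partial>S) \<le> ennreal C"
  proof -
    have "(\<integral>\<^sup>+\<omega>. ennreal (exp (2 * (\<eta> / 2) * \<bar>X \<omega>\<bar>)) \<partial>S)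
        \<le> (\<integral>\<^sup>+\<omega>. ennreal (exp (\<eta> * \<bar>a\<bar>)) * ennreal (exp (\<eta> * \<bar>h k \<omega>\<bar>)) \<partial>S)"
    proof (intro nn_integral_mono)
      fix \<omega>
      have "\<eta> * \<bar>X \<omega>\<bar> \<le> \<eta> * (\<bar>a\<bar> + \<bar>h k \<omega>\<bar>)" using \<eta>(1) by (intro mult_left_mono) (auto simp: X_def)
      then show "ennreal (exp (2 * (\<eta> / 2) * \<bar>X \<omega>\<bar>)) \<le> ennreal (exp (\<eta> * \<bar>a\<bar>)) * ennreal (exp (\<eta> * \<bar>h k \<omega>\<bar>))"
        by (simp add: ennreal_mult'[symmetric] exp_add[symmetric] ring_distribs ennreal_leI)
    qed
    also have "\<dots> \<le> ennreal (exp (\<eta> * \<bar>a\<bar>)) * ennreal (K ^ k)"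
      using exp_moment_bound[of \<eta> k] \<eta>(1) by (subst nn_integral_cmult) (auto simp: K_def intro: mult_left_mono)
    finally show ?thesis by (simp add: C_def ennreal_mult'[symmetric])
  qed
  have EX: "(\<integral>\<omega>. X \<omega> \<partial>S) \<le> - \<gamma>"
    using k(2) h_int by (simp add: X_def mean_def[symmetric] P.prob_space[simplified] a_def \<gamma>_def algebra_simps)
  have "(\<integral>\<^sup>+\<omega>. ennreal (exp (\<theta> * X \<omega>)) \<partial>S) \<le> ennreal (1 + \<theta> * (\<integral>\<omega>. X \<omega> \<partial>S) + \<theta>\<^sup>2 * D)"
    unfolding D_def by (rule P.small_exponential_moment) (use X_exp C0 \<theta> \<eta> in auto)
  also have "\<dots> \<le> ennreal 1"
  proof (rule ennreal_leI)
    have "\<theta> * (\<integral>\<omega>. X \<omega> \<partial>S) + \<theta>\<^sup>2 * D = \<theta> * ((\<integral>\<omega>. X \<omega> \<partial>S) + \<theta> * D)"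
      by (simp add: power2_eq_square algebra_simps)
    also have "\<dots> \<le> 0" using EX \<theta>D \<theta>(1) by (intro mult_nonneg_nonpos) auto
    finally show "1 + \<theta> * (\<integral>\<omega>. X \<omega> \<partial>S) + \<theta>\<^sup>2 * D \<le> 1" by simp
  qed
  finally have X1: "(\<integral>\<^sup>+\<omega>. ennreal (exp (\<theta> * X \<omega>)) \<partial>S) \<le> 1" by simp
  define e where "e n = (\<integral>\<^sup>+\<omega>. ennreal (exp (\<theta> * h n \<omega>)) \<partial>S)" for n
  have ek: "e k \<le> ennreal (exp (\<theta> * a))"
  proof -
    have "e k = (\<integral>\<^sup>+\<omega>. ennreal (exp (\<theta> * a)) * ennreal (exp (\<theta> * X \<omega>)) \<partial>S)"
      unfolding e_def by (intro nn_integral_cong)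
        (simp add: ennreal_mult'[symmetric] exp_add[symmetric] X_def ring_distribs)
    also have "\<dots> = ennreal (exp (\<theta> * a)) * (\<integral>\<^sup>+\<omega>. ennreal (exp (\<theta> * X \<omega>)) \<partial>S)"
      by (rule nn_integral_cmult) measurable
    also have "\<dots> \<le> ennreal (exp (\<theta> * a)) * 1" by (intro mult_left_mono X1) simp
    finally show ?thesis by simp
  qed
  have eq: "e (q * k + r) \<le> e k ^ q * e r" for q r
  proof (induction q)
    case (Suc q)
    have "e (Suc q * k + r) \<le> e k * e (q * k + r)"
      using exp_moment_add_le[of \<theta> k "q * k + r"] \<theta>(1) by (simp add: e_def add.assoc)
    also have "\<dots> \<le> e k * (e k ^ q * e r)" by (intro mult_left_mono Suc) simp
    finally show ?case by (simp add: mult.assoc)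
  qed simp
  define D' where "D' = exp (\<theta> * \<bar>a\<bar>) * max 1 K ^ k"
  have en: "e n \<le> ennreal (D' * exp (\<theta> * (rate + \<epsilon>) * real n))" for n
  proof -
    define q r where "q = n div k" and "r = n mod k"
    have n: "n = q * k + r" "r < k" using k(1) by (simp_all add: q_def r_def)
    have nr: "real n = real q * real k + real r" by (simp add: n(1))
    have "e n \<le> e k ^ q * e r" unfolding n(1) by (rule eq)
    also have "\<dots> \<le> ennreal (exp (\<theta> * a)) ^ q * ennreal (max 1 K ^ k)"
    proof (intro mult_mono power_mono ek)
      have "e r \<le> (\<integral>\<^sup>+\<omega>. ennreal (exp (\<theta> * \<bar>h r \<omega>\<bar>)) \<partial>S)"
        unfolding e_def using \<theta>(1) by (intro nn_integral_mono ennreal_leI) (simp add: mult_left_mono)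
      also have "\<dots> \<le> ennreal (K ^ r)"
        unfolding K_def using \<theta> \<eta>(1) by (intro exp_moment_bound) auto
      also have "\<dots> \<le> ennreal (max 1 K ^ k)"
      proof (rule ennreal_leI)
        have "K ^ r \<le> max 1 K ^ r" using K0 by (intro power_mono) auto
        also have "\<dots> \<le> max 1 K ^ k" using n(2) by (intro power_increasing) auto
        finally show "K ^ r \<le> max 1 K ^ k" .
      qed
      finally show "e r \<le> ennreal (max 1 K ^ k)" .
    qed auto
    also have "\<dots> = ennreal (exp (\<theta> * a * real q) * max 1 K ^ k)"
      by (simp add: ennreal_power ennreal_mult'[symmetric] exp_of_nat_mult[symmetric] mult.commute)
    also have "\<dots> \<le> ennreal (D' * exp (\<theta> * (rate + \<epsilon>) * real n))"
    proof (rule ennreal_leI)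
      have "a * real q = (rate + \<epsilon>) * real n - (rate + \<epsilon>) * real r"
        by (simp add: a_def nr algebra_simps)
      moreover have "- ((rate + \<epsilon>) * real r) \<le> \<bar>rate + \<epsilon>\<bar> * real r"
        by (metis abs_ge_minus_self abs_mult abs_of_nat)
      moreover have "\<bar>rate + \<epsilon>\<bar> * real r \<le> \<bar>rate + \<epsilon>\<bar> * real k" using n(2) by (intro mult_left_mono) auto
      moreover have "\<bar>rate + \<epsilon>\<bar> * real k = \<bar>a\<bar>" by (simp add: a_def abs_mult)
      ultimately have "a * real q \<le> \<bar>a\<bar> + (rate + \<epsilon>) * real n" by linarith
      then have "\<theta> * (a * real q) \<le> \<theta> * (\<bar>a\<bar> + (rate + \<epsilon>) * real n)" using \<theta>(1) by (intro mult_left_mono) auto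
      then have "exp (\<theta> * a * real q) \<le> exp (\<theta> * \<bar>a\<bar>) * exp (\<theta> * (rate + \<epsilon>) * real n)"
        by (simp add: exp_add[symmetric] algebra_simps)
      then have "exp (\<theta> * a * real q) * max 1 K ^ k
          \<le> exp (\<theta> * \<bar>a\<bar>) * exp (\<theta> * (rate + \<epsilon>) * real n) * max 1 K ^ k"
        by (intro mult_right_mono) auto
      then show "exp (\<theta> * a * real q) * max 1 K ^ k \<le> D' * exp (\<theta> * (rate + \<epsilon>) * real n)"
        by (simp add: D'_def mult_ac)
    qed
    finally show ?thesis .
  qed
  define B where "B n = {\<omega>. (rate + 2 * \<epsilon>) * real n \<le> h n \<omega>}" for n
  have B_sets: "B n \<in> sets S" for n
  proof -
    have "{\<omega> \<in> space S. (rate + 2 * \<epsilon>) * real n \<le> h n \<omega>} \<in> sets S" by measurable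
    then show ?thesis by (simp add: B_def)
  qed
  have B_small: "measure S (B n) \<le> D' * exp (- \<theta> * \<epsilon>) ^ n" for n
  proof -
    have "emeasure S (B n) = (\<integral>\<^sup>+\<omega>. indicator (B n) \<omega> \<partial>S)" using B_sets by simp
    also have "\<dots> \<le> (\<integral>\<^sup>+\<omega>. ennreal (exp (- \<theta> * (rate + 2 * \<epsilon>) * real n)) * ennreal (exp (\<theta> * h n \<omega>)) \<partial>S)"
    proof (intro nn_integral_mono)
      fix \<omega>
      have "0 \<le> \<theta> * (h n \<omega> - (rate + 2 * \<epsilon>) * real n)" if "\<omega> \<in> B n"
        using that \<theta>(1) by (simp add: B_def)
      then have "1 \<le> exp (- \<theta> * (rate + 2 * \<epsilon>) * real n) * exp (\<theta> * h n \<omega>)" if "\<omega> \<in> B n"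
        using that by (simp add: exp_add[symmetric] algebra_simps)
      then have "ennreal 1 \<le> ennreal (exp (- \<theta> * (rate + 2 * \<epsilon>) * real n) * exp (\<theta> * h n \<omega>))" if "\<omega> \<in> B n"
        using that by (intro ennreal_leI) 
      then show "indicator (B n) \<omega> \<le> ennreal (exp (- \<theta> * (rate + 2 * \<epsilon>) * real n)) * ennreal (exp (\<theta> * h n \<omega>))"
        by (simp add: indicator_def ennreal_mult')
    qed
    also have "\<dots> = ennreal (exp (- \<theta> * (rate + 2 * \<epsilon>) * real n)) * e n"
      unfolding e_def by (rule nn_integral_cmult) measurable
    also have "\<dots> \<le> ennreal (exp (- \<theta> * (rate + 2 * \<epsilon>) * real n)) * ennreal (D' * exp (\<theta> * (rate + \<epsilon>) * real n))"
      by (intro mult_left_mono en) simp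
    also have "\<dots> = ennreal (D' * exp (- \<theta> * \<epsilon>) ^ n)"
    proof -
      have "exp (- \<theta> * (rate + 2 * \<epsilon>) * real n) * exp (\<theta> * (rate + \<epsilon>) * real n) = exp (- \<theta> * \<epsilon>) ^ n"
        by (simp add: exp_of_nat_mult[symmetric] exp_add[symmetric]) (simp add: algebra_simps)
      then have "exp (- \<theta> * (rate + 2 * \<epsilon>) * real n) * (D' * exp (\<theta> * (rate + \<epsilon>) * real n)) = D' * exp (- \<theta> * \<epsilon>) ^ n"
        by (metis mult.left_commute)
      then show ?thesis by (metis ennreal_mult' exp_ge_zero)
    qed
    finally show ?thesis by (simp add: emeasure_eq_measure ennreal_le_iff D'_def)
  qed
  have "summable (\<lambda>n. measure S (B n))"
  proof (rule summable_comparison_test)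
    show "\<exists>N. \<forall>n\<ge>N. norm (measure S (B n)) \<le> D' * exp (- \<theta> * \<epsilon>) ^ n" using B_small by auto
    have "exp (- \<theta> * \<epsilon>) < 1" using \<theta>(1) assms by simp
    then show "summable (\<lambda>n. D' * exp (- \<theta> * \<epsilon>) ^ n)"
      by (intro summable_mult summable_geometric) simp
  qed
  then have "AE \<omega> in S. \<forall>\<^sub>F n in sequentially. \<omega> \<in> space S - B n"
    using B_sets by (intro borel_cantelli_AE1) (auto simp: emeasure_eq_measure)
  then show ?thesis by (simp add: B_def not_le)
qed

text \<open>
  The lower half: if \<open>h n\<close> were below a smaller rate infinitely often with positive probability, it
  would, by the zero-one law and at the cost of a slightly larger rate, be so almost surely, and the greedy
  cutting would push the means below the rate.
\<close>
lemma eventually_greater_rate: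
  assumes "0 < \<epsilon>"
  shows "AE \<omega> in S. \<forall>\<^sub>F n in sequentially. (rate - \<epsilon>) * real n < h n \<omega>"
proof -
  define V where "V l = {\<omega>. \<exists>\<^sub>F n in sequentially. h n \<omega> \<le> l * real n}" for l
  have V_sets: "V l \<in> sets S" for l
  proof -
    have "{\<omega> \<in> space S. \<forall>m. \<exists>n\<ge>m. h n \<omega> \<le> l * real n} \<in> sets S" by measurable
    then show ?thesis by (simp add: V_def frequently_sequentially)
  qed
  have drop_V: "\<omega>' \<in> V (rate - \<epsilon> / 2)" if "comb_seq k \<omega> \<omega>' \<in> V (rate - \<epsilon>)" for k \<omega> \<omega>'
  proof -
    define c where "c = (\<Sum>i<k. \<psi> (\<omega> i)) + \<bar>rate - \<epsilon>\<bar> * real k"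
    have le: "h n \<omega>' \<le> h (k + n) (comb_seq k \<omega> \<omega>') + (\<Sum>i<k. \<psi> (\<omega> i))" for n
      using drop[of n k "comb_seq k \<omega> \<omega>'"] by (simp add: comb_seq_less)
    show ?thesis unfolding V_def mem_Collect_eq frequently_sequentially
    proof
      fix m
      obtain m' :: nat where m': "2 * c / \<epsilon> \<le> real m'" using real_arch_simple by blast
      obtain n where n: "k + (m + m') \<le> n" "h n (comb_seq k \<omega> \<omega>') \<le> (rate - \<epsilon>) * real n"
        using \<open>comb_seq k \<omega> \<omega>' \<in> V (rate - \<epsilon>)\<close> unfolding V_def mem_Collect_eq frequently_sequentially by blast
      define j where "j = n - k"
      have nj: "n = k + j" "m \<le> j" "m' \<le> j" using n(1) by (auto simp: j_def)
      have "c \<le> \<epsilon> / 2 * real m'" using m' assms by (simp add: field_simps)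
      also have "\<dots> \<le> \<epsilon> / 2 * real j" using nj assms by (intro mult_left_mono) auto
      finally have cj: "c \<le> \<epsilon> / 2 * real j" .
      have "(rate - \<epsilon>) * real k \<le> \<bar>rate - \<epsilon>\<bar> * real k" by (intro mult_right_mono) auto
      then have "h j \<omega>' \<le> (rate - \<epsilon>) * real j + c"
        using le[of j] n(2) unfolding nj(1) by (simp add: c_def ring_distribs)
      also have "\<dots> \<le> (rate - \<epsilon> / 2) * real j" using cj by (simp add: algebra_simps)
      finally show "\<exists>n\<ge>m. h n \<omega>' \<le> (rate - \<epsilon> / 2) * real n" using nj by blast
    qed
  qed
  have "measure S (V (rate - \<epsilon>)) = 0"
  proof (rule ccontr)
    assume "measure S (V (rate - \<epsilon>)) \<noteq> 0"
    then have pos: "0 < measure S (V (rate - \<epsilon>))" by (simp add: zero_less_measure_iff)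
    let ?l = "rate - \<epsilon> / 2"
    have "1 - \<delta> \<le> measure S (V ?l)" if \<delta>: "0 < \<delta>" for \<delta>
    proof -
      obtain k \<omega> where "1 - \<delta> \<le> measure S {\<omega>'. comb_seq k \<omega> \<omega>' \<in> V (rate - \<epsilon>)}"
        using almost_certain_after_word[OF V_sets pos \<delta>] by blast
      also have "\<dots> \<le> measure S (V ?l)"
        using drop_V V_sets by (intro finite_measure_mono) auto
      finally show ?thesis .
    qed
    then have V1: "measure S (V ?l) = 1"
      by (metis P.prob_le_1 antisym field_le_epsilon le_diff_eq diff_le_eq)
    define B where "B N = {\<omega>. \<forall>n\<in>{1..N}. ?l * real n < h n \<omega>}" for N :: nat
    have B_sets: "B N \<in> sets S" for N
    proof -
      have "{\<omega> \<in> space S. \<forall>n\<in>{1..N}. ?l * real n < h n \<omega>} \<in> sets S" by measurable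
      then show ?thesis by (simp add: B_def)
    qed
    have "(\<lambda>N. measure S (B N)) \<longlonglongrightarrow> measure S (\<Inter>N. B N)"
      using B_sets by (intro finite_Lim_measure_decseq) (auto simp: decseq_def B_def)
    also have "measure S (\<Inter>N. B N) = 0"
    proof -
      have "(\<Inter>N. B N) \<inter> V ?l = {}"
      proof (rule equals0I)
        fix \<omega> assume "\<omega> \<in> (\<Inter>N. B N) \<inter> V ?l"
        then obtain n where n: "1 \<le> n" "h n \<omega> \<le> ?l * real n" and "\<omega> \<in> B n"
          unfolding V_def frequently_sequentially by blast
        then show False by (force simp: B_def)
      qed
      then have "measure S (\<Inter>N. B N) \<le> measure S (space S - V ?l)"
        using B_sets sets.compl_sets[OF V_sets] by (intro finite_measure_mono) auto
      also have "\<dots> = 0" using V1 V_sets by (subst P.prob_compl) auto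
      finally show ?thesis by (simp add: measure_le_0_iff)
    qed
    finally have B_lim: "(\<lambda>N. measure S (B N)) \<longlonglongrightarrow> 0" .
    have "\<exists>c. \<forall>m. \<forall>x\<in>{()}. (\<integral>\<omega>. h m \<omega> \<partial>S) \<le> (?l + \<epsilon> / 4) * real m + c"
    proof (rule integral_le_of_often_small[where h = "\<lambda>n \<omega> _. h n \<omega>" and T = "\<lambda>_ _ x. x" and X = "{()}" and \<psi> = \<psi>])
      fix \<delta> :: real assume "0 < \<delta>"
      then have "\<forall>\<^sub>F N in sequentially. measure S (B N) < \<delta>" by (rule order_tendstoD(2)[OF B_lim])
      then obtain N where "measure S (B N) < \<delta>" using eventually_sequentially by auto
      then show "\<exists>N. \<forall>x\<in>{()}. measure S {\<omega>. \<forall>n\<in>{1..N}. ?l * real n < h n \<omega>} \<le> \<delta>"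
        by (intro exI[of _ N]) (simp add: B_def)
    qed (use sub bound \<psi> \<psi>_int assms in \<open>auto intro: measurable_compose[OF measurable_drop_seq h_meas]\<close>)
    then obtain c where c: "\<And>m. mean m \<le> (?l + \<epsilon> / 4) * real m + c" by (auto simp: mean_def)
    obtain m :: nat where "4 * c / \<epsilon> < real m" using reals_Archimedean2 by blast
    then have "c < \<epsilon> / 4 * real m" using assms by (simp add: field_simps)
    then show False using c[of m] rate_le[of m] by (simp add: algebra_simps)
  qed
  then have "AE \<omega> in S. \<omega> \<notin> V (rate - \<epsilon>)"
    using V_sets by (intro AE_not_in) (auto simp: null_sets_def emeasure_eq_measure)
  then show ?thesis by (simp add: V_def frequently_def not_le)
qed

text \<open>The theorem of Furstenberg and Kesten, for the process \<open>h\<close>.\<close>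
theorem ratio_tendsto_rate: "AE \<omega> in S. (\<lambda>n. h n \<omega> / real n) \<longlonglongrightarrow> rate"
proof -
  have "AE \<omega> in S. \<forall>j. (\<forall>\<^sub>F n in sequentially. h n \<omega> < (rate + 2 * (1 / real (Suc j))) * real n)
      \<and> (\<forall>\<^sub>F n in sequentially. (rate - 1 / real (Suc j)) * real n < h n \<omega>)"
    unfolding AE_all_countable
    by (intro allI AE_conjI eventually_less_rate eventually_greater_rate) auto
  then show ?thesis
  proof eventually_elim
    case (elim \<omega>)
    show ?case
    proof (rule order_tendstoI)
      fix a assume "a < rate"
      then obtain j where j: "1 / real (Suc j) < rate - a" by (metis diff_gt_0_iff_gt inverse_eq_divide reals_Archimedean)
      have "\<forall>\<^sub>F n in sequentially. (rate - 1 / real (Suc j)) * real n < h n \<omega>" using elim by blast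
      moreover have "\<forall>\<^sub>F n in sequentially. (1::nat) \<le> n" by (rule eventually_ge_at_top)
      ultimately show "\<forall>\<^sub>F n in sequentially. a < h n \<omega> / real n"
      proof eventually_elim
        case (elim n)
        then have "rate - 1 / real (Suc j) < h n \<omega> / real n" by (simp add: pos_less_divide_eq)
        then show ?case using j by linarith
      qed
    next
      fix a assume "rate < a"
      then obtain j where j: "1 / real (Suc j) < (a - rate) / 2"
        by (metis diff_gt_0_iff_gt half_gt_zero inverse_eq_divide reals_Archimedean)
      have ja: "rate + 2 * (1 / real (Suc j)) < a" using j by (simp only: pos_less_divide_eq)
      have "\<forall>\<^sub>F n in sequentially. h n \<omega> < (rate + 2 * (1 / real (Suc j))) * real n" using elim by blast
      moreover have "\<forall>\<^sub>F n in sequentially. (1::nat) \<le> n" by (rule eventually_ge_at_top)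
      ultimately show "\<forall>\<^sub>F n in sequentially. h n \<omega> / real n < a"
      proof eventually_elim
        case (elim n)
        then have "h n \<omega> / real n < rate + 2 * (1 / real (Suc j))" by (simp add: pos_divide_less_eq)
        then show ?case using ja by (rule less_trans)
      qed
    qed
  qed
qed

end

section \<open>Products of random matrices\<close>

primrec mat_prod :: "('s \<Rightarrow> real ^ 'm ^ 'm) \<Rightarrow> nat \<Rightarrow> (nat \<Rightarrow> 's) \<Rightarrow> real ^ 'm ^ 'm" where
  "mat_prod a 0 \<omega> = mat 1"
| "mat_prod a (Suc n) \<omega> = a (\<omega> n) ** mat_prod a n \<omega>"

lemma mat_prod_add: "mat_prod a (n + k) \<omega> = mat_prod a k (drop_seq n \<omega>) ** mat_prod a n \<omega>"
proof (induction k)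
  case (Suc k)
  have "mat_prod a (n + Suc k) \<omega> = a (\<omega> (n + k)) ** mat_prod a (n + k) \<omega>" by simp
  also have "\<dots> = a (\<omega> (n + k)) ** (mat_prod a k (drop_seq n \<omega>) ** mat_prod a n \<omega>)" by (simp only: Suc)
  finally show ?case by (simp add: matrix_mul_assoc drop_seq_def)
qed simp

lemma mat_prod_cong: "(\<And>i. i < n \<Longrightarrow> \<omega> i = \<omega>' i) \<Longrightarrow> mat_prod a n \<omega> = mat_prod a n \<omega>'"
  by (induction n) auto

lemma mat_prod_comb_seq [simp]: "mat_prod a n (comb_seq n \<omega> \<omega>') = mat_prod a n \<omega>"
  by (rule mat_prod_cong) (simp add: comb_seq_less)

lemma mat_prod_Suc_case_nat: "mat_prod a (Suc n) (case_nat s \<omega>) = mat_prod a n \<omega> ** a s"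
  using mat_prod_add[of a 1 n "case_nat s \<omega>"] by (simp del: mat_prod.simps(2) add: mat_prod.simps(2)[of a 0])

lemma det_mat_prod: "(\<And>s. det (a s) = 1) \<Longrightarrow> det (mat_prod a n \<omega>) = 1"
  by (induction n) (auto simp: det_mul)

lemma borel_measurable_matrix_mult [measurable (raw)]:
  fixes f g :: "'x \<Rightarrow> real ^ 'm ^ 'm"
  assumes "f \<in> borel_measurable N" "g \<in> borel_measurable N"
  shows "(\<lambda>x. f x ** g x) \<in> borel_measurable N"
proof (rule borel_measurable_continuous_Pair[OF assms])
  show "continuous_on UNIV (\<lambda>p. fst p ** snd p :: real ^ 'm ^ 'm)"
    unfolding matrix_matrix_mult_def by (intro continuous_intros)
qed

lemma borel_measurable_matrix_vector_mult [measurable (raw)]: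
  fixes f :: "'x \<Rightarrow> real ^ 'm ^ 'm" and g :: "'x \<Rightarrow> real ^ 'm"
  assumes "f \<in> borel_measurable N" "g \<in> borel_measurable N"
  shows "(\<lambda>x. f x *v g x) \<in> borel_measurable N"
proof (rule borel_measurable_continuous_Pair[OF assms])
  show "continuous_on UNIV (\<lambda>p. fst p *v snd p :: real ^ 'm)"
    unfolding matrix_vector_mult_def by (intro continuous_intros)
qed

lemma matrix_inv_apply:
  fixes g :: "real ^ 'm ^ 'm"
  assumes "det g = 1"
  shows "g *v (matrix_inv g *v x) = x" "matrix_inv g *v (g *v x) = x"
  using assms matrix_mult_inv[of g] by (auto simp: matrix_vector_mul_assoc invertible_det_nz)

lemma opnorm_le_opnorm_mult:
  fixes g h :: "real ^ 'm ^ 'm"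
  assumes "det g = 1" "\<And>x. norm x \<le> D * norm (g *v x)"
  shows "opnorm h \<le> D * opnorm (h ** g)"
proof (rule opnorm_leI)
  fix y
  let ?x = "matrix_inv g *v y"
  have "norm (h *v y) = norm ((h ** g) *v ?x)"
    by (simp add: matrix_vector_mul_assoc[symmetric] matrix_inv_apply[OF assms(1)])
  also have "\<dots> \<le> opnorm (h ** g) * norm ?x" by (rule norm_mult_le_opnorm)
  also have "\<dots> \<le> opnorm (h ** g) * (D * norm y)"
    using assms(2)[of ?x] by (intro mult_left_mono opnorm_nonneg) (simp add: matrix_inv_apply[OF assms(1)])
  finally show "norm (h *v y) \<le> D * opnorm (h ** g) * norm y" by (simp add: mult_ac)
qed

lemma area_norm_le_area_norm_mult:
  fixes g h :: "real ^ 'm ^ 'm"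
  assumes "CARD('m) \<ge> 2" "det g = 1" "\<And>x. norm x \<le> D * norm (g *v x)"
  shows "area_norm h \<le> D\<^sup>2 * area_norm (h ** g)"
proof (rule area_norm_leI[OF assms(1)])
  fix x y
  let ?x = "matrix_inv g *v x" and ?y = "matrix_inv g *v y"
  have inv: "opnorm (matrix_inv g) \<le> D"
    by (rule opnorm_leI) (use assms(3)[of "matrix_inv g *v _"] in \<open>simp add: matrix_inv_apply[OF assms(2)]\<close>)
  have "area (h *v x) (h *v y) = area ((h ** g) *v ?x) ((h ** g) *v ?y)"
    by (simp add: matrix_vector_mul_assoc[symmetric] matrix_inv_apply[OF assms(2)])
  also have "\<dots> \<le> area_norm (h ** g) * area ?x ?y" by (rule area_image_le_area_norm)
  also have "\<dots> \<le> area_norm (h ** g) * ((opnorm (matrix_inv g))\<^sup>2 * area x y)"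
    by (intro mult_left_mono area_image_le_opnorm area_norm_nonneg assms)
  also have "\<dots> \<le> area_norm (h ** g) * (D\<^sup>2 * area x y)"
    using inv by (intro mult_left_mono mult_right_mono power_mono area_norm_nonneg area_nonneg opnorm_nonneg assms)
  finally show "area (h *v x) (h *v y) \<le> D\<^sup>2 * area_norm (h ** g) * area x y" by (simp add: mult_ac)
qed

lemma opnorm_mat_1: "opnorm (mat 1 :: real ^ 'm ^ 'm) = 1"
proof (rule antisym)
  show "opnorm (mat 1 :: real ^ 'm ^ 'm) \<le> 1" by (rule opnorm_leI) simp
  show "1 \<le> opnorm (mat 1 :: real ^ 'm ^ 'm)"
    using norm_mult_le_opnorm[of "mat 1 :: real ^ 'm ^ 'm" "axis undefined 1"] by simp
qed

lemma area_norm_mat_1: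
  assumes "CARD('m) \<ge> 2"
  shows "1 \<le> area_norm (mat 1 :: real ^ 'm ^ 'm)"
proof -
  obtain u v :: "real ^ 'm" where "area u v = 1" using ex_area_1[OF assms] by blast
  then show ?thesis using area_image_le_area_norm[of "mat 1 :: real ^ 'm ^ 'm" u v] by simp
qed

lemma abs_ln_le:
  fixes y D :: real
  assumes "0 < y" "1 / D \<le> y" "y \<le> D" "1 \<le> D"
  shows "\<bar>ln y\<bar> \<le> ln D"
proof -
  have "ln (1 / D) \<le> ln y" using assms by (subst ln_le_cancel_iff) auto
  moreover have "ln y \<le> ln D" using assms by (subst ln_le_cancel_iff) auto
  ultimately show ?thesis using assms by (simp add: ln_div abs_le_iff)
qed

locale sl_cocycle = letters M for M :: "'s measure" +
  fixes a :: "'s \<Rightarrow> real ^ 'm ^ 'm" and q :: real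
  assumes dim_ge_2: "CARD('m) \<ge> 2"
    and a_meas [measurable]: "a \<in> borel_measurable M"
    and det_a: "\<And>s. det (a s) = 1"
    and q_pos: "0 < q"
    and moment: "integrable M (\<lambda>s. distortion (a s) powr q)"
begin

abbreviation "A \<equiv> mat_prod a"

definition dist_prod :: "nat \<Rightarrow> (nat \<Rightarrow> 's) \<Rightarrow> real" where
  "dist_prod n \<omega> = (\<Prod>i<n. distortion (a (\<omega> i)))"

lemma det_A: "det (A n \<omega>) = 1"
  by (rule det_mat_prod) (rule det_a)

lemma A_meas [measurable]: "A n \<in> borel_measurable S"
  by (induction n) simp_all

lemma A_eq_0_iff [simp]: "A n \<omega> *v x = 0 \<longleftrightarrow> x = 0"
  by (rule mult_eq_0_iff_det_1) (rule det_A)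

lemma dist_prod_ge_1: "1 \<le> dist_prod n \<omega>"
  unfolding dist_prod_def by (intro prod_ge_1 distortion_ge_1)

lemma norm_A_le: "norm (A n \<omega> *v x) \<le> dist_prod n \<omega> * norm x"
proof (induction n)
  case (Suc n)
  have "norm (A (Suc n) \<omega> *v x) \<le> distortion (a (\<omega> n)) * norm (A n \<omega> *v x)"
    by (simp add: matrix_vector_mul_assoc[symmetric] norm_mult_le_distortion)
  also have "\<dots> \<le> distortion (a (\<omega> n)) * (dist_prod n \<omega> * norm x)"
    by (intro mult_left_mono Suc less_imp_le distortion_pos)
  finally show ?case by (simp add: dist_prod_def mult_ac)
qed (simp add: dist_prod_def)

lemma norm_le_A: "norm x \<le> dist_prod n \<omega> * norm (A n \<omega> *v x)"
proof (induction n)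
  case (Suc n)
  have "norm x \<le> dist_prod n \<omega> * norm (A n \<omega> *v x)" by (rule Suc)
  also have "norm (A n \<omega> *v x) \<le> distortion (a (\<omega> n)) * norm (A (Suc n) \<omega> *v x)"
    using norm_le_distortion_mult[OF det_a, of "A n \<omega> *v x" "\<omega> n"] by (simp add: matrix_vector_mul_assoc)
  finally show ?case using dist_prod_ge_1[of n \<omega>] by (simp add: dist_prod_def mult_ac mult_left_mono)
qed (simp add: dist_prod_def)

text \<open>
  The role of \<open>\<psi>\<close> for both subadditive processes below; the factor two is due to the areas.
\<close>
definition logd :: "'s \<Rightarrow> real" where
  "logd s = 2 * ln (distortion (a s))"

lemma logd_nonneg: "0 \<le> logd s"
  using distortion_ge_1[of "a s"] by (simp add: logd_def)

lemma logd_meas [measurable]: "logd \<in> borel_measurable M"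
  unfolding logd_def by measurable

lemma sum_logd: "(\<Sum>i<n. logd (\<omega> i)) = 2 * ln (dist_prod n \<omega>)"
  unfolding logd_def dist_prod_def
  by (subst ln_prod) (auto simp: sum_distrib_left distortion_pos)

lemma exp_logd: "exp (q / 2 * logd s) = distortion (a s) powr q"
  using distortion_pos[of "a s"] by (simp add: logd_def powr_def)

lemma opnorm_A_le: "opnorm (A n \<omega>) \<le> dist_prod n \<omega>"
  by (rule opnorm_leI) (rule norm_A_le)

lemma opnorm_A_ge: "1 / dist_prod n \<omega> \<le> opnorm (A n \<omega>)"
  using opnorm_le_opnorm_mult[of "A n \<omega>" "dist_prod n \<omega>" "mat 1"] det_A[of n \<omega>] norm_le_A[of _ n \<omega>]
    dist_prod_ge_1[of n \<omega>]
  by (simp add: opnorm_mat_1 field_simps)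

lemma opnorm_A_pos: "0 < opnorm (A n \<omega>)"
  using opnorm_A_ge[of n \<omega>] dist_prod_ge_1[of n \<omega>] by (smt (verit) divide_pos_pos)

lemma area_norm_A_le: "area_norm (A n \<omega>) \<le> (dist_prod n \<omega>)\<^sup>2"
  using area_norm_le_opnorm[OF dim_ge_2, of "A n \<omega>"] power_mono[OF opnorm_A_le[of n \<omega>] opnorm_nonneg, of 2]
  by simp

lemma area_norm_A_ge: "1 / (dist_prod n \<omega>)\<^sup>2 \<le> area_norm (A n \<omega>)"
  using area_norm_le_area_norm_mult[OF dim_ge_2 det_A norm_le_A, of "mat 1" n \<omega>] area_norm_mat_1[OF dim_ge_2]
    dist_prod_ge_1[of n \<omega>]
  by (simp add: field_simps)

lemma area_norm_A_pos: "0 < area_norm (A n \<omega>)"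
  by (rule area_norm_pos[OF dim_ge_2 det_A])

sublocale top: subadditive_process M "\<lambda>n \<omega>. ln (opnorm (A n \<omega>))" logd "q / 2"
proof
  fix n k \<omega> \<omega>'
  show "(\<lambda>\<omega>. ln (opnorm (A n \<omega>))) \<in> borel_measurable S" by measurable
  have "ln (opnorm (A (n + k) \<omega>)) \<le> ln (opnorm (A k (drop_seq n \<omega>)) * opnorm (A n \<omega>))"
    using opnorm_A_pos[of "n + k" \<omega>] opnorm_A_pos[of n \<omega>] opnorm_A_pos[of k "drop_seq n \<omega>"]
    by (subst ln_le_cancel_iff) (auto simp: mat_prod_add opnorm_mult_le)
  then show "ln (opnorm (A (n + k) \<omega>)) \<le> ln (opnorm (A n \<omega>)) + ln (opnorm (A k (drop_seq n \<omega>)))"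
    using opnorm_A_pos[of k "drop_seq n \<omega>"] opnorm_A_pos[of n \<omega>] by (simp add: ln_mult)
  show "ln (opnorm (A n (comb_seq n \<omega> \<omega>'))) = ln (opnorm (A n \<omega>))" by simp
  have "\<bar>ln (opnorm (A n \<omega>))\<bar> \<le> ln (dist_prod n \<omega>)"
    by (intro abs_ln_le opnorm_A_pos opnorm_A_ge opnorm_A_le dist_prod_ge_1)
  then show "\<bar>ln (opnorm (A n \<omega>))\<bar> \<le> (\<Sum>i<n. logd (\<omega> i))"
    using dist_prod_ge_1[of n \<omega>] by (simp add: sum_logd)
  have "opnorm (A k (drop_seq n \<omega>)) \<le> dist_prod n \<omega> * opnorm (A (n + k) \<omega>)"
    unfolding mat_prod_add by (intro opnorm_le_opnorm_mult det_A norm_le_A)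
  then have "ln (opnorm (A k (drop_seq n \<omega>))) \<le> ln (dist_prod n \<omega> * opnorm (A (n + k) \<omega>))"
    using opnorm_A_pos by (subst ln_le_cancel_iff) (auto intro: less_le_trans)
  then show "ln (opnorm (A k (drop_seq n \<omega>))) \<le> ln (opnorm (A (n + k) \<omega>)) + (\<Sum>i<n. logd (\<omega> i))"
    using opnorm_A_pos[of "n + k" \<omega>] dist_prod_ge_1[of n \<omega>] ln_ge_zero[OF dist_prod_ge_1[of n \<omega>]]
      ln_mult_pos[of "dist_prod n \<omega>" "opnorm (A (n + k) \<omega>)"]
    unfolding sum_logd by linarith
next
  show "integrable M (\<lambda>s. exp (q / 2 * logd s))" using moment by (simp only: exp_logd)
qed (use logd_nonneg q_pos in auto)

sublocale area: subadditive_process M "\<lambda>n \<omega>. ln (area_norm (A n \<omega>))" logd "q / 2"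
proof
  fix n k \<omega> \<omega>'
  have D: "ln ((dist_prod n \<omega>)\<^sup>2) = (\<Sum>i<n. logd (\<omega> i))"
    using dist_prod_ge_1[of n \<omega>] by (simp add: sum_logd ln_realpow)
  have D1: "1 \<le> (dist_prod n \<omega>)\<^sup>2" using dist_prod_ge_1[of n \<omega>] by (rule one_le_power)
  note [measurable] = borel_measurable_area_norm[OF dim_ge_2]
  show "(\<lambda>\<omega>. ln (area_norm (A n \<omega>))) \<in> borel_measurable S" by measurable
  have "ln (area_norm (A (n + k) \<omega>)) \<le> ln (area_norm (A k (drop_seq n \<omega>)) * area_norm (A n \<omega>))"
    using area_norm_A_pos[of "n + k" \<omega>] area_norm_A_pos[of n \<omega>] area_norm_A_pos[of k "drop_seq n \<omega>"]
    by (subst ln_le_cancel_iff) (auto simp: mat_prod_add area_norm_mult_le[OF dim_ge_2])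
  then show "ln (area_norm (A (n + k) \<omega>)) \<le> ln (area_norm (A n \<omega>)) + ln (area_norm (A k (drop_seq n \<omega>)))"
    using area_norm_A_pos[of k "drop_seq n \<omega>"] area_norm_A_pos[of n \<omega>] by (simp add: ln_mult)
  show "ln (area_norm (A n (comb_seq n \<omega> \<omega>'))) = ln (area_norm (A n \<omega>))" by simp
  show "\<bar>ln (area_norm (A n \<omega>))\<bar> \<le> (\<Sum>i<n. logd (\<omega> i))"
    unfolding D[symmetric] by (intro abs_ln_le area_norm_A_pos area_norm_A_ge area_norm_A_le D1)
  have "area_norm (A k (drop_seq n \<omega>)) \<le> (dist_prod n \<omega>)\<^sup>2 * area_norm (A (n + k) \<omega>)"
    unfolding mat_prod_add by (intro area_norm_le_area_norm_mult dim_ge_2 det_A norm_le_A)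
  then have "ln (area_norm (A k (drop_seq n \<omega>))) \<le> ln ((dist_prod n \<omega>)\<^sup>2 * area_norm (A (n + k) \<omega>))"
    using area_norm_A_pos by (subst ln_le_cancel_iff) (auto intro: less_le_trans)
  then show "ln (area_norm (A k (drop_seq n \<omega>))) \<le> ln (area_norm (A (n + k) \<omega>)) + (\<Sum>i<n. logd (\<omega> i))"
    using area_norm_A_pos[of "n + k" \<omega>] D1 ln_mult_pos[of "(dist_prod n \<omega>)\<^sup>2" "area_norm (A (n + k) \<omega>)"]
    unfolding D[symmetric] by linarith
next
  show "integrable M (\<lambda>s. exp (q / 2 * logd s))" using moment by (simp only: exp_logd)
qed (use logd_nonneg q_pos in auto)

end

section \<open>Uniform growth of vectors under quasi-irreducibility\<close>

lemma eventually_const_mult_exp_le: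
  assumes "l < l'"
  shows "\<forall>\<^sub>F n in sequentially. c * exp (l * real n) \<le> exp (l' * real n)"
proof -
  have "filterlim (\<lambda>n. (l' - l) * real n) at_top sequentially"
    using assms by (intro filterlim_tendsto_pos_mult_at_top[OF tendsto_const] filterlim_real_sequentially) auto
  then have "\<forall>\<^sub>F n in sequentially. ln (max 1 c) \<le> (l' - l) * real n"
    by (simp add: filterlim_at_top)
  then show ?thesis
  proof eventually_elim
    case (elim n)
    then have "exp (ln (max 1 c)) \<le> exp ((l' - l) * real n)" by (simp only: exp_le_cancel_iff)
    then have "c \<le> exp ((l' - l) * real n)" by simp
    then have "c * exp (l * real n) \<le> exp ((l' - l) * real n) * exp (l * real n)"
      by (intro mult_right_mono) auto
    also have "\<dots> = exp (l' * real n)" by (simp add: exp_add[symmetric] algebra_simps)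
    finally show ?case .
  qed
qed

context sl_cocycle
begin

abbreviation "slow_rate j \<equiv> top.rate - 1 / real (Suc j)"

text \<open>
  The vectors that grow at a rate below the top one. The countable family of rates
  \<open>slow_rate j\<close> makes membership measurable.
\<close>
definition slow :: "(nat \<Rightarrow> 's) \<Rightarrow> (real ^ 'm) set" where
  "slow \<omega> = {v. \<exists>j. \<forall>\<^sub>F n in sequentially. norm (A n \<omega> *v v) \<le> exp (slow_rate j * real n)}"

lemma slow_rate_mono: "i \<le> j \<Longrightarrow> slow_rate i \<le> slow_rate j"
  by (simp add: frac_le)

lemma slow_rate_less: "slow_rate j < slow_rate (Suc j)"
  by (simp add: field_simps)

lemma slowI:
  assumes "\<forall>\<^sub>F n in sequentially. norm (A n \<omega> *v v) \<le> c * exp (slow_rate j * real n)"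
  shows "v \<in> slow \<omega>"
proof -
  have "\<forall>\<^sub>F n in sequentially. c * exp (slow_rate j * real n) \<le> exp (slow_rate (Suc j) * real n)"
    by (rule eventually_const_mult_exp_le) (rule slow_rate_less)
  with assms have "\<forall>\<^sub>F n in sequentially. norm (A n \<omega> *v v) \<le> exp (slow_rate (Suc j) * real n)"
    by eventually_elim (rule order_trans)
  then show ?thesis unfolding slow_def by blast
qed

lemma subspace_slow: "subspace (slow \<omega>)"
proof -
  have "x + y \<in> slow \<omega>" if xy: "x \<in> slow \<omega>" "y \<in> slow \<omega>" for x y
  proof -
    obtain i where i: "\<forall>\<^sub>F n in sequentially. norm (A n \<omega> *v x) \<le> exp (slow_rate i * real n)"
      using xy(1) unfolding slow_def by blast
    obtain j where j: "\<forall>\<^sub>F n in sequentially. norm (A n \<omega> *v y) \<le> exp (slow_rate j * real n)"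
      using xy(2) unfolding slow_def by blast
    have "\<forall>\<^sub>F n in sequentially. norm (A n \<omega> *v (x + y)) \<le> 2 * exp (slow_rate (max i j) * real n)"
      using i j
    proof eventually_elim
      case (elim n)
      have "norm (A n \<omega> *v (x + y)) \<le> exp (slow_rate i * real n) + exp (slow_rate j * real n)"
        using elim norm_triangle_le[of "A n \<omega> *v x" "A n \<omega> *v y"] by (simp add: matrix_vector_right_distrib)
      moreover have "exp (slow_rate i * real n) \<le> exp (slow_rate (max i j) * real n)"
        unfolding exp_le_cancel_iff by (intro mult_right_mono slow_rate_mono) auto
      moreover have "exp (slow_rate j * real n) \<le> exp (slow_rate (max i j) * real n)"
        unfolding exp_le_cancel_iff by (intro mult_right_mono slow_rate_mono) auto
      ultimately show ?case by linarith
    qed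
    then show ?thesis by (rule slowI)
  qed
  moreover have "c *\<^sub>R x \<in> slow \<omega>" if x: "x \<in> slow \<omega>" for x c
  proof -
    obtain j where "\<forall>\<^sub>F n in sequentially. norm (A n \<omega> *v x) \<le> exp (slow_rate j * real n)"
      using x unfolding slow_def by blast
    then have "\<forall>\<^sub>F n in sequentially. norm (A n \<omega> *v (c *\<^sub>R x)) \<le> \<bar>c\<bar> * exp (slow_rate j * real n)"
      by eventually_elim (simp add: matrix_vector_mult_scaleR mult_left_mono)
    then show ?thesis by (rule slowI)
  qed
  moreover have "0 \<in> slow \<omega>" unfolding slow_def by simp
  ultimately show ?thesis unfolding subspace_def by blast
qed

lemma slow_comb_seq:
  assumes "v \<in> slow (comb_seq k \<omega> \<omega>')"
  shows "A k \<omega> *v v \<in> slow \<omega>'"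
proof -
  obtain j where "\<forall>\<^sub>F n in sequentially. norm (A n (comb_seq k \<omega> \<omega>') *v v) \<le> exp (slow_rate j * real n)"
    using assms unfolding slow_def by blast
  then have "\<forall>\<^sub>F n in sequentially. norm (A (n + k) (comb_seq k \<omega> \<omega>') *v v) \<le> exp (slow_rate j * real (n + k))"
    by (subst eventually_sequentially_seg)
  then have "\<forall>\<^sub>F n in sequentially. norm (A n \<omega>' *v (A k \<omega> *v v)) \<le> exp (slow_rate j * real k) * exp (slow_rate j * real n)"
  proof eventually_elim
    case (elim n)
    have "A (n + k) (comb_seq k \<omega> \<omega>') = A n \<omega>' ** A k \<omega>"
      using mat_prod_add[of a k n "comb_seq k \<omega> \<omega>'"] by (simp add: add.commute)
    then have "norm (A n \<omega>' *v (A k \<omega> *v v)) \<le> exp (slow_rate j * real (n + k))"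
      using elim by (simp add: matrix_vector_mul_assoc)
    also have "\<dots> = exp (slow_rate j * real k) * exp (slow_rate j * real n)"
      by (simp only: exp_add[symmetric] of_nat_add ring_distribs add.commute)
    finally show ?case .
  qed
  then show ?thesis by (rule slowI)
qed

lemma slow_sets: "{\<omega>. v \<in> slow \<omega>} \<in> sets S"
proof -
  have "{\<omega> \<in> space S. \<exists>j. \<exists>N. \<forall>n\<ge>N. norm (A n \<omega> *v v) \<le> exp (slow_rate j * real n)} \<in> sets S"
    by measurable
  then show ?thesis by (simp add: slow_def eventually_sequentially)
qed

text \<open>
  If some vector is slow with positive probability, then after suitable words its image is slow
  with probability close to one; by compactness of the sphere and since \<open>slow \<omega>\<close> is closed, a limit
  of the directions of these images is slow almost surely.
\<close>
lemma ex_almost_surely_slow: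
  assumes "v \<noteq> 0" "measure S {\<omega>. v \<in> slow \<omega>} \<noteq> 0"
  shows "\<exists>x. x \<noteq> 0 \<and> (AE \<omega> in S. x \<in> slow \<omega>)"
proof -
  have pos: "0 < measure S {\<omega>. v \<in> slow \<omega>}" using assms(2) by (simp add: zero_less_measure_iff)
  have "\<exists>x. norm x = 1 \<and> 1 - (1/2) ^ j \<le> measure S {\<omega>. x \<in> slow \<omega>}" for j
  proof -
    obtain k \<omega> where k: "1 - (1/2) ^ j \<le> measure S {\<omega>'. comb_seq k \<omega> \<omega>' \<in> {\<omega>. v \<in> slow \<omega>}}"
      using almost_certain_after_word[OF slow_sets pos, of "(1/2) ^ j"] by auto
    define x where "x = (1 / norm (A k \<omega> *v v)) *\<^sub>R (A k \<omega> *v v)"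
    have "{\<omega>'. comb_seq k \<omega> \<omega>' \<in> {\<omega>. v \<in> slow \<omega>}} \<subseteq> {\<omega>. x \<in> slow \<omega>}"
      unfolding x_def using slow_comb_seq subspace_scale[OF subspace_slow] by auto
    then have "measure S {\<omega>'. comb_seq k \<omega> \<omega>' \<in> {\<omega>. v \<in> slow \<omega>}} \<le> measure S {\<omega>. x \<in> slow \<omega>}"
      by (intro finite_measure_mono slow_sets)
    moreover have "norm x = 1" using assms(1) by (simp add: x_def)
    ultimately show ?thesis using k by (intro exI[of _ x]) auto
  qed
  then have "\<exists>x. \<forall>j. norm (x j) = 1 \<and> 1 - (1/2) ^ j \<le> measure S {\<omega>. x j \<in> slow \<omega>}"
    by (intro choice) simp
  then obtain x :: "nat \<Rightarrow> real ^ 'm" where x: "\<And>j. norm (x j) = 1"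
      "\<And>j. 1 - (1/2) ^ j \<le> measure S {\<omega>. x j \<in> slow \<omega>}" by blast
  have "\<forall>j. x j \<in> sphere 0 1" using x(1) by simp
  then obtain y r where y: "y \<in> sphere 0 1" "strict_mono r" "(x \<circ> r) \<longlonglongrightarrow> y"
    using compact_sphere[of "0 :: real ^ 'm" 1] unfolding compact_def by metis
  define B where "B j = space S - {\<omega>. x (r j) \<in> slow \<omega>}" for j
  have B_le: "measure S (B j) \<le> (1/2) ^ j" for j
  proof -
    have "measure S (B j) = 1 - measure S {\<omega>. x (r j) \<in> slow \<omega>}"
      unfolding B_def by (rule P.prob_compl) (rule slow_sets)
    also have "\<dots> \<le> (1/2) ^ r j" using x(2)[of "r j"] by linarith
    also have "\<dots> \<le> (1/2) ^ j" by (intro power_decreasing strict_mono_imp_increasing y(2)) auto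
    finally show ?thesis .
  qed
  have "summable (\<lambda>j. measure S (B j))"
    by (rule summable_comparison_test[OF _ summable_geometric[of "1/2"]]) (use B_le in auto)
  moreover have "B j \<in> sets S" for j
    unfolding B_def by (rule sets.compl_sets) (rule slow_sets)
  ultimately have "AE \<omega> in S. \<forall>\<^sub>F j in sequentially. \<omega> \<in> space S - B j"
    by (intro borel_cantelli_AE1) (auto simp: emeasure_eq_measure)
  then have "AE \<omega> in S. y \<in> slow \<omega>"
  proof eventually_elim
    case (elim \<omega>)
    then have "\<forall>\<^sub>F j in sequentially. (x \<circ> r) j \<in> slow \<omega>"
      by eventually_elim (simp add: B_def)
    then show ?case
      by (rule Lim_in_closed_set[OF closed_subspace[OF subspace_slow] _ sequentially_bot y(3)])
  qed
  moreover have "y \<noteq> 0" using y(1) by auto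
  ultimately show ?thesis by blast
qed

lemma slow_subspace_opnorm:
  assumes E: "subspace E" "E \<noteq> {0}" "E \<subseteq> slow \<omega>"
  shows "\<exists>j. \<forall>\<^sub>F n in sequentially. opnorm_on E (A n \<omega>) \<le> exp (slow_rate j * real n)"
proof -
  obtain B where B: "B \<subseteq> E" "pairwise orthogonal B" "\<And>x. x \<in> B \<Longrightarrow> norm x = 1" "independent B"
    "card B = dim E" "span B = E"
    using orthonormal_basis_subspace[OF E(1)] by metis
  have finB: "finite B" using B(4) by (rule independent_imp_finite)
  have "\<forall>b\<in>B. \<exists>j. \<forall>\<^sub>F n in sequentially. norm (A n \<omega> *v b) \<le> exp (slow_rate j * real n)"
    using B(1) E(3) unfolding slow_def by blast
  from bchoice[OF this] obtain f where f:
      "\<And>b. b \<in> B \<Longrightarrow> \<forall>\<^sub>F n in sequentially. norm (A n \<omega> *v b) \<le> exp (slow_rate (f b) * real n)"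
    by blast
  define j where "j = Max (insert 0 (f ` B))"
  have fj: "f b \<le> j" if "b \<in> B" for b unfolding j_def using finB that by (intro Max_ge) auto
  have "\<forall>\<^sub>F n in sequentially. \<forall>b\<in>B. norm (A n \<omega> *v b) \<le> exp (slow_rate (f b) * real n)"
    using finB f by (simp add: eventually_ball_finite)
  moreover have "\<forall>\<^sub>F n in sequentially. real (card B) * exp (slow_rate j * real n) \<le> exp (slow_rate (Suc j) * real n)"
    by (rule eventually_const_mult_exp_le) (rule slow_rate_less)
  ultimately have "\<forall>\<^sub>F n in sequentially. opnorm_on E (A n \<omega>) \<le> exp (slow_rate (Suc j) * real n)"
  proof eventually_elim
    case (elim n)
    have unit: "norm (A n \<omega> *v v) \<le> exp (slow_rate (Suc j) * real n)" if v: "v \<in> E" "norm v = 1" for v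
    proof -
      have "v = (\<Sum>b\<in>B. (v \<bullet> b) *\<^sub>R b)"
      proof -
        have "v \<in> span B" using v B(6) by simp
        then show ?thesis
          by (intro sym[OF orthonormal_basis_expand] B(2,3) finB)
      qed
      then have "A n \<omega> *v v = (\<Sum>b\<in>B. (v \<bullet> b) *\<^sub>R (A n \<omega> *v b))"
        using linear_sum[OF matrix_vector_mul_linear, of "A n \<omega>" "\<lambda>b. (v \<bullet> b) *\<^sub>R b" B]
        by (simp add: matrix_vector_mult_scaleR)
      then have "norm (A n \<omega> *v v) \<le> (\<Sum>b\<in>B. norm ((v \<bullet> b) *\<^sub>R (A n \<omega> *v b)))"
        by (simp only: norm_sum)
      also have "\<dots> \<le> (\<Sum>b\<in>B. exp (slow_rate j * real n))"
      proof (rule sum_mono)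
        fix b assume b: "b \<in> B"
        have "\<bar>v \<bullet> b\<bar> \<le> 1" using Cauchy_Schwarz_ineq2[of v b] v B(3)[OF b] by simp
        moreover have "norm (A n \<omega> *v b) \<le> exp (slow_rate j * real n)"
        proof -
          have "slow_rate (f b) * real n \<le> slow_rate j * real n"
            by (intro mult_right_mono slow_rate_mono fj b) simp
          then show ?thesis using elim(1) b by (meson exp_le_cancel_iff order_trans)
        qed
        ultimately have "\<bar>v \<bullet> b\<bar> * norm (A n \<omega> *v b) \<le> 1 * exp (slow_rate j * real n)"
          by (intro mult_mono) auto
        then show "norm ((v \<bullet> b) *\<^sub>R (A n \<omega> *v b)) \<le> exp (slow_rate j * real n)" by simp
      qed
      also have "\<dots> \<le> exp (slow_rate (Suc j) * real n)" using elim(2) by simp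
      finally show ?thesis .
    qed
    obtain e where "e \<in> E" "e \<noteq> 0" using E(1,2) subspace_0 by blast
    then have "(1 / norm e) *\<^sub>R e \<in> {v \<in> E. norm v = 1}" using E(1) by (simp add: subspace_scale)
    then have "{v \<in> E. norm v = 1} \<noteq> {}" by blast
    then show ?case unfolding opnorm_on_def by (rule cSUP_least) (use unit in auto)
  qed
  then show ?thesis by blast
qed

end

text \<open>
  Quasi-irreducibility in the form in which it is used: on no nonzero invariant subspace, the whole
  space included, do the products grow at a rate below the top one.
\<close>
locale quasi_irreducible_cocycle = sl_cocycle M a q
  for M :: "'s measure" and a :: "'s \<Rightarrow> real ^ 'm ^ 'm" and q :: real +
  assumes no_slow_subspace: "\<And>E. subspace E \<Longrightarrow> E \<noteq> {0} \<Longrightarrow>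
    (AE s in M. (\<lambda>v. a s *v v) ` E \<subseteq> E) \<Longrightarrow>
    \<not> (AE \<omega> in S. \<exists>l < top.rate. \<forall>\<^sub>F n in sequentially. opnorm_on E (A n \<omega>) \<le> exp (l * real n))"
begin

text \<open>
  The almost surely slow vectors form an invariant subspace, on which a basis being slow makes the
  restricted norms slow.
\<close>
lemma not_slow:
  assumes "v \<noteq> 0"
  shows "AE \<omega> in S. v \<notin> slow \<omega>"
proof (rule ccontr)
  assume n: "\<not> ?thesis"
  have "measure S {\<omega>. v \<in> slow \<omega>} \<noteq> 0"
  proof
    assume "measure S {\<omega>. v \<in> slow \<omega>} = 0"
    then have "{\<omega>. v \<in> slow \<omega>} \<in> null_sets S" using slow_sets[of v] by (auto simp: null_sets_def emeasure_eq_measure)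
    then show False using n AE_not_in by force
  qed
  with assms obtain x where x: "x \<noteq> 0" "AE \<omega> in S. x \<in> slow \<omega>" using ex_almost_surely_slow by blast
  define E where "E = {x. AE \<omega> in S. x \<in> slow \<omega>}"
  have E: "subspace E"
    unfolding subspace_def E_def mem_Collect_eq
  proof (intro conjI ballI allI)
    show "AE \<omega> in S. 0 \<in> slow \<omega>" by (simp add: subspace_0[OF subspace_slow])
    fix x y :: "real ^ 'm" and c :: real
    assume x: "x \<in> {x. AE \<omega> in S. x \<in> slow \<omega>}"
    then have x': "AE \<omega> in S. x \<in> slow \<omega>" by simp
    then show "AE \<omega> in S. c *\<^sub>R x \<in> slow \<omega>"
      by eventually_elim (rule subspace_scale[OF subspace_slow])
    assume "y \<in> {x. AE \<omega> in S. x \<in> slow \<omega>}"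
    then have "AE \<omega> in S. y \<in> slow \<omega>" by simp
    with x' show "AE \<omega> in S. x + y \<in> slow \<omega>"
      by eventually_elim (rule subspace_add[OF subspace_slow])
  qed
  obtain B where B: "B \<subseteq> E" "independent B" "E \<subseteq> span B" using basis_exists by metis
  have finB: "finite B" using B(2) by (rule independent_imp_finite)
  have "AE s in M. a s *v b \<in> E" if "b \<in> B" for b
  proof -
    have "AE \<omega> in S. b \<in> slow \<omega>" using that B(1) by (auto simp: E_def)
    then have "AE s in M. AE \<omega> in S. b \<in> slow (case_nat s \<omega>)" by (rule AE_case_nat)
    then show ?thesis
    proof eventually_elim
      case (elim s)
      have "a s *v b \<in> slow \<omega>" if "b \<in> slow (case_nat s \<omega>)" for \<omega>
        using slow_comb_seq[of b 1 "\<lambda>_. s" \<omega>] that by simp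
      then have "AE \<omega> in S. a s *v b \<in> slow \<omega>" using elim by (rule eventually_mono[rotated])
      then show ?case by (simp add: E_def)
    qed
  qed
  then have "AE s in M. \<forall>b\<in>B. a s *v b \<in> E" by (intro AE_finite_allI finB)
  then have inv: "AE s in M. (\<lambda>v. a s *v v) ` E \<subseteq> E"
  proof eventually_elim
    case (elim s)
    have "(\<lambda>v. a s *v v) ` E \<subseteq> (\<lambda>v. a s *v v) ` span B" using B(3) by (rule image_mono)
    also have "\<dots> = span ((\<lambda>v. a s *v v) ` B)" by (rule linear_span_image[symmetric]) (rule matrix_vector_mul_linear)
    also have "\<dots> \<subseteq> E" using elim E by (intro span_minimal) auto
    finally show ?case .
  qed
  have ne: "E \<noteq> {0}" using x by (auto simp: E_def)
  have "AE \<omega> in S. \<forall>b\<in>B. b \<in> slow \<omega>" 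
    by (rule AE_finite_allI[OF finB]) (use B(1) in \<open>auto simp: E_def\<close>)
  then have "AE \<omega> in S. \<exists>l < top.rate. \<forall>\<^sub>F n in sequentially. opnorm_on E (A n \<omega>) \<le> exp (l * real n)"
  proof eventually_elim
    case (elim \<omega>)
    then have "span B \<subseteq> slow \<omega>" by (intro span_minimal subspace_slow) auto
    then obtain j where "\<forall>\<^sub>F n in sequentially. opnorm_on E (A n \<omega>) \<le> exp (slow_rate j * real n)"
      using slow_subspace_opnorm[OF E ne, of \<omega>] B(3) by blast
    then show ?case by (intro exI[of _ "slow_rate j"]) simp
  qed
  then show False using no_slow_subspace[OF E ne inv] by blast
qed

text \<open>
  Uniformity in the direction, by compactness: the events that the growth stays below \<open>l\<close> up to
  time \<open>N\<close> decrease in \<open>N\<close>, and their probabilities are upper semicontinuous in the direction up to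
  replacing strict by weak inequalities.
\<close>
lemma uniformly_not_slow:
  assumes "l < top.rate" "0 < \<epsilon>"
  shows "\<exists>N. \<forall>x. x \<noteq> 0 \<longrightarrow>
    measure S {\<omega>. \<forall>n\<in>{1..N}. norm (A n \<omega> *v x) < exp (l * real n) * norm x} \<le> \<epsilon>"
proof (rule ccontr)
  define Q where "Q N x = {\<omega>. \<forall>n\<in>{1..N}. norm (A n \<omega> *v x) < exp (l * real n) * norm x}" for N :: nat and x
  define R where "R N x = {\<omega>. \<forall>n\<in>{1..N}. norm (A n \<omega> *v x) \<le> exp (l * real n) * norm x}" for N :: nat and x
  have Q_sets: "Q N x \<in> sets S" and R_sets: "R N x \<in> sets S" for N x
  proof -
    have "{\<omega> \<in> space S. \<forall>n\<in>{1..N}. norm (A n \<omega> *v x) < exp (l * real n) * norm x} \<in> sets S" by measurable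
    then show "Q N x \<in> sets S" by (simp add: Q_def)
    have "{\<omega> \<in> space S. \<forall>n\<in>{1..N}. norm (A n \<omega> *v x) \<le> exp (l * real n) * norm x} \<in> sets S" by measurable
    then show "R N x \<in> sets S" by (simp add: R_def)
  qed
  assume "\<not> ?thesis"
  then have bad: "\<And>N. \<exists>x. x \<noteq> 0 \<and> \<epsilon> < measure S (Q N x)" unfolding Q_def by (meson not_le)
  have "\<exists>x. norm x = 1 \<and> \<epsilon> < measure S (Q N x)" for N
  proof -
    obtain x where x: "x \<noteq> 0" "\<epsilon> < measure S (Q N x)" using bad by blast
    have "Q N ((1 / norm x) *\<^sub>R x) = Q N x"
      using x(1) by (simp add: Q_def matrix_vector_mult_scaleR field_simps)
    then show ?thesis using x by (intro exI[of _ "(1 / norm x) *\<^sub>R x"]) auto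
  qed
  then have "\<exists>x. \<forall>N. norm (x N) = 1 \<and> \<epsilon> < measure S (Q N (x N))" by (intro choice) simp
  then obtain x :: "nat \<Rightarrow> real ^ 'm" where x: "\<And>N. norm (x N) = 1" "\<And>N. \<epsilon> < measure S (Q N (x N))" by blast
  have "\<forall>N. x N \<in> sphere 0 1" using x(1) by simp
  then obtain y r where y: "y \<in> sphere 0 1" "strict_mono r" "(x \<circ> r) \<longlonglongrightarrow> y"
    using compact_sphere[of "0 :: real ^ 'm" 1] unfolding compact_def by metis
  have R_ge: "\<epsilon> \<le> measure S (R K y)" for K
  proof -
    define L where "L m = (\<Union>N\<in>{m..}. Q K (x (r (N + K))))" for m
    have L_sets: "L m \<in> sets S" for m unfolding L_def using Q_sets by (intro sets.countable_UN') auto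
    have L_ge: "\<epsilon> \<le> measure S (L m)" for m
    proof -
      have "K \<le> r (m + K)" using strict_mono_imp_increasing[OF y(2), of "m + K"] by linarith
      then have "Q (r (m + K)) (x (r (m + K))) \<subseteq> Q K (x (r (m + K)))" by (auto simp: Q_def)
      also have "\<dots> \<subseteq> L m" by (auto simp: L_def)
      finally have "measure S (Q (r (m + K)) (x (r (m + K)))) \<le> measure S (L m)"
        by (intro finite_measure_mono L_sets)
      then show ?thesis using x(2)[of "r (m + K)"] by linarith
    qed
    have "(\<lambda>m. measure S (L m)) \<longlonglongrightarrow> measure S (\<Inter>m. L m)"
    proof (rule finite_Lim_measure_decseq)
      show "decseq L" unfolding decseq_def L_def by (intro allI impI UN_mono) auto
    qed (use L_sets in auto)
    then have "\<epsilon> \<le> measure S (\<Inter>m. L m)" by (rule LIMSEQ_le_const) (use L_ge in auto)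
    also have "\<dots> \<le> measure S (R K y)"
    proof (intro finite_measure_mono R_sets subsetI)
      fix \<omega> assume "\<omega> \<in> (\<Inter>m. L m)"
      then have freq: "\<exists>\<^sub>F N in sequentially. \<omega> \<in> Q K (x (r (N + K)))"
        unfolding frequently_sequentially L_def by blast
      show "\<omega> \<in> R K y" unfolding R_def mem_Collect_eq
      proof
        fix n assume n: "n \<in> {1..K}"
        have lim: "(\<lambda>N. x (r (N + K))) \<longlonglongrightarrow> y" using LIMSEQ_ignore_initial_segment[OF y(3), of K] by simp
        have cont: "(\<lambda>N. A n \<omega> *v x (r (N + K))) \<longlonglongrightarrow> A n \<omega> *v y"
          by (rule isCont_tendsto_compose[OF matrix_vector_mult_linear_continuous_at lim])
        have l1: "(\<lambda>N. exp (l * real n) * norm (x (r (N + K))) - norm (A n \<omega> *v x (r (N + K))))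
          \<longlonglongrightarrow> exp (l * real n) * norm y - norm (A n \<omega> *v y)"
          by (intro tendsto_intros lim cont)
        show "norm (A n \<omega> *v y) \<le> exp (l * real n) * norm y"
        proof (rule ccontr)
          assume "\<not> ?thesis"
          then have "\<forall>\<^sub>F N in sequentially. exp (l * real n) * norm (x (r (N + K))) - norm (A n \<omega> *v x (r (N + K))) < 0"
            by (intro order_tendstoD(2)[OF l1]) simp
          then have "\<forall>\<^sub>F N in sequentially. \<omega> \<notin> Q K (x (r (N + K)))"
            by eventually_elim (use n in \<open>force simp: Q_def\<close>)
          then show False using freq by (simp add: frequently_def)
        qed
      qed
    qed
    finally show ?thesis .
  qed
  have "(\<lambda>K. measure S (R K y)) \<longlonglongrightarrow> measure S (\<Inter>K. R K y)"
    using R_sets by (intro finite_Lim_measure_decseq) (auto simp: decseq_def R_def)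
  then have "\<epsilon> \<le> measure S (\<Inter>K. R K y)" by (rule LIMSEQ_le_const) (use R_ge in auto)
  moreover have "measure S (\<Inter>K. R K y) = 0"
  proof -
    have y1: "norm y = 1" using y(1) by simp
    obtain j where j: "l \<le> slow_rate j"
    proof -
      obtain j where "inverse (real (Suc j)) < top.rate - l" using reals_Archimedean[of "top.rate - l"] assms(1) by auto
      then show thesis using that[of j] by (simp add: inverse_eq_divide)
    qed
    have "(\<Inter>K. R K y) \<subseteq> {\<omega>. y \<in> slow \<omega>}"
    proof
      fix \<omega> assume w: "\<omega> \<in> (\<Inter>K. R K y)"
      have "norm (A n \<omega> *v y) \<le> 1 * exp (slow_rate j * real n)" if "1 \<le> n" for n
      proof -
        have "\<omega> \<in> R n y" using w by blast
        then have "norm (A n \<omega> *v y) \<le> exp (l * real n)" using that y1 by (auto simp: R_def)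
        also have "\<dots> \<le> exp (slow_rate j * real n)" using j by (simp add: mult_right_mono)
        finally show ?thesis by simp
      qed
      then have "y \<in> slow \<omega>" by (intro slowI[of _ _ 1 j]) (auto intro: eventually_sequentiallyI[of 1])
      then show "\<omega> \<in> {\<omega>. y \<in> slow \<omega>}" by simp
    qed
    moreover have "{\<omega>. y \<in> slow \<omega>} \<in> null_sets S"
    proof -
      have "AE \<omega> in S. y \<notin> slow \<omega>" using y1 by (intro not_slow) auto
      then show ?thesis using slow_sets[of y] by (simp add: AE_iff_null_sets)
    qed
    ultimately have "measure S (\<Inter>K. R K y) \<le> measure S {\<omega>. y \<in> slow \<omega>}" using slow_sets by (intro finite_measure_mono)
    also have "\<dots> = 0" using \<open>{\<omega>. y \<in> slow \<omega>} \<in> null_sets S\<close> by (simp add: measure_eq_0_null_sets)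
    finally show ?thesis by (simp add: measure_le_0_iff)
  qed
  ultimately show False using assms(2) by simp
qed

text \<open>
  Greedy cutting, applied to \<open>- ln (|A n x| / |x|)\<close> with the nonzero vectors as states: by
  \<open>uniformly_not_slow\<close>, an orbit rarely has to wait longer than \<open>N\<close> steps for a stretch of growth at rate
  \<open>l\<close>, wherever it is.
\<close>
lemma uniform_growth:
  assumes "l < top.rate" "0 < \<epsilon>"
  shows "\<exists>c. \<forall>m. \<forall>x. x \<noteq> 0 \<longrightarrow>
    (l - \<epsilon>) * real m - c \<le> (\<integral>\<omega>. ln (norm (A m \<omega> *v x) / norm x) \<partial>S)"
proof -
  define h where "h n \<omega> x = - ln (norm (A n \<omega> *v x) / norm x)" for n \<omega> and x :: "real ^ 'm"
  have shift: "h k (drop_seq n \<omega>) (A n \<omega> *v x) = - ln (norm (A (n + k) \<omega> *v x) / norm (A n \<omega> *v x))" for n k \<omega> x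
    by (simp add: h_def mat_prod_add matrix_vector_mul_assoc)
  have "\<exists>c. \<forall>m. \<forall>x\<in>-{0}. (\<integral>\<omega>. h m \<omega> x \<partial>S) \<le> (- l + \<epsilon>) * real m + c"
  proof (rule integral_le_of_often_small[where T = "\<lambda>n \<omega> x. A n \<omega> *v x" and \<psi> = logd])
    fix n k \<omega> and x :: "real ^ 'm" assume x: "x \<in> - {0}"
    have pos: "0 < norm (A n \<omega> *v x)" for n using x by simp
    show "h (n + k) \<omega> x \<le> h n \<omega> x + h k (drop_seq n \<omega>) (A n \<omega> *v x)"
      unfolding shift unfolding h_def using pos[of n] pos[of "n + k"] x by (simp add: ln_div)
    show "A (n + k) \<omega> *v x = A k (drop_seq n \<omega>) *v (A n \<omega> *v x)"
      by (simp add: mat_prod_add matrix_vector_mul_assoc)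
    show "A n \<omega> *v x \<in> - {0}" using x by simp
    show "\<bar>h n \<omega> x\<bar> \<le> (\<Sum>i<n. logd (\<omega> i))"
    proof -
      have "1 / dist_prod n \<omega> \<le> norm (A n \<omega> *v x) / norm x"
        using norm_le_A[of x n \<omega>] dist_prod_ge_1[of n \<omega>] x by (simp add: field_simps)
      moreover have "norm (A n \<omega> *v x) / norm x \<le> dist_prod n \<omega>"
        using norm_A_le[of n \<omega> x] x by (simp add: field_simps)
      ultimately have "\<bar>ln (norm (A n \<omega> *v x) / norm x)\<bar> \<le> ln (dist_prod n \<omega>)"
        using pos[of n] x dist_prod_ge_1[of n \<omega>] by (intro abs_ln_le) auto
      then show ?thesis using ln_ge_zero[OF dist_prod_ge_1[of n \<omega>]] by (simp add: h_def sum_logd)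
    qed
  next
    fix n i and x :: "real ^ 'm"
    show "(\<lambda>\<omega>. h n (drop_seq i \<omega>) (A i \<omega> *v x)) \<in> borel_measurable S"
      unfolding shift by measurable
  next
    fix \<delta> :: real assume "0 < \<delta>"
    then obtain N where N: "\<And>x. x \<noteq> 0 \<Longrightarrow>
      measure S {\<omega>. \<forall>n\<in>{1..N}. norm (A n \<omega> *v x) < exp (l * real n) * norm x} \<le> \<delta>"
      using uniformly_not_slow[OF assms(1)] by blast
    have "- l * real n < h n \<omega> x \<longleftrightarrow> norm (A n \<omega> *v x) < exp (l * real n) * norm x" if "x \<noteq> 0" for n \<omega> x
    proof -
      have "- l * real n < h n \<omega> x \<longleftrightarrow> ln (norm (A n \<omega> *v x) / norm x) < ln (exp (l * real n))" by (auto simp: h_def)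
      also have "\<dots> \<longleftrightarrow> norm (A n \<omega> *v x) / norm x < exp (l * real n)"
        using that by (intro ln_less_cancel_iff) auto
      finally show ?thesis using that by (simp add: field_simps)
    qed
    then show "\<exists>N. \<forall>x\<in>-{0}. measure S {\<omega>. \<forall>n\<in>{1..N}. - l * real n < h n \<omega> x} \<le> \<delta>"
      using N by (intro exI[of _ N]) auto
  qed (use logd_nonneg top.\<psi>_int assms in auto)
  then obtain c where c: "\<And>m x. x \<noteq> 0 \<Longrightarrow> (\<integral>\<omega>. h m \<omega> x \<partial>S) \<le> (- l + \<epsilon>) * real m + c" by auto
  have "(l - \<epsilon>) * real m - c \<le> (\<integral>\<omega>. ln (norm (A m \<omega> *v x) / norm x) \<partial>S)" if "x \<noteq> 0" for m x
    using c[OF that, of m] by (simp add: h_def algebra_simps)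
  then show ?thesis by blast
qed

end

section \<open>Average contraction of directions\<close>

lemma powr_add_le:
  fixes a b t :: real
  assumes "0 \<le> a" "0 \<le> b" "0 < t" "t \<le> 1"
  shows "(a + b) powr t \<le> a powr t + b powr t"
proof (cases "a + b = 0")
  case True
  then show ?thesis using assms by simp
next
  case False
  then have s: "0 < a + b" using assms by simp
  have frac: "z \<le> z powr t" if "0 \<le> z" "z \<le> 1" for z :: real
    using powr_mono'[of t 1 z] that assms by simp
  have "1 = a / (a + b) + b / (a + b)" using s by (simp add: add_divide_distrib[symmetric])
  also have "\<dots> \<le> (a / (a + b)) powr t + (b / (a + b)) powr t"
    using assms s by (intro add_mono frac) auto
  also have "\<dots> = (a powr t + b powr t) / (a + b) powr t"
    using assms s by (simp add: powr_divide add_divide_distrib)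
  finally show ?thesis using s by (simp add: field_simps)
qed

lemma ln_one_plus_le_powr:
  fixes y t :: real
  assumes "0 \<le> y" "0 < t" "t \<le> 1"
  shows "ln (1 + y) \<le> y powr t / t"
proof -
  have "t * ln (1 + y) = ln ((1 + y) powr t)" using assms by (simp add: ln_powr)
  also have "\<dots> \<le> ln (1 + y powr t)"
    using powr_add_le[of 1 y t] assms by (subst ln_le_cancel_iff) (auto intro: add_pos_nonneg)
  also have "\<dots> \<le> y powr t" by (rule ln_add_one_self_le_self) simp
  finally show ?thesis using assms by (simp add: field_simps)
qed

text \<open>
  Logarithms are compared with a power \<open>t\<close> of the difference, since only small moments of the distortion,
  the typical value of \<open>D\<close>, are finite.
\<close>
lemma abs_ln_norm_diff_le:
  fixes u v :: "'v :: real_normed_vector" and t :: real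
  assumes "1 \<le> D * norm u" "1 \<le> D * norm v" "0 \<le> D" "0 < t" "t \<le> 1"
  shows "\<bar>ln (norm u) - ln (norm v)\<bar> \<le> (norm (u - v) * D) powr t / t"
proof -
  have le: "ln (norm u) \<le> ln (norm v) + (norm (u - v) * D) powr t / t"
    if "1 \<le> D * norm u" "1 \<le> D * norm v" for u v :: 'v
  proof -
    have pos: "0 < norm u" "0 < norm v" using that assms(3) by (auto simp: order.strict_iff_order)
    have "norm u \<le> norm v + norm (u - v) * 1" using norm_triangle_ineq[of v "u - v"] by simp
    also have "\<dots> \<le> norm v + norm (u - v) * (D * norm v)" by (intro add_left_mono mult_left_mono that) simp
    also have "\<dots> = norm v * (1 + norm (u - v) * D)" by (simp add: algebra_simps)
    finally have "ln (norm u) \<le> ln (norm v * (1 + norm (u - v) * D))"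
      using pos assms(3) by (subst ln_le_cancel_iff) (auto intro!: mult_pos_pos add_pos_nonneg)
    also have "\<dots> = ln (norm v) + ln (1 + norm (u - v) * D)"
      using pos assms(3) by (intro ln_mult_pos) (auto intro!: add_pos_nonneg)
    also have "ln (1 + norm (u - v) * D) \<le> (norm (u - v) * D) powr t / t"
      using assms by (intro ln_one_plus_le_powr) auto
    finally show ?thesis by simp
  qed
  show ?thesis using le[OF assms(1,2)] le[OF assms(2,1)] by (auto simp: abs_le_iff norm_minus_commute)
qed

text \<open>The sine of the angle between two vectors, a metric on directions.\<close>
definition sdist :: "real ^ 'm \<Rightarrow> real ^ 'm \<Rightarrow> real" where
  "sdist x y = area x y / (norm x * norm y)"

lemma sdist_nonneg: "0 \<le> sdist x y"
  by (simp add: sdist_def area_nonneg)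

lemma sdist_le_1: "sdist x y \<le> 1"
proof (cases "norm x * norm y = 0")
  case False
  then have "0 < norm x * norm y" by simp
  then show ?thesis using area_le[of x y] by (simp only: sdist_def divide_le_eq_1_pos)
next
  case True
  then show ?thesis unfolding sdist_def by (subst True) simp
qed

lemma area_scaleR_right: "area x (c *\<^sub>R y) = \<bar>c\<bar> * area x y"
  using area_scaleR_left[of c y x] by (simp add: area_commute)

lemma sdist_scaleR: "c \<noteq> 0 \<Longrightarrow> d \<noteq> 0 \<Longrightarrow> sdist (c *\<^sub>R x) (d *\<^sub>R y) = sdist x y"
  by (simp add: sdist_def area_scaleR_left area_scaleR_right)

lemma sdist_le_norm_diff:
  assumes "x \<noteq> 0"
  shows "sdist x y \<le> norm (x - y) / norm y"
proof -
  have "area x y = area x (y - x)"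
    using area_lincomb[of 1 x 0 y "-1" 1] by simp
  also have "\<dots> \<le> norm x * norm (x - y)" using area_le[of x "y - x"] by (simp add: norm_minus_commute)
  finally show ?thesis using assms by (simp add: sdist_def divide_simps) (auto simp: mult.commute)
qed

definition lgain :: "real ^ 'm ^ 'm \<Rightarrow> real ^ 'm \<Rightarrow> real" where
  "lgain g x = ln (norm (g *v x) / norm x)"

lemma lgain_scaleR: "c \<noteq> 0 \<Longrightarrow> lgain g (c *\<^sub>R x) = lgain g x"
  by (simp add: lgain_def matrix_vector_mult_scaleR)

lemma lgain_mult:
  assumes "det g = 1" "det h = 1" "x \<noteq> 0"
  shows "lgain (g ** h) x = lgain h x + lgain g (h *v x)"
proof -
  have "h *v x \<noteq> 0" "g *v (h *v x) \<noteq> 0" using assms by (simp_all add: mult_eq_0_iff_det_1)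
  then show ?thesis using assms(3) by (simp add: lgain_def ln_div matrix_vector_mul_assoc[symmetric])
qed

text \<open>
  For unit vectors at an acute angle, \<open>|u - v|\<^sup>2 = 2 (1 - cos) \<le> 2 sin\<^sup>2\<close>; so angles may be replaced
  by differences of representatives.
\<close>
lemma abs_lgain_diff_le:
  fixes g :: "real ^ 'm ^ 'm"
  assumes g: "det g = 1" and xy: "x \<noteq> 0" "y \<noteq> 0" and t: "0 < t" "t \<le> 1"
  shows "\<bar>lgain g x - lgain g y\<bar> \<le> 2 / t * (distortion g powr (2 * t) * sdist x y powr t)"
proof -
  define u where "u = (1 / norm x) *\<^sub>R x"
  define s where "s = (if 0 \<le> x \<bullet> y then 1 else -1 :: real)"
  define v where "v = (s / norm y) *\<^sub>R y"
  have u: "norm u = 1" and v: "norm v = 1" using xy by (auto simp: u_def v_def s_def)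
  have sd: "sdist u v = sdist x y" and lu: "lgain g u = lgain g x" and lv: "lgain g v = lgain g y"
    using xy sdist_scaleR[of "1 / norm x" "s / norm y" x y] lgain_scaleR[of "1 / norm x" g x]
      lgain_scaleR[of "s / norm y" g y] by (auto simp: u_def v_def s_def)
  define c where "c = u \<bullet> v"
  have c0: "0 \<le> c" using xy by (auto simp: c_def u_def v_def s_def divide_nonneg_pos mult_nonpos_nonneg)
  have c1: "c \<le> 1" using norm_cauchy_schwarz[of u v] by (simp add: c_def u v)
  have "(norm (u - v))\<^sup>2 = 2 * (1 - c)"
    using u v unfolding power2_norm_eq_inner norm_eq_1
    by (simp add: inner_diff_left inner_diff_right inner_commute[of v u] c_def)
  also have "\<dots> \<le> 2 * ((1 - c) * (1 + c))" using c0 c1 by (intro mult_left_mono) (auto simp: mult_le_cancel_left1)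
  also have "(1 - c) * (1 + c) = (sdist u v)\<^sup>2"
  proof -
    have "0 \<le> 1 - c\<^sup>2" using c0 c1 by (simp add: power_le_one)
    then have "(sdist u v)\<^sup>2 = 1 - c\<^sup>2" using u v unfolding sdist_def area_def c_def[symmetric]
      by (simp add: dot_square_norm)
    then show ?thesis by (simp add: power2_eq_square algebra_simps)
  qed
  also have "2 * (sdist u v)\<^sup>2 \<le> (2 * sdist u v)\<^sup>2" by (simp add: power2_eq_square)
  finally have uv: "norm (u - v) \<le> 2 * sdist u v"
    by (rule power2_le_imp_le) (simp add: sdist_nonneg)
  have "\<bar>ln (norm (g *v u)) - ln (norm (g *v v))\<bar> \<le> (norm (g *v u - g *v v) * distortion g) powr t / t"
    using norm_le_distortion_mult[OF g, of u] norm_le_distortion_mult[OF g, of v] u v t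
    by (intro abs_ln_norm_diff_le) (auto intro: less_imp_le)
  also have "\<dots> \<le> (distortion g * (2 * sdist u v) * distortion g) powr t / t"
  proof -
    have "norm (g *v u - g *v v) \<le> distortion g * norm (u - v)"
      using norm_mult_le_distortion[of g "u - v"] by (simp add: matrix_vector_mult_diff_distrib)
    also have "\<dots> \<le> distortion g * (2 * sdist u v)" by (intro mult_left_mono uv less_imp_le distortion_pos)
    finally show ?thesis using t
      by (intro divide_right_mono powr_mono2 mult_right_mono) (auto intro: less_imp_le[OF distortion_pos] intro!: mult_nonneg_nonneg)
  qed
  also have "distortion g * (2 * sdist u v) * distortion g = 2 * ((distortion g)\<^sup>2 * sdist u v)"
    by (simp add: power2_eq_square)
  also have "\<dots> powr t = 2 powr t * (distortion g powr (2 * t) * sdist u v powr t)"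
    by (simp add: powr_mult sdist_nonneg powr_powr[symmetric] less_imp_le)
  also have "\<dots> \<le> 2 powr 1 * (distortion g powr (2 * t) * sdist u v powr t)"
    using t by (intro mult_right_mono powr_mono) auto
  finally have "\<bar>lgain g u - lgain g v\<bar> \<le> 2 / t * (distortion g powr (2 * t) * sdist u v powr t)"
    using u v t by (simp add: lgain_def divide_right_mono)
  then show ?thesis by (simp add: sd lu lv)
qed

lemma abs_lgain_compare:
  fixes g h :: "real ^ 'm ^ 'm"
  assumes "x \<noteq> 0" "\<And>x. norm x \<le> D * norm (g *v x)" "\<And>x. norm x \<le> D * norm (h *v x)" "0 \<le> D" "0 < t" "t \<le> 1"
  shows "\<bar>lgain g x - lgain h x\<bar> \<le> (opnorm (g - h) * D) powr t / t"
proof -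
  define u where "u = (1 / norm x) *\<^sub>R x"
  have u: "norm u = 1" using assms(1) by (simp add: u_def)
  have l: "lgain g u = lgain g x" "lgain h u = lgain h x"
    unfolding u_def using assms(1) by (auto intro!: lgain_scaleR)
  have "\<bar>ln (norm (g *v u)) - ln (norm (h *v u))\<bar> \<le> (norm (g *v u - h *v u) * D) powr t / t"
    using assms(2)[of u] assms(3)[of u] assms(4-6) u by (intro abs_ln_norm_diff_le) auto
  also have "\<dots> \<le> (opnorm (g - h) * D) powr t / t"
    using norm_mult_le_opnorm[of "g - h" u] u assms
    by (intro divide_right_mono powr_mono2 mult_right_mono) (auto simp: matrix_vector_mult_diff_rdistrib)
  finally show ?thesis using u by (simp add: l[symmetric]) (simp add: lgain_def)
qed

text \<open>Submultiplicativity for \<open>h = g k\<close>, where \<open>k\<close> is close to the identity.\<close>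
lemma ln_area_norm_compare:
  fixes g h :: "real ^ 'm ^ 'm"
  assumes dim: "CARD('m) \<ge> 2" and det: "det g = 1" "det h = 1"
    and D: "\<And>x. norm x \<le> D * norm (g *v x)" "0 \<le> D" and t: "0 < t" "t \<le> 1"
  shows "ln (area_norm h) \<le> ln (area_norm g) + 2 / t * (opnorm (h - g) * D) powr t"
proof -
  define y where "y = opnorm (h - g) * D"
  have y: "0 \<le> y" by (simp add: y_def D opnorm_nonneg)
  let ?k = "matrix_inv g ** h"
  have h: "h = g ** ?k" using matrix_mult_inv(1)[of g] det by (simp add: matrix_mul_assoc invertible_det_nz)
  have invD: "opnorm (matrix_inv g) \<le> D"
    by (rule opnorm_leI) (use D(1)[of "matrix_inv g *v _"] in \<open>simp add: matrix_inv_apply[OF det(1)]\<close>)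
  have "?k = mat 1 + matrix_inv g ** (h - g)"
    using matrix_add_ldistrib[of "matrix_inv g" g "h - g"] matrix_mult_inv(2)[of g] det
    by (simp add: invertible_det_nz)
  then have "opnorm ?k \<le> opnorm (mat 1 :: real ^ 'm ^ 'm) + opnorm (matrix_inv g ** (h - g))"
    using opnorm_triangle[of "mat 1" "matrix_inv g ** (h - g)"] by simp
  also have "opnorm (matrix_inv g ** (h - g)) \<le> opnorm (matrix_inv g) * opnorm (h - g)" by (rule opnorm_mult_le)
  also have "\<dots> \<le> y" unfolding y_def by (subst mult.commute) (intro mult_left_mono invD opnorm_nonneg)
  finally have k: "opnorm ?k \<le> 1 + y" by (simp add: opnorm_mat_1)
  have pos: "0 < area_norm g" "0 < area_norm h" using area_norm_pos[OF dim] det by auto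
  have "area_norm h \<le> area_norm g * area_norm ?k"
    using area_norm_mult_le[OF dim, of g ?k] h by simp
  also have "\<dots> \<le> area_norm g * (1 + y)\<^sup>2"
    using area_norm_le_opnorm[OF dim, of ?k] power_mono[OF k opnorm_nonneg, of 2] pos by (intro mult_left_mono) auto
  finally have "ln (area_norm h) \<le> ln (area_norm g * (1 + y)\<^sup>2)"
    using pos y by (subst ln_le_cancel_iff) (auto intro!: mult_pos_pos)
  also have "\<dots> = ln (area_norm g) + 2 * ln (1 + y)"
    using pos y by (subst ln_mult_pos) (auto simp: ln_realpow)
  also have "ln (1 + y) \<le> y powr t / t" by (intro ln_one_plus_le_powr y t)
  finally show ?thesis by (simp add: y_def)
qed

locale bounded_cocycle = sl_cocycle M a q for M :: "'s measure" and a :: "'s \<Rightarrow> real ^ 'm ^ 'm" and q :: real +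
  fixes K :: real
  assumes moment_le: "(\<integral>s. distortion (a s) powr q \<partial>M) \<le> K"
begin

lemma distortion_moment:
  assumes "t \<le> q"
  shows "(\<integral>\<^sup>+s. ennreal (distortion (a s) powr t) \<partial>M) \<le> ennreal K"
proof -
  have "(\<integral>\<^sup>+s. ennreal (distortion (a s) powr t) \<partial>M) \<le> (\<integral>\<^sup>+s. ennreal (distortion (a s) powr q) \<partial>M)"
    using assms distortion_ge_1 by (intro nn_integral_mono ennreal_leI powr_mono) auto
  also have "\<dots> = ennreal (\<integral>s. distortion (a s) powr q \<partial>M)"
    using moment by (intro nn_integral_eq_integral) auto
  also have "\<dots> \<le> ennreal K" by (rule ennreal_leI) (rule moment_le)
  finally show ?thesis .
qed

lemma K_ge_1: "1 \<le> K"
proof -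
  have "ennreal 1 \<le> ennreal K" using distortion_moment[of 0] q_pos by (simp add: M.emeasure_space_1)
  then show ?thesis by (subst (asm) ennreal_le_iff2) auto
qed

lemma dist_prod_meas [measurable]: "dist_prod n \<in> borel_measurable S"
  unfolding dist_prod_def by measurable

lemma dist_prod_moment:
  assumes "t \<le> q"
  shows "(\<integral>\<^sup>+\<omega>. ennreal (dist_prod n \<omega> powr t) \<partial>S) \<le> ennreal (K ^ n)"
proof -
  have "(\<integral>\<^sup>+\<omega>. ennreal (dist_prod n \<omega> powr t) \<partial>S) = (\<integral>\<^sup>+\<omega>. (\<Prod>i<n. ennreal (distortion (a (\<omega> i)) powr t)) \<partial>S)"
    by (intro nn_integral_cong) (simp add: dist_prod_def prod_ennreal prod_powr_distrib less_imp_le)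
  also have "\<dots> = (\<integral>\<^sup>+s. ennreal (distortion (a s) powr t) \<partial>M) ^ n"
    by (rule nn_integral_prod_coord) measurable
  also have "\<dots> \<le> ennreal K ^ n" by (intro power_mono distortion_moment assms) simp
  finally show ?thesis using K_ge_1 by (simp add: ennreal_power)
qed

text \<open>
  An upper bound for the logarithm of the factor by which the angles between \<open>x\<close> and directions
  infinitely close to it are multiplied: the growth of areas minus twice the growth of lengths.
\<close>
definition angle_rate :: "nat \<Rightarrow> real ^ 'm \<Rightarrow> (nat \<Rightarrow> 's) \<Rightarrow> real" where
  "angle_rate n x \<omega> = ln (area_norm (A n \<omega>)) - 2 * lgain (A n \<omega>) x"

lemma lgain_A_meas [measurable]: "(\<lambda>\<omega>. lgain (A n \<omega>) x) \<in> borel_measurable S"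
  unfolding lgain_def by measurable

lemma angle_rate_meas [measurable]: "angle_rate n x \<in> borel_measurable S"
  unfolding angle_rate_def using borel_measurable_area_norm[OF dim_ge_2] by measurable

lemma abs_lgain_A_le:
  assumes "x \<noteq> 0"
  shows "\<bar>lgain (A n \<omega>) x\<bar> \<le> ln (dist_prod n \<omega>)"
proof -
  have "1 / dist_prod n \<omega> \<le> norm (A n \<omega> *v x) / norm x"
    using norm_le_A[of x n \<omega>] dist_prod_ge_1[of n \<omega>] assms by (simp add: field_simps)
  moreover have "norm (A n \<omega> *v x) / norm x \<le> dist_prod n \<omega>"
    using norm_A_le[of n \<omega> x] assms by (simp add: field_simps)
  ultimately show ?thesis
    unfolding lgain_def using assms dist_prod_ge_1[of n \<omega>] by (intro abs_ln_le) auto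
qed

lemma abs_angle_rate_le:
  assumes "x \<noteq> 0"
  shows "\<bar>angle_rate n x \<omega>\<bar> \<le> 4 * ln (dist_prod n \<omega>)"
proof -
  have "\<bar>ln (area_norm (A n \<omega>))\<bar> \<le> 2 * ln (dist_prod n \<omega>)"
    using area.bound[of n \<omega>] by (simp add: sum_logd)
  then show ?thesis using abs_lgain_A_le[OF assms, of n \<omega>] by (simp add: angle_rate_def)
qed

lemma exp_angle_rate:
  assumes "x \<noteq> 0" "0 \<le> t" "4 * t \<le> q"
  shows "(\<integral>\<^sup>+\<omega>. ennreal (exp (t * \<bar>angle_rate n x \<omega>\<bar>)) \<partial>S) \<le> ennreal (K ^ n)"
proof -
  have "exp (t * \<bar>angle_rate n x \<omega>\<bar>) \<le> dist_prod n \<omega> powr (4 * t)" for \<omega>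
  proof -
    have "t * \<bar>angle_rate n x \<omega>\<bar> \<le> t * (4 * ln (dist_prod n \<omega>))"
      using abs_angle_rate_le[OF assms(1)] assms(2) by (intro mult_left_mono)
    then show ?thesis using dist_prod_ge_1[of n \<omega>] by (simp add: powr_def mult_ac)
  qed
  then have "(\<integral>\<^sup>+\<omega>. ennreal (exp (t * \<bar>angle_rate n x \<omega>\<bar>)) \<partial>S) \<le> (\<integral>\<^sup>+\<omega>. ennreal (dist_prod n \<omega> powr (4 * t)) \<partial>S)"
    by (intro nn_integral_mono ennreal_leI)
  also have "\<dots> \<le> ennreal (K ^ n)" by (rule dist_prod_moment) (rule assms)
  finally show ?thesis .
qed

text \<open>
  Angles are multiplied by at most the geometric mean of the factors given by the angle rates at the two
  directions; the arithmetic mean separates the directions.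
\<close>
lemma sdist_A_le:
  assumes "x \<noteq> 0" "y \<noteq> 0" "0 \<le> t"
  shows "sdist (A n \<omega> *v x) (A n \<omega> *v y) powr t
    \<le> (exp (t * angle_rate n x \<omega>) + exp (t * angle_rate n y \<omega>)) / 2 * sdist x y powr t"
proof -
  define \<Lambda> where "\<Lambda> = area_norm (A n \<omega>)"
  define u v where "u = norm (A n \<omega> *v x) / norm x" and "v = norm (A n \<omega> *v y) / norm y"
  have pos: "0 < \<Lambda>" "0 < u" "0 < v" using assms area_norm_A_pos by (auto simp: \<Lambda>_def u_def v_def)
  have "sdist (A n \<omega> *v x) (A n \<omega> *v y) \<le> \<Lambda> / (u * v) * sdist x y"
    using area_image_le_area_norm[of "A n \<omega>" x y] assms(1,2) unfolding sdist_def \<Lambda>_def u_def v_def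
    by (simp add: divide_right_mono)
  then have "sdist (A n \<omega> *v x) (A n \<omega> *v y) powr t \<le> (\<Lambda> / (u * v) * sdist x y) powr t"
    using assms(3) by (intro powr_mono2 sdist_nonneg)
  also have "\<dots> = (\<Lambda> / (u * v)) powr t * sdist x y powr t"
    using pos by (intro powr_mult)
  also have "(\<Lambda> / (u * v)) powr t \<le> (exp (t * angle_rate n x \<omega>) + exp (t * angle_rate n y \<omega>)) / 2"
  proof -
    have ex: "exp (t * angle_rate n x \<omega>) = (exp (t * (ln \<Lambda> / 2 - ln u)))\<^sup>2"
      by (simp add: exp_double[symmetric] angle_rate_def lgain_def \<Lambda>_def u_def ring_distribs)
    have ey: "exp (t * angle_rate n y \<omega>) = (exp (t * (ln \<Lambda> / 2 - ln v)))\<^sup>2"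
      by (simp add: exp_double[symmetric] angle_rate_def lgain_def \<Lambda>_def v_def ring_distribs)
    have "(\<Lambda> / (u * v)) powr t = exp (t * (ln \<Lambda> / 2 - ln u)) * exp (t * (ln \<Lambda> / 2 - ln v))"
      using pos by (simp add: powr_def ln_div ln_mult exp_add[symmetric] algebra_simps)
    then show ?thesis unfolding ex ey
      using sum_squares_bound[of "exp (t * (ln \<Lambda> / 2 - ln u))" "exp (t * (ln \<Lambda> / 2 - ln v))"] by simp
  qed
  finally show ?thesis by (simp add: mult_right_mono)
qed

end

locale cocycle_pair = letters M + A: bounded_cocycle M a q K + B: bounded_cocycle M b q K
  for M :: "'s measure" and a b :: "'s \<Rightarrow> real ^ 'm ^ 'm" and q K +
  fixes t d :: real
  assumes t: "0 < t" "4 * t \<le> q" "2 * t \<le> 1"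
    and d: "0 < d" "(\<integral>\<^sup>+s. ennreal (opnorm (a s - b s)) \<partial>M) \<le> ennreal d"
begin

definition wt :: "'s \<Rightarrow> real" where
  "wt s = distortion (a s) * distortion (b s)"

lemma wt_ge_1: "1 \<le> wt s"
  unfolding wt_def using distortion_ge_1[of "a s"] distortion_ge_1[of "b s"] mult_mono[of 1 _ 1] by force

lemma wt_meas [measurable]: "wt \<in> borel_measurable M"
  unfolding wt_def by measurable

lemma distortion_le_wt: "distortion (a s) \<le> wt s" "distortion (b s) \<le> wt s"
  unfolding wt_def using distortion_ge_1[of "a s"] distortion_ge_1[of "b s"]
  by (simp_all add: mult_le_cancel_left1 mult_le_cancel_right1)

lemma wt_moment: "(\<integral>\<^sup>+s. ennreal (wt s powr (2 * t)) \<partial>M) \<le> ennreal K"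
proof -
  have "wt s powr (2 * t) \<le> (distortion (a s) powr (4 * t) + distortion (b s) powr (4 * t)) / 2" for s
  proof -
    let ?x = "distortion (a s) powr (2 * t)" and ?y = "distortion (b s) powr (2 * t)"
    have "wt s powr (2 * t) = ?x * ?y" by (simp add: wt_def powr_mult)
    also have "\<dots> \<le> (?x\<^sup>2 + ?y\<^sup>2) / 2" using sum_squares_bound[of ?x ?y] by simp
    also have "?x\<^sup>2 = distortion (a s) powr (4 * t)" by (simp add: power2_eq_square powr_add[symmetric])
    also have "?y\<^sup>2 = distortion (b s) powr (4 * t)" by (simp add: power2_eq_square powr_add[symmetric])
    finally show ?thesis .
  qed
  then have "(\<integral>\<^sup>+s. ennreal (wt s powr (2 * t)) \<partial>M)
      \<le> (\<integral>\<^sup>+s. ennreal (1/2) * (ennreal (distortion (a s) powr (4 * t)) + ennreal (distortion (b s) powr (4 * t))) \<partial>M)"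
  proof (intro nn_integral_mono)
    fix s assume le: "\<And>s. wt s powr (2 * t) \<le> (distortion (a s) powr (4 * t) + distortion (b s) powr (4 * t)) / 2"
    have "ennreal (wt s powr (2 * t)) \<le> ennreal (1/2 * (distortion (a s) powr (4 * t) + distortion (b s) powr (4 * t)))"
      using le[of s] by (intro ennreal_leI) simp
    also have "\<dots> = ennreal (1/2) * ennreal (distortion (a s) powr (4 * t) + distortion (b s) powr (4 * t))"
      by (rule ennreal_mult') simp
    also have "ennreal (distortion (a s) powr (4 * t) + distortion (b s) powr (4 * t))
        = ennreal (distortion (a s) powr (4 * t)) + ennreal (distortion (b s) powr (4 * t))"
      by (rule ennreal_plus) auto
    finally show "ennreal (wt s powr (2 * t))
        \<le> ennreal (1/2) * (ennreal (distortion (a s) powr (4 * t)) + ennreal (distortion (b s) powr (4 * t)))" .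
  qed
  also have "\<dots> = ennreal (1/2) * ((\<integral>\<^sup>+s. ennreal (distortion (a s) powr (4 * t)) \<partial>M) + (\<integral>\<^sup>+s. ennreal (distortion (b s) powr (4 * t)) \<partial>M))"
    by (simp add: nn_integral_cmult nn_integral_add)
  also have "\<dots> \<le> ennreal (1/2) * (ennreal K + ennreal K)"
    using t by (intro mult_left_mono add_mono A.distortion_moment B.distortion_moment) auto
  also have "ennreal K + ennreal K = ennreal (2 * K)" using A.K_ge_1 by (simp add: ennreal_plus[symmetric] del: ennreal_plus)
  also have "ennreal (1/2) * ennreal (2 * K) = ennreal (1/2 * (2 * K))" by (rule ennreal_mult'[symmetric]) simp
  finally show ?thesis by simp
qed

text \<open>
  Dividing the distance by \<open>d\<close> before applying the arithmetic-geometric mean inequality makes its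
  \<open>2 t\<close>-th power at most one plus a variable of mean at most one; so no moment beyond the
  first is needed, and the factor \<open>d powr t\<close> comes out.
\<close>
lemma diff_moment:
  "(\<integral>\<^sup>+s. ennreal ((opnorm (a s - b s) * wt s) powr t) \<partial>M) \<le> ennreal ((2 + K) * d powr t)"
proof -
  have pw: "(opnorm (a s - b s) * wt s) powr t \<le> d powr t * (1 + opnorm (a s - b s) / d + wt s powr (2 * t))" for s
  proof -
    define y where "y = opnorm (a s - b s) / d"
    have y: "0 \<le> y" unfolding y_def by (intro divide_nonneg_pos opnorm_nonneg d(1))
    have "(opnorm (a s - b s) * wt s) powr t = (d * (y * wt s)) powr t" using d by (simp add: y_def)
    also have "\<dots> = d powr t * (y powr t * wt s powr t)"
      by (simp add: powr_mult)
    also have "y powr t * wt s powr t \<le> 1 + y + wt s powr (2 * t)"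
    proof -
      have "y powr t * wt s powr t \<le> ((y powr t)\<^sup>2 + (wt s powr t)\<^sup>2) / 2"
        using sum_squares_bound[of "y powr t" "wt s powr t"] by simp
      also have "\<dots> \<le> (y powr t)\<^sup>2 + (wt s powr t)\<^sup>2" by simp
      also have "(y powr t)\<^sup>2 = y powr (2 * t)" by (simp add: power2_eq_square powr_add[symmetric])
      also have "(wt s powr t)\<^sup>2 = wt s powr (2 * t)" by (simp add: power2_eq_square powr_add[symmetric])
      also have "y powr (2 * t) \<le> 1 + y"
      proof -
        have "y powr (2 * t) \<le> (1 + y) powr (2 * t)" using y t by (intro powr_mono2) auto
        also have "\<dots> \<le> (1 + y) powr 1" using y t by (intro powr_mono) auto
        finally show ?thesis using y by simp
      qed
      finally show ?thesis by simp
    qed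
    finally show ?thesis using d by (simp add: y_def mult_left_mono)
  qed
  have "(\<integral>\<^sup>+s. ennreal ((opnorm (a s - b s) * wt s) powr t) \<partial>M)
    \<le> (\<integral>\<^sup>+s. ennreal (d powr t) * (1 + ennreal (1 / d) * ennreal (opnorm (a s - b s)) + ennreal (wt s powr (2 * t))) \<partial>M)"
  proof (intro nn_integral_mono)
    fix s
    have "ennreal ((opnorm (a s - b s) * wt s) powr t)
        \<le> ennreal (d powr t * (1 + opnorm (a s - b s) / d + wt s powr (2 * t)))" by (rule ennreal_leI) (rule pw)
    also have "\<dots> = ennreal (d powr t) * (ennreal 1 + ennreal (1 / d * opnorm (a s - b s)) + ennreal (wt s powr (2 * t)))"
      using d opnorm_nonneg[of "a s - b s"]
      by (simp add: ennreal_plus[symmetric] ennreal_mult'[symmetric] del: ennreal_plus ennreal_1)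
    also have "ennreal (1 / d * opnorm (a s - b s)) = ennreal (1 / d) * ennreal (opnorm (a s - b s))"
      using d opnorm_nonneg by (intro ennreal_mult') auto
    finally show "ennreal ((opnorm (a s - b s) * wt s) powr t)
      \<le> ennreal (d powr t) * (1 + ennreal (1 / d) * ennreal (opnorm (a s - b s)) + ennreal (wt s powr (2 * t)))" by simp
  qed
  also have "\<dots> = ennreal (d powr t) * (1 + ennreal (1 / d) * (\<integral>\<^sup>+s. ennreal (opnorm (a s - b s)) \<partial>M)
      + (\<integral>\<^sup>+s. ennreal (wt s powr (2 * t)) \<partial>M))"
    by (simp add: nn_integral_cmult nn_integral_add M.emeasure_space_1)
  also have "\<dots> \<le> ennreal (d powr t) * (1 + ennreal (1 / d) * ennreal d + ennreal K)"
    by (intro mult_left_mono add_mono d wt_moment order_refl) auto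
  also have "\<dots> = ennreal ((2 + K) * d powr t)"
  proof -
    have "ennreal (1 / d) * ennreal d = 1" using d by (simp add: ennreal_mult'[symmetric])
    moreover have "ennreal (2 + K) = ennreal 2 + ennreal K" using A.K_ge_1 by (intro ennreal_plus) auto
    ultimately have "1 + ennreal (1 / d) * ennreal d + ennreal K = ennreal (2 + K)" by simp
    then show ?thesis by (simp only: ennreal_mult'[OF powr_ge_zero, symmetric] mult.commute)
  qed
  finally show ?thesis .
qed

definition wt_prod :: "nat \<Rightarrow> (nat \<Rightarrow> 's) \<Rightarrow> real" where
  "wt_prod n \<omega> = (\<Prod>i<n. wt (\<omega> i))"

lemma wt_prod_meas [measurable]: "wt_prod n \<in> borel_measurable S"
  unfolding wt_prod_def by measurable

lemma wt_prod_ge_1: "1 \<le> wt_prod n \<omega>"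
  unfolding wt_prod_def by (intro prod_ge_1 wt_ge_1)

lemma dist_prod_le_wt_prod: "A.dist_prod n \<omega> \<le> wt_prod n \<omega>" "B.dist_prod n \<omega> \<le> wt_prod n \<omega>"
  unfolding A.dist_prod_def B.dist_prod_def wt_prod_def
  by (intro prod_mono conjI distortion_le_wt less_imp_le distortion_pos)+

lemma wt_prod_moment: "(\<integral>\<^sup>+\<omega>. ennreal (wt_prod n \<omega> powr (2 * t)) \<partial>S) \<le> ennreal (K ^ n)"
proof -
  have "0 \<le> wt s" for s using wt_ge_1[of s] by simp
  then have "(\<integral>\<^sup>+\<omega>. ennreal (wt_prod n \<omega> powr (2 * t)) \<partial>S) = (\<integral>\<^sup>+\<omega>. (\<Prod>i<n. ennreal (wt (\<omega> i) powr (2 * t))) \<partial>S)"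
    by (intro nn_integral_cong) (simp add: wt_prod_def prod_ennreal prod_powr_distrib)
  also have "\<dots> = (\<integral>\<^sup>+s. ennreal (wt s powr (2 * t)) \<partial>M) ^ n"
    by (rule nn_integral_prod_coord) measurable
  also have "\<dots> \<le> ennreal K ^ n" by (intro power_mono wt_moment) simp
  finally show ?thesis using A.K_ge_1 by (simp add: ennreal_power)
qed

text \<open>
  Telescoping at the first letter: \<open>A' a - B' b = (A' - B') a + B' (a - b)\<close>, with independent factors.
  The weight bounds the factors other than the differences.
\<close>
lemma prod_diff_moment:
  "(\<integral>\<^sup>+\<omega>. ennreal ((opnorm (mat_prod a n \<omega> - mat_prod b n \<omega>) * wt_prod n \<omega>) powr t) \<partial>S)
    \<le> ennreal (real n * K ^ n * ((2 + K) * d powr t))"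
proof (induction n)
  case 0
  have "opnorm (0 :: real ^ 'm ^ 'm) = 0" 
    using opnorm_leI[of "0 :: real ^ 'm ^ 'm" 0] opnorm_nonneg[of "0 :: real ^ 'm ^ 'm"] by simp
  then show ?case by simp
next
  case (Suc n)
  let ?J = "\<lambda>n \<omega>. (opnorm (mat_prod a n \<omega> - mat_prod b n \<omega>) * wt_prod n \<omega>) powr t"
  define \<Delta> where "\<Delta> = (2 + K) * d powr t"
  have \<Delta>: "0 \<le> \<Delta>" using A.K_ge_1 by (simp add: \<Delta>_def)
  have pw: "?J (Suc n) (case_nat s \<omega>)
      \<le> ?J n \<omega> * wt s powr (2 * t) + wt_prod n \<omega> powr (2 * t) * (opnorm (a s - b s) * wt s) powr t" for s \<omega>
  proof -
    let ?x = "opnorm (mat_prod a n \<omega> - mat_prod b n \<omega>)" and ?y = "opnorm (a s - b s)"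
    let ?W = "wt_prod n \<omega>" and ?w = "wt s"
    have pos: "0 \<le> ?x" "0 \<le> ?y" "0 \<le> ?W" "0 \<le> ?w" using opnorm_nonneg wt_prod_ge_1[of n \<omega>] wt_ge_1[of s] by auto
    have W: "wt_prod (Suc n) (case_nat s \<omega>) = ?W * ?w"
      by (simp add: wt_prod_def prod.lessThan_Suc_shift del: prod.lessThan_Suc)
    have "mat_prod a (Suc n) (case_nat s \<omega>) - mat_prod b (Suc n) (case_nat s \<omega>)
        = (mat_prod a n \<omega> - mat_prod b n \<omega>) ** a s + mat_prod b n \<omega> ** (a s - b s)"
      unfolding mat_prod_Suc_case_nat
      by (simp add: matrix_eq matrix_vector_mul_assoc[symmetric] matrix_vector_mult_add_rdistrib
          matrix_vector_mult_diff_rdistrib matrix_vector_mult_diff_distrib)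
    then have "opnorm (mat_prod a (Suc n) (case_nat s \<omega>) - mat_prod b (Suc n) (case_nat s \<omega>))
        \<le> opnorm ((mat_prod a n \<omega> - mat_prod b n \<omega>) ** a s) + opnorm (mat_prod b n \<omega> ** (a s - b s))"
      by (simp only: opnorm_triangle)
    also have "\<dots> \<le> ?x * opnorm (a s) + opnorm (mat_prod b n \<omega>) * ?y"
      by (intro add_mono opnorm_mult_le)
    also have "\<dots> \<le> ?x * ?w + ?W * ?y"
      using pos order_trans[OF opnorm_le_distortion distortion_le_wt(1), of s]
        order_trans[OF B.opnorm_A_le dist_prod_le_wt_prod(2), of n \<omega>]
      by (intro add_mono mult_left_mono mult_right_mono) auto
    finally have "?J (Suc n) (case_nat s \<omega>) \<le> ((?x * ?w + ?W * ?y) * (?W * ?w)) powr t"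
      unfolding W using pos t by (intro powr_mono2 mult_right_mono mult_nonneg_nonneg opnorm_nonneg) auto
    also have "(?x * ?w + ?W * ?y) * (?W * ?w) = (?x * ?W) * ?w\<^sup>2 + ?W\<^sup>2 * (?y * ?w)"
      by (simp add: power2_eq_square algebra_simps)
    also have "\<dots> powr t \<le> ((?x * ?W) * ?w\<^sup>2) powr t + (?W\<^sup>2 * (?y * ?w)) powr t"
      using pos t by (intro powr_add_le) auto
    also have "\<dots> = (?x * ?W) powr t * ?w powr (2 * t) + ?W powr (2 * t) * (?y * ?w) powr t"
    proof -
      have "?w\<^sup>2 powr t = ?w powr (2 * t)" "?W\<^sup>2 powr t = ?W powr (2 * t)"
        using wt_prod_ge_1[of n \<omega>] wt_ge_1[of s]
        by (simp_all add: powr_powr[symmetric])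
      moreover have "((?x * ?W) * ?w\<^sup>2) powr t = (?x * ?W) powr t * ?w\<^sup>2 powr t"
        by (rule powr_mult)
      moreover have "(?W\<^sup>2 * (?y * ?w)) powr t = ?W\<^sup>2 powr t * (?y * ?w) powr t"
        by (rule powr_mult)
      ultimately show ?thesis by simp
    qed
    finally show ?thesis .
  qed
  have "(\<integral>\<^sup>+\<omega>. ennreal (?J (Suc n) \<omega>) \<partial>S) = (\<integral>\<^sup>+s. \<integral>\<^sup>+\<omega>. ennreal (?J (Suc n) (case_nat s \<omega>)) \<partial>S \<partial>M)"
    by (rule nn_integral_case_nat) measurable
  also have "\<dots> \<le> (\<integral>\<^sup>+s. \<integral>\<^sup>+\<omega>. ennreal (?J n \<omega>) * ennreal (wt s powr (2 * t))
      + ennreal (wt_prod n \<omega> powr (2 * t)) * ennreal ((opnorm (a s - b s) * wt s) powr t) \<partial>S \<partial>M)"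
    by (intro nn_integral_mono order_trans[OF ennreal_leI[OF pw]])
      (simp add: ennreal_plus[symmetric] ennreal_mult'[symmetric] del: ennreal_plus)
  also have "\<dots> = (\<integral>\<^sup>+\<omega>. ennreal (?J n \<omega>) \<partial>S) * (\<integral>\<^sup>+s. ennreal (wt s powr (2 * t)) \<partial>M)
      + (\<integral>\<^sup>+\<omega>. ennreal (wt_prod n \<omega> powr (2 * t)) \<partial>S) * (\<integral>\<^sup>+s. ennreal ((opnorm (a s - b s) * wt s) powr t) \<partial>M)"
    by (simp add: nn_integral_add nn_integral_cmult nn_integral_multc)
  also have "\<dots> \<le> ennreal (real n * K ^ n * \<Delta>) * ennreal K + ennreal (K ^ n) * ennreal \<Delta>"
    using Suc by (intro add_mono mult_mono wt_moment wt_prod_moment diff_moment[folded \<Delta>_def])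
      (auto simp: \<Delta>_def)
  also have "\<dots> = ennreal (real n * K ^ n * \<Delta> * K + K ^ n * \<Delta>)"
    using \<Delta> A.K_ge_1 by (simp add: ennreal_plus[symmetric] ennreal_mult'[symmetric] del: ennreal_plus)
  also have "\<dots> \<le> ennreal (real (Suc n) * K ^ Suc n * \<Delta>)"
  proof (rule ennreal_leI)
    have "K ^ n * \<Delta> \<le> K ^ Suc n * \<Delta>" using A.K_ge_1 \<Delta> by (intro mult_right_mono power_increasing) auto
    then show "real n * K ^ n * \<Delta> * K + K ^ n * \<Delta> \<le> real (Suc n) * K ^ Suc n * \<Delta>" by (simp add: algebra_simps)
  qed
  finally show ?case by (simp only: \<Delta>_def)
qed

text \<open>
  Both parts of the angle rate change by at most a multiple of \<open>(|A n - B n| W)^t\<close>, where the weight \<open>W\<close>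
  bounds the inverses, and \<open>prod_diff_moment\<close> controls the expectation of this error.
\<close>
lemma mean_angle_rate_le:
  assumes x: "x \<noteq> 0"
  shows "(\<integral>\<omega>. B.angle_rate n x \<omega> \<partial>S) \<le> (\<integral>\<omega>. A.angle_rate n x \<omega> \<partial>S) + 4 / t * (real n * K ^ n * ((2 + K) * d powr t))"
proof -
  let ?J = "\<lambda>\<omega>. (opnorm (mat_prod a n \<omega> - mat_prod b n \<omega>) * wt_prod n \<omega>) powr t"
  have D: "norm x \<le> wt_prod n \<omega> * norm (mat_prod a n \<omega> *v x)" "norm x \<le> wt_prod n \<omega> * norm (mat_prod b n \<omega> *v x)"
    for \<omega> and x :: "real ^ 'm"
    using A.norm_le_A[of x n \<omega>] B.norm_le_A[of x n \<omega>] dist_prod_le_wt_prod[of n \<omega>]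
    by (meson mult_right_mono norm_ge_zero order_trans)+
  have W: "0 \<le> wt_prod n \<omega>" for \<omega> using wt_prod_ge_1[of n \<omega>] by simp
  have pw: "B.angle_rate n x \<omega> \<le> A.angle_rate n x \<omega> + 4 / t * ?J \<omega>" for \<omega>
  proof -
    have "\<bar>lgain (mat_prod a n \<omega>) x - lgain (mat_prod b n \<omega>) x\<bar> \<le> ?J \<omega> / t"
      using t by (intro abs_lgain_compare D W x) auto
    moreover have "ln (area_norm (mat_prod b n \<omega>)) \<le> ln (area_norm (mat_prod a n \<omega>))
        + 2 / t * (opnorm (mat_prod b n \<omega> - mat_prod a n \<omega>) * wt_prod n \<omega>) powr t"
      using t by (intro ln_area_norm_compare A.dim_ge_2 A.det_A B.det_A D W) auto
    ultimately show ?thesis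
      by (simp add: A.angle_rate_def B.angle_rate_def opnorm_minus_commute[of "mat_prod b n \<omega>"])
  qed
  have J_int: "integrable S ?J"
    using prod_diff_moment[of n] by (intro integrableI_bounded) (auto intro: le_less_trans)
  have J_le: "(\<integral>\<omega>. ?J \<omega> \<partial>S) \<le> real n * K ^ n * ((2 + K) * d powr t)"
    using prod_diff_moment[of n] A.K_ge_1 by (subst (asm) nn_integral_eq_integral[OF J_int]) (auto simp: ennreal_le_iff)
  have int: "integrable S (A.angle_rate n x)" "integrable S (B.angle_rate n x)"
  proof -
    have q8: "0 < q / 8" using A.q_pos by simp
    show "integrable S (A.angle_rate n x)"
      by (rule P.small_exponential_moment(1)[OF A.angle_rate_meas, of "q / 8" _ _ "K ^ n" 0])
        (use A.exp_angle_rate[OF x, of "2 * (q / 8)" n] A.K_ge_1 q8 in auto)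
    show "integrable S (B.angle_rate n x)"
      by (rule P.small_exponential_moment(1)[OF B.angle_rate_meas, of "q / 8" _ _ "K ^ n" 0])
        (use B.exp_angle_rate[OF x, of "2 * (q / 8)" n] A.K_ge_1 q8 in auto)
  qed
  have "(\<integral>\<omega>. B.angle_rate n x \<omega> \<partial>S) \<le> (\<integral>\<omega>. A.angle_rate n x \<omega> + 4 / t * ?J \<omega> \<partial>S)"
    using int J_int by (intro integral_mono pw) auto
  also have "\<dots> = (\<integral>\<omega>. A.angle_rate n x \<omega> \<partial>S) + 4 / t * (\<integral>\<omega>. ?J \<omega> \<partial>S)"
    using int J_int by simp
  also have "4 / t * (\<integral>\<omega>. ?J \<omega> \<partial>S) \<le> 4 / t * (real n * K ^ n * ((2 + K) * d powr t))"
    using t by (intro mult_left_mono J_le) auto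
  finally show ?thesis by simp
qed

end

lemma (in bounded_cocycle) integrable_lgain_A:
  assumes "x \<noteq> 0"
  shows "integrable S (\<lambda>\<omega>. lgain (A n \<omega>) x)"
proof (rule Bochner_Integration.integrable_bound)
  show "integrable S (\<lambda>\<omega>. \<Sum>i<n. logd (\<omega> i))"
    by (intro Bochner_Integration.integrable_sum integrable_coord top.\<psi>_int)
  show "AE \<omega> in S. norm (lgain (A n \<omega>) x) \<le> norm (\<Sum>i<n. logd (\<omega> i))"
  proof (rule AE_I2)
    fix \<omega>
    show "norm (lgain (A n \<omega>) x) \<le> norm (\<Sum>i<n. logd (\<omega> i))"
      using abs_lgain_A_le[OF assms, of n \<omega>] ln_ge_zero[OF dist_prod_ge_1[of n \<omega>]] by (simp add: sum_logd)
  qed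
qed measurable

text \<open>
  Since areas grow at a rate less than twice the top one, while every vector grows on average at
  a rate close to the top one, uniformly in its direction, angles shrink on average.
\<close>
lemma ex_mean_angle_rate_le:
  assumes "quasi_irreducible_cocycle M a q" "bounded_cocycle M a q K"
    and gap: "subadditive_process.rate M (\<lambda>n \<omega>. ln (area_norm (mat_prod a n \<omega>)))
      < 2 * subadditive_process.rate M (\<lambda>n \<omega>. ln (opnorm (mat_prod a n \<omega>)))"
  shows "\<exists>n\<ge>1. \<forall>x. x \<noteq> 0 \<longrightarrow> (\<integral>\<omega>. bounded_cocycle.angle_rate a n x \<omega> \<partial>Pi\<^sub>M UNIV (\<lambda>_. M)) \<le> - 1"
proof -
  interpret quasi_irreducible_cocycle M a q by fact
  interpret bounded_cocycle M a q K by fact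
  \<comment> \<open>Errors of \<open>\<gamma>\<close> in the growth of areas and of \<open>\<gamma>\<close> in that of lengths, which counts twice, leave a
    quarter of the gap.\<close>
  define \<gamma> where "\<gamma> = (2 * top.rate - area.rate) / 4"
  have \<gamma>: "0 < \<gamma>" using gap by (simp add: \<gamma>_def)
  obtain c where c: "\<And>m x. x \<noteq> 0 \<Longrightarrow>
      ((top.rate - \<gamma> / 2) - \<gamma> / 2) * real m - c \<le> (\<integral>\<omega>. ln (norm (A m \<omega> *v x) / norm x) \<partial>S)"
    using uniform_growth[of "top.rate - \<gamma> / 2" "\<gamma> / 2"] \<gamma> by auto
  have "\<forall>\<^sub>F n in sequentially. area.mean n / real n < area.rate + \<gamma>"
    using \<gamma> by (intro order_tendstoD(2)[OF area.mean_limit]) simp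
  moreover have "\<forall>\<^sub>F n in sequentially. (1::nat) \<le> n" by (rule eventually_ge_at_top)
  moreover have "\<forall>\<^sub>F n in sequentially. nat \<lceil>(2 * c + 1) / \<gamma>\<rceil> \<le> n" by (rule eventually_ge_at_top)
  ultimately have "\<forall>\<^sub>F n in sequentially. 1 \<le> n \<and> (\<forall>x. x \<noteq> 0 \<longrightarrow> (\<integral>\<omega>. angle_rate n x \<omega> \<partial>S) \<le> - 1)"
  proof eventually_elim
    case (elim n)
    have "(2 * c + 1) / \<gamma> \<le> real n" using elim(3) by linarith
    then have nc: "2 * c + 1 \<le> \<gamma> * real n" using \<gamma> by (simp add: field_simps)
    have mean: "area.mean n \<le> (area.rate + \<gamma>) * real n" using elim by (simp add: field_simps)
    have "(\<integral>\<omega>. angle_rate n x \<omega> \<partial>S) \<le> - 1" if x: "x \<noteq> 0" for x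
    proof -
      have "(\<integral>\<omega>. angle_rate n x \<omega> \<partial>S) = area.mean n - 2 * (\<integral>\<omega>. lgain (A n \<omega>) x \<partial>S)"
        unfolding angle_rate_def area.mean_def using area.h_int integrable_lgain_A[OF x] by simp
      also have "\<dots> \<le> (area.rate + \<gamma>) * real n - 2 * ((top.rate - \<gamma>) * real n - c)"
        using mean c[OF x, of n] by (simp add: lgain_def)
      also have "\<dots> = - \<gamma> * real n + 2 * c"
      proof -
        have "area.rate = 2 * top.rate - 4 * \<gamma>" by (simp add: \<gamma>_def field_simps)
        then show ?thesis by (simp only:) (simp add: algebra_simps)
      qed
      also have "\<dots> \<le> - 1" using nc by simp
      finally show ?thesis .
    qed
    then show ?case using elim by blast
  qed
  then show ?thesis using eventually_sequentially by auto
qed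

text \<open>
  The bounds on \<open>\<theta>\<close> make the second-order remainder at most half of the first-order gain \<open>\<theta> / 2\<close>.
\<close>
lemma (in bounded_cocycle) contraction_of_mean_angle_rate:
  assumes neg: "\<And>x. x \<noteq> 0 \<Longrightarrow> (\<integral>\<omega>. angle_rate n x \<omega> \<partial>S) \<le> - 1 / 2"
    and \<theta>: "0 < \<theta>" "\<theta> \<le> q / 8" "\<theta> * (2 * K ^ n / (q / 8)\<^sup>2) \<le> 1 / 4"
    and xy: "x \<noteq> 0" "y \<noteq> 0"
  shows "(\<integral>\<^sup>+\<omega>. ennreal (sdist (A n \<omega> *v x) (A n \<omega> *v y) powr \<theta>) \<partial>S)
    \<le> ennreal ((1 - \<theta> / 4) * sdist x y powr \<theta>)"
proof -
  have e: "(\<integral>\<^sup>+\<omega>. ennreal (exp (\<theta> * angle_rate n z \<omega>)) \<partial>S) \<le> ennreal (1 - \<theta> / 4)" if z: "z \<noteq> 0" for z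
  proof -
    have "(\<integral>\<^sup>+\<omega>. ennreal (exp (\<theta> * angle_rate n z \<omega>)) \<partial>S)
        \<le> ennreal (1 + \<theta> * (\<integral>\<omega>. angle_rate n z \<omega> \<partial>S) + \<theta>\<^sup>2 * (2 * K ^ n / (q / 8)\<^sup>2))"
      by (rule P.small_exponential_moment(2)[OF angle_rate_meas])
        (use exp_angle_rate[OF z, of "2 * (q / 8)" n] K_ge_1 q_pos \<theta> in auto)
    also have "\<dots> \<le> ennreal (1 - \<theta> / 4)"
    proof (rule ennreal_leI)
      have "\<theta> * (\<integral>\<omega>. angle_rate n z \<omega> \<partial>S) \<le> \<theta> * (- 1 / 2)" using neg[OF z] \<theta>(1) by (intro mult_left_mono) auto
      moreover have "\<theta> * (\<theta> * (2 * K ^ n / (q / 8)\<^sup>2)) \<le> \<theta> * (1 / 4)" using \<theta> by (intro mult_left_mono) auto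
      moreover have "\<theta>\<^sup>2 * (2 * K ^ n / (q / 8)\<^sup>2) = \<theta> * (\<theta> * (2 * K ^ n / (q / 8)\<^sup>2))"
        by (simp only: power2_eq_square mult.assoc)
      ultimately show "1 + \<theta> * (\<integral>\<omega>. angle_rate n z \<omega> \<partial>S) + \<theta>\<^sup>2 * (2 * K ^ n / (q / 8)\<^sup>2) \<le> 1 - \<theta> / 4"
        by linarith
    qed
    finally show ?thesis .
  qed
  define \<sigma> where "\<sigma> = sdist x y powr \<theta>"
  have "ennreal (1 - \<theta> / 4) \<noteq> 0"
  proof
    assume "ennreal (1 - \<theta> / 4) = 0"
    then have "(\<integral>\<^sup>+\<omega>. ennreal (exp (\<theta> * angle_rate n x \<omega>)) \<partial>S) = 0" using e[OF xy(1)] by simp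
    then have "AE \<omega> in S. False" by (subst (asm) nn_integral_0_iff_AE) auto
    then show False by simp
  qed
  then have \<rho>: "0 \<le> 1 - \<theta> / 4" by (simp add: ennreal_eq_0_iff)
  have "(\<integral>\<^sup>+\<omega>. ennreal (sdist (A n \<omega> *v x) (A n \<omega> *v y) powr \<theta>) \<partial>S)
      \<le> (\<integral>\<^sup>+\<omega>. (ennreal (exp (\<theta> * angle_rate n x \<omega>)) + ennreal (exp (\<theta> * angle_rate n y \<omega>))) * ennreal (\<sigma> / 2) \<partial>S)"
  proof (intro nn_integral_mono)
    fix \<omega>
    have "ennreal (sdist (A n \<omega> *v x) (A n \<omega> *v y) powr \<theta>)
        \<le> ennreal ((exp (\<theta> * angle_rate n x \<omega>) + exp (\<theta> * angle_rate n y \<omega>)) * (\<sigma> / 2))"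
      using sdist_A_le[OF xy, of \<theta> n \<omega>] \<theta>(1) by (intro ennreal_leI) (simp add: \<sigma>_def)
    also have "\<dots> = ennreal (exp (\<theta> * angle_rate n x \<omega>) + exp (\<theta> * angle_rate n y \<omega>)) * ennreal (\<sigma> / 2)"
      by (rule ennreal_mult') (simp add: add_nonneg_nonneg)
    also have "ennreal (exp (\<theta> * angle_rate n x \<omega>) + exp (\<theta> * angle_rate n y \<omega>))
        = ennreal (exp (\<theta> * angle_rate n x \<omega>)) + ennreal (exp (\<theta> * angle_rate n y \<omega>))" by (rule ennreal_plus) auto
    finally show "ennreal (sdist (A n \<omega> *v x) (A n \<omega> *v y) powr \<theta>)
        \<le> (ennreal (exp (\<theta> * angle_rate n x \<omega>)) + ennreal (exp (\<theta> * angle_rate n y \<omega>))) * ennreal (\<sigma> / 2)" .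
  qed
  also have "\<dots> = ((\<integral>\<^sup>+\<omega>. ennreal (exp (\<theta> * angle_rate n x \<omega>)) \<partial>S)
      + (\<integral>\<^sup>+\<omega>. ennreal (exp (\<theta> * angle_rate n y \<omega>)) \<partial>S)) * ennreal (\<sigma> / 2)"
    by (simp add: nn_integral_multc nn_integral_add)
  also have "\<dots> \<le> (ennreal (1 - \<theta> / 4) + ennreal (1 - \<theta> / 4)) * ennreal (\<sigma> / 2)"
    by (intro mult_right_mono add_mono e xy) simp
  also have "\<dots> = ennreal (2 * (1 - \<theta> / 4)) * ennreal (\<sigma> / 2)"
    using \<rho> by (simp add: ennreal_plus[symmetric] del: ennreal_plus)
  also have "\<dots> = ennreal (2 * (1 - \<theta> / 4) * (\<sigma> / 2))" using \<rho> by (intro ennreal_mult'[symmetric]) simp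
  also have "2 * (1 - \<theta> / 4) * (\<sigma> / 2) = (1 - \<theta> / 4) * \<sigma>" by (simp add: field_simps)
  finally show ?thesis by (simp only: \<sigma>_def)
qed

section \<open>Regularity of the expected growth\<close>

locale contracting_cocycle = bounded_cocycle M a q K
  for M :: "'s measure" and a :: "'s \<Rightarrow> real ^ 'm ^ 'm" and q K +
  fixes N :: nat and \<theta> \<rho> :: real
  assumes N_pos: "1 \<le> N" and \<theta>_pos: "0 < \<theta>" and \<theta>_le: "4 * \<theta> \<le> q" "2 * \<theta> \<le> 1"
    and \<rho>: "0 \<le> \<rho>" "\<rho> < 1"
    and contraction: "\<And>x y. x \<noteq> 0 \<Longrightarrow> y \<noteq> 0 \<Longrightarrow>
      (\<integral>\<^sup>+\<omega>. ennreal (sdist (A N \<omega> *v x) (A N \<omega> *v y) powr \<theta>) \<partial>S) \<le> ennreal (\<rho> * sdist x y powr \<theta>)"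
begin

lemma sdist_A_meas [measurable]: "(\<lambda>\<omega>. sdist (A n \<omega> *v x) (A n \<omega> *v y)) \<in> borel_measurable S"
  unfolding sdist_def area_def by measurable

lemma sdist_moment_le:
  assumes "x \<noteq> 0" "y \<noteq> 0"
  shows "(\<integral>\<^sup>+\<omega>. ennreal (sdist (A n \<omega> *v x) (A n \<omega> *v y) powr \<theta>) \<partial>S) \<le> ennreal (K ^ n * sdist x y powr \<theta>)"
proof -
  have pw: "sdist (A n \<omega> *v x) (A n \<omega> *v y) powr \<theta> \<le> dist_prod n \<omega> powr (4 * \<theta>) * sdist x y powr \<theta>" for \<omega>
  proof -
    have e: "exp (\<theta> * angle_rate n z \<omega>) \<le> dist_prod n \<omega> powr (4 * \<theta>)" if "z \<noteq> 0" for z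
    proof -
      have "\<theta> * angle_rate n z \<omega> \<le> \<theta> * (4 * ln (dist_prod n \<omega>))"
        using abs_angle_rate_le[OF that, of n \<omega>] \<theta>_pos by (intro mult_left_mono) auto
      then show ?thesis using dist_prod_ge_1[of n \<omega>] by (simp add: powr_def mult_ac)
    qed
    have "sdist (A n \<omega> *v x) (A n \<omega> *v y) powr \<theta>
        \<le> (exp (\<theta> * angle_rate n x \<omega>) + exp (\<theta> * angle_rate n y \<omega>)) / 2 * sdist x y powr \<theta>"
      using \<theta>_pos by (intro sdist_A_le assms) auto
    also have "\<dots> \<le> dist_prod n \<omega> powr (4 * \<theta>) * sdist x y powr \<theta>"
      using e[OF assms(1)] e[OF assms(2)] by (intro mult_right_mono) auto
    finally show ?thesis .
  qed
  have "(\<integral>\<^sup>+\<omega>. ennreal (sdist (A n \<omega> *v x) (A n \<omega> *v y) powr \<theta>) \<partial>S)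
      \<le> (\<integral>\<^sup>+\<omega>. ennreal (dist_prod n \<omega> powr (4 * \<theta>)) * ennreal (sdist x y powr \<theta>) \<partial>S)"
    by (intro nn_integral_mono) (simp add: ennreal_mult'[symmetric] ennreal_leI pw)
  also have "\<dots> = (\<integral>\<^sup>+\<omega>. ennreal (dist_prod n \<omega> powr (4 * \<theta>)) \<partial>S) * ennreal (sdist x y powr \<theta>)"
    by (rule nn_integral_multc) measurable
  also have "\<dots> \<le> ennreal (K ^ n) * ennreal (sdist x y powr \<theta>)"
    by (intro mult_right_mono dist_prod_moment \<theta>_le) simp
  finally show ?thesis using K_ge_1 by (simp add: ennreal_mult'[symmetric])
qed

definition angle_sum :: "nat \<Rightarrow> real ^ 'm \<Rightarrow> real ^ 'm \<Rightarrow> ennreal" where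
  "angle_sum j x y = (\<integral>\<^sup>+\<omega>. (\<Sum>i<j. ennreal (sdist (A i \<omega> *v x) (A i \<omega> *v y) powr \<theta>)) \<partial>S)"

text \<open>
  The geometric series over blocks of \<open>N\<close> steps; within a block, each step is bounded by \<open>K ^ N\<close>.
\<close>
definition angle_const :: real where
  "angle_const = real N * K ^ N / (1 - \<rho>)"

lemma angle_const_nonneg: "0 \<le> angle_const"
  using \<rho> K_ge_1 by (simp add: angle_const_def)

text \<open>Induction over blocks: after the first block the pair of directions has contracted.\<close>
lemma angle_sum_le:
  assumes "x \<noteq> 0" "y \<noteq> 0"
  shows "angle_sum j x y \<le> ennreal (angle_const * sdist x y powr \<theta>)"
  using assms
proof (induction j arbitrary: x y rule: less_induct)
  case (less j)
  define \<sigma> where "\<sigma> = sdist x y powr \<theta>"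
  have \<sigma>: "0 \<le> \<sigma>" by (simp add: \<sigma>_def)
  have short: "(\<integral>\<^sup>+\<omega>. (\<Sum>i<k. ennreal (sdist (A i \<omega> *v x) (A i \<omega> *v y) powr \<theta>)) \<partial>S) \<le> ennreal (real N * K ^ N * \<sigma>)"
    if "k \<le> N" for k
  proof -
    have "(\<integral>\<^sup>+\<omega>. (\<Sum>i<k. ennreal (sdist (A i \<omega> *v x) (A i \<omega> *v y) powr \<theta>)) \<partial>S)
        = (\<Sum>i<k. \<integral>\<^sup>+\<omega>. ennreal (sdist (A i \<omega> *v x) (A i \<omega> *v y) powr \<theta>) \<partial>S)"
      by (rule nn_integral_sum) measurable
    also have "\<dots> \<le> (\<Sum>i<k. ennreal (K ^ N * \<sigma>))"
    proof (rule sum_mono)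
      fix i assume "i \<in> {..<k}"
      then have "K ^ i \<le> K ^ N" using that K_ge_1 by (intro power_increasing) auto
      then have "ennreal (K ^ i * \<sigma>) \<le> ennreal (K ^ N * \<sigma>)" using \<sigma> by (intro ennreal_leI mult_right_mono)
      then show "(\<integral>\<^sup>+\<omega>. ennreal (sdist (A i \<omega> *v x) (A i \<omega> *v y) powr \<theta>) \<partial>S) \<le> ennreal (K ^ N * \<sigma>)"
        using sdist_moment_le[OF less.prems, of i] by (simp add: \<sigma>_def)
    qed
    also have "\<dots> = ennreal (real k * (K ^ N * \<sigma>))"
      using \<sigma> K_ge_1 by (simp add: ennreal_of_nat_eq_real_of_nat ennreal_mult'[symmetric])
    also have "\<dots> \<le> ennreal (real N * (K ^ N * \<sigma>))"
      using that \<sigma> K_ge_1 by (intro ennreal_leI mult_right_mono) auto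
    finally show ?thesis by (simp add: mult.assoc)
  qed
  have c: "real N * K ^ N + angle_const * \<rho> = angle_const"
    using \<rho> by (simp add: angle_const_def field_simps)
  show ?case
  proof (cases "j \<le> N")
    case True
    have "real N * K ^ N \<le> angle_const" using c angle_const_nonneg \<rho> by (metis add_increasing2 mult_nonneg_nonneg order_refl)
    then have "ennreal (real N * K ^ N * \<sigma>) \<le> ennreal (angle_const * \<sigma>)" using \<sigma> by (intro ennreal_leI mult_right_mono)
    then show ?thesis using short[OF True] by (simp add: angle_sum_def \<sigma>_def)
  next
    case False
    define k where "k = j - N"
    have j: "j = N + k" "k < j" using False N_pos by (auto simp: k_def)
    let ?f = "\<lambda>i \<omega>. ennreal (sdist (A i \<omega> *v x) (A i \<omega> *v y) powr \<theta>)"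
    have split: "(\<Sum>i<j. ?f i \<omega>) = (\<Sum>i<N. ?f i \<omega>) + (\<Sum>i<k. ?f (N + i) \<omega>)" for \<omega>
      unfolding j(1) by (induction k) (simp_all add: add.assoc)
    have shift: "?f (N + i) (comb_seq N \<omega> \<omega>')
        = ennreal (sdist (A i \<omega>' *v (A N \<omega> *v x)) (A i \<omega>' *v (A N \<omega> *v y)) powr \<theta>)" for i \<omega> \<omega>'
      by (simp add: mat_prod_add matrix_vector_mul_assoc)
    have "angle_sum j x y = (\<integral>\<^sup>+\<omega>. (\<Sum>i<N. ?f i \<omega>) \<partial>S) + (\<integral>\<^sup>+\<omega>. (\<Sum>i<k. ?f (N + i) \<omega>) \<partial>S)"
      unfolding angle_sum_def split by (rule nn_integral_add) measurable
    also have "(\<integral>\<^sup>+\<omega>. (\<Sum>i<k. ?f (N + i) \<omega>) \<partial>S)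
        = (\<integral>\<^sup>+\<omega>. \<integral>\<^sup>+\<omega>'. (\<Sum>i<k. ?f (N + i) (comb_seq N \<omega> \<omega>')) \<partial>S \<partial>S)"
      by (rule nn_integral_comb_seq) measurable
    also have "\<dots> = (\<integral>\<^sup>+\<omega>. angle_sum k (A N \<omega> *v x) (A N \<omega> *v y) \<partial>S)"
      unfolding shift angle_sum_def ..
    also have "\<dots> \<le> (\<integral>\<^sup>+\<omega>. ennreal (angle_const * sdist (A N \<omega> *v x) (A N \<omega> *v y) powr \<theta>) \<partial>S)"
      using less.prems by (intro nn_integral_mono less.IH j(2)) auto
    also have "\<dots> = ennreal angle_const * (\<integral>\<^sup>+\<omega>. ennreal (sdist (A N \<omega> *v x) (A N \<omega> *v y) powr \<theta>) \<partial>S)"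
      using angle_const_nonneg by (simp add: ennreal_mult' nn_integral_cmult)
    also have "\<dots> \<le> ennreal angle_const * ennreal (\<rho> * \<sigma>)"
      unfolding \<sigma>_def by (intro mult_left_mono contraction less.prems) simp
    also have "(\<integral>\<^sup>+\<omega>. (\<Sum>i<N. ?f i \<omega>) \<partial>S) + ennreal angle_const * ennreal (\<rho> * \<sigma>)
        \<le> ennreal (real N * K ^ N * \<sigma>) + ennreal (angle_const * (\<rho> * \<sigma>))"
      using short[OF order_refl] angle_const_nonneg by (intro add_mono) (auto simp: ennreal_mult')
    also have "\<dots> = ennreal ((real N * K ^ N + angle_const * \<rho>) * \<sigma>)"
      using \<sigma> \<rho> angle_const_nonneg K_ge_1 by (simp add: ennreal_plus[symmetric] algebra_simps del: ennreal_plus)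
    finally show ?thesis by (simp add: c \<sigma>_def add_left_mono)
  qed
qed

end

context contracting_cocycle
begin

lemma lgain_A_Suc_case_nat:
  assumes "x \<noteq> 0"
  shows "lgain (A (Suc n) (case_nat s \<omega>)) x = lgain (a s) x + lgain (A n \<omega>) (a s *v x)"
  unfolding mat_prod_Suc_case_nat by (rule lgain_mult[OF det_A det_a assms])

lemma a_mult_neq_0: "x \<noteq> 0 \<Longrightarrow> a s *v x \<noteq> 0"
  by (simp add: mult_eq_0_iff_det_1 det_a)

definition gain_const :: real where
  "gain_const = 2 / \<theta> * K * angle_const"

lemma gain_const_nonneg: "0 \<le> gain_const"
  using \<theta>_pos K_ge_1 angle_const_nonneg by (simp add: gain_const_def)

text \<open>
  The expansions of two directions differ at each step by at most a power of the angle between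
  the current directions, and these powers are summable on average.
\<close>
lemma lgain_diff_angle_sum:
  assumes "x \<noteq> 0" "y \<noteq> 0"
  shows "(\<integral>\<^sup>+\<omega>. ennreal \<bar>lgain (A j \<omega>) x - lgain (A j \<omega>) y\<bar> \<partial>S) \<le> ennreal (2 / \<theta> * K) * angle_sum j x y"
  using assms
proof (induction j arbitrary: x y)
  case 0
  have "lgain (mat 1) z = 0" for z :: "real ^ 'm" by (simp add: lgain_def)
  then show ?case by simp
next
  case (Suc j)
  let ?C = "ennreal (2 / \<theta> * K)"
  let ?f = "\<lambda>i \<omega>. ennreal (sdist (A i \<omega> *v x) (A i \<omega> *v y) powr \<theta>)"
  define \<sigma> where "\<sigma> = sdist x y powr \<theta>"
  have C: "0 \<le> 2 / \<theta> * K" using \<theta>_pos K_ge_1 by simp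
  have as_meas: "(\<lambda>s. angle_sum j (a s *v x) (a s *v y)) \<in> borel_measurable M"
    unfolding angle_sum_def sdist_def area_def by measurable
  have "angle_sum (Suc j) x y
      = (\<integral>\<^sup>+s. \<integral>\<^sup>+\<omega>. (\<Sum>i<Suc j. ?f i (case_nat s \<omega>)) \<partial>S \<partial>M)"
    unfolding angle_sum_def by (rule nn_integral_case_nat) measurable
  also have "\<dots> = (\<integral>\<^sup>+s. \<integral>\<^sup>+\<omega>. ennreal \<sigma> + (\<Sum>i<j. ennreal (sdist (A i \<omega> *v (a s *v x)) (A i \<omega> *v (a s *v y)) powr \<theta>)) \<partial>S \<partial>M)"
    unfolding sum.lessThan_Suc_shift mat_prod_Suc_case_nat by (simp add: \<sigma>_def matrix_vector_mul_assoc)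
  also have "\<dots> = (\<integral>\<^sup>+s. ennreal \<sigma> + angle_sum j (a s *v x) (a s *v y) \<partial>M)"
  proof (rule nn_integral_cong)
    fix s
    have "(\<integral>\<^sup>+\<omega>. ennreal \<sigma> + (\<Sum>i<j. ennreal (sdist (A i \<omega> *v (a s *v x)) (A i \<omega> *v (a s *v y)) powr \<theta>)) \<partial>S)
        = (\<integral>\<^sup>+\<omega>. ennreal \<sigma> \<partial>S) + angle_sum j (a s *v x) (a s *v y)"
      unfolding angle_sum_def by (rule nn_integral_add) measurable
    then show "(\<integral>\<^sup>+\<omega>. ennreal \<sigma> + (\<Sum>i<j. ennreal (sdist (A i \<omega> *v (a s *v x)) (A i \<omega> *v (a s *v y)) powr \<theta>)) \<partial>S)
        = ennreal \<sigma> + angle_sum j (a s *v x) (a s *v y)"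
      by (simp add: P.emeasure_space_1[simplified])
  qed
  also have "\<dots> = ennreal \<sigma> + (\<integral>\<^sup>+s. angle_sum j (a s *v x) (a s *v y) \<partial>M)"
    using as_meas by (subst nn_integral_add) (auto simp: M.emeasure_space_1)
  finally have rec: "angle_sum (Suc j) x y = ennreal \<sigma> + (\<integral>\<^sup>+s. angle_sum j (a s *v x) (a s *v y) \<partial>M)" .
  have one: "(\<integral>\<^sup>+s. ennreal \<bar>lgain (a s) x - lgain (a s) y\<bar> \<partial>M) \<le> ?C * ennreal \<sigma>"
  proof -
    have "(\<integral>\<^sup>+s. ennreal \<bar>lgain (a s) x - lgain (a s) y\<bar> \<partial>M)
        \<le> (\<integral>\<^sup>+s. ennreal (distortion (a s) powr (2 * \<theta>)) * ennreal (2 / \<theta> * \<sigma>) \<partial>M)"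
    proof (intro nn_integral_mono)
      fix s
      have "\<bar>lgain (a s) x - lgain (a s) y\<bar> \<le> 2 / \<theta> * (distortion (a s) powr (2 * \<theta>) * sdist x y powr \<theta>)"
        using \<theta>_pos \<theta>_le by (intro abs_lgain_diff_le det_a Suc.prems) auto
      then have "\<bar>lgain (a s) x - lgain (a s) y\<bar> \<le> distortion (a s) powr (2 * \<theta>) * (2 / \<theta> * \<sigma>)"
        by (simp add: \<sigma>_def mult_ac)
      then show "ennreal \<bar>lgain (a s) x - lgain (a s) y\<bar> \<le> ennreal (distortion (a s) powr (2 * \<theta>)) * ennreal (2 / \<theta> * \<sigma>)"
        by (metis ennreal_leI ennreal_mult' powr_ge_zero)
    qed
    also have "\<dots> = (\<integral>\<^sup>+s. ennreal (distortion (a s) powr (2 * \<theta>)) \<partial>M) * ennreal (2 / \<theta> * \<sigma>)"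
      by (rule nn_integral_multc) measurable
    also have "\<dots> \<le> ennreal K * ennreal (2 / \<theta> * \<sigma>)"
      using \<theta>_le \<theta>_pos by (intro mult_right_mono distortion_moment) auto
    also have "\<dots> = ennreal (K * (2 / \<theta> * \<sigma>))" using K_ge_1 by (intro ennreal_mult'[symmetric]) auto
    also have "K * (2 / \<theta> * \<sigma>) = (2 / \<theta> * K) * \<sigma>" by simp
    also have "ennreal ((2 / \<theta> * K) * \<sigma>) = ?C * ennreal \<sigma>" using C by (rule ennreal_mult')
    finally show ?thesis .
  qed
  have lg_meas [measurable]: "(\<lambda>s. lgain (a s) z) \<in> borel_measurable M" for z unfolding lgain_def by measurable
  have lgA_meas: "(\<lambda>s. \<integral>\<^sup>+\<omega>. ennreal \<bar>lgain (A j \<omega>) (a s *v x) - lgain (A j \<omega>) (a s *v y)\<bar> \<partial>S) \<in> borel_measurable M"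
    unfolding lgain_def by measurable
  have "(\<integral>\<^sup>+\<omega>. ennreal \<bar>lgain (A (Suc j) \<omega>) x - lgain (A (Suc j) \<omega>) y\<bar> \<partial>S)
      = (\<integral>\<^sup>+s. \<integral>\<^sup>+\<omega>. ennreal \<bar>lgain (A (Suc j) (case_nat s \<omega>)) x - lgain (A (Suc j) (case_nat s \<omega>)) y\<bar> \<partial>S \<partial>M)"
    by (rule nn_integral_case_nat) (simp del: mat_prod.simps)
  also have "\<dots> \<le> (\<integral>\<^sup>+s. \<integral>\<^sup>+\<omega>. ennreal \<bar>lgain (a s) x - lgain (a s) y\<bar>
      + ennreal \<bar>lgain (A j \<omega>) (a s *v x) - lgain (A j \<omega>) (a s *v y)\<bar> \<partial>S \<partial>M)"
    unfolding lgain_A_Suc_case_nat[OF Suc.prems(1)] lgain_A_Suc_case_nat[OF Suc.prems(2)]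
    by (intro nn_integral_mono) (simp add: ennreal_plus[symmetric] ennreal_leI del: ennreal_plus)
  also have "\<dots> = (\<integral>\<^sup>+s. ennreal \<bar>lgain (a s) x - lgain (a s) y\<bar>
      + (\<integral>\<^sup>+\<omega>. ennreal \<bar>lgain (A j \<omega>) (a s *v x) - lgain (A j \<omega>) (a s *v y)\<bar> \<partial>S) \<partial>M)"
    by (intro nn_integral_cong, subst nn_integral_add) (simp_all add: P.emeasure_space_1[simplified])
  also have "\<dots> = (\<integral>\<^sup>+s. ennreal \<bar>lgain (a s) x - lgain (a s) y\<bar> \<partial>M)
      + (\<integral>\<^sup>+s. \<integral>\<^sup>+\<omega>. ennreal \<bar>lgain (A j \<omega>) (a s *v x) - lgain (A j \<omega>) (a s *v y)\<bar> \<partial>S \<partial>M)"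
    using lgA_meas by (intro nn_integral_add) auto
  also have "\<dots> \<le> ?C * ennreal \<sigma> + (\<integral>\<^sup>+s. ?C * angle_sum j (a s *v x) (a s *v y) \<partial>M)"
    by (intro add_mono one nn_integral_mono Suc.IH a_mult_neq_0 Suc.prems)
  also have "\<dots> = ?C * angle_sum (Suc j) x y"
    unfolding rec using as_meas by (simp add: nn_integral_cmult distrib_left)
  finally show ?case .
qed

lemma lgain_diff_le:
  assumes "x \<noteq> 0" "y \<noteq> 0"
  shows "(\<integral>\<^sup>+\<omega>. ennreal \<bar>lgain (A j \<omega>) x - lgain (A j \<omega>) y\<bar> \<partial>S) \<le> ennreal (gain_const * sdist x y powr \<theta>)"
proof -
  have "(\<integral>\<^sup>+\<omega>. ennreal \<bar>lgain (A j \<omega>) x - lgain (A j \<omega>) y\<bar> \<partial>S) \<le> ennreal (2 / \<theta> * K) * angle_sum j x y"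
    by (rule lgain_diff_angle_sum[OF assms])
  also have "\<dots> \<le> ennreal (2 / \<theta> * K) * ennreal (angle_const * sdist x y powr \<theta>)"
    by (intro mult_left_mono angle_sum_le assms) simp
  also have "\<dots> = ennreal (2 / \<theta> * K * (angle_const * sdist x y powr \<theta>))"
    using \<theta>_pos K_ge_1 by (intro ennreal_mult'[symmetric]) auto
  finally show ?thesis by (simp add: gain_const_def mult.assoc)
qed

definition gain :: "nat \<Rightarrow> real ^ 'm \<Rightarrow> real" where
  "gain j x = (\<integral>\<omega>. lgain (A j \<omega>) x \<partial>S)"

lemma lgain_diff_int:
  assumes "x \<noteq> 0" "y \<noteq> 0"
  shows "(\<integral>\<omega>. \<bar>lgain (A j \<omega>) x - lgain (A j \<omega>) y\<bar> \<partial>S) \<le> gain_const * sdist x y powr \<theta>"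
proof -
  have "integrable S (\<lambda>\<omega>. \<bar>lgain (A j \<omega>) x - lgain (A j \<omega>) y\<bar>)"
    using integrable_lgain_A assms by simp
  from nn_integral_eq_integral[OF this] show ?thesis
    using lgain_diff_le[OF assms, of j] gain_const_nonneg by (simp add: ennreal_le_iff)
qed

lemma gain_diff_le:
  assumes "x \<noteq> 0" "y \<noteq> 0"
  shows "\<bar>gain j x - gain j y\<bar> \<le> gain_const * sdist x y powr \<theta>"
proof -
  have "gain j x - gain j y = (\<integral>\<omega>. lgain (A j \<omega>) x - lgain (A j \<omega>) y \<partial>S)"
    unfolding gain_def using integrable_lgain_A assms by simp
  then have "\<bar>gain j x - gain j y\<bar> \<le> (\<integral>\<omega>. \<bar>lgain (A j \<omega>) x - lgain (A j \<omega>) y\<bar> \<partial>S)"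
    by (simp add: integral_abs_bound)
  then show ?thesis using lgain_diff_int[OF assms, of j] by linarith
qed

text \<open>
  All directions have the same expected growth up to a constant, hence so has the norm, which is
  at most the sum of the lengths of the columns.
\<close>
lemma gain_limit:
  assumes "x \<noteq> 0"
  shows "(\<lambda>n. gain n x / real n) \<longlonglongrightarrow> top.rate"
proof -
  define e where "e i = (axis i 1 :: real ^ 'm)" for i
  have e: "e i \<noteq> 0" "norm (e i) = 1" for i by (auto simp: e_def axis_eq_0_iff)
  define c where "c = ln (real CARD('m)) + real CARD('m) * gain_const"
  have upper: "gain n x \<le> top.mean n" for n
  proof -
    have "lgain (A n \<omega>) x \<le> ln (opnorm (A n \<omega>))" for \<omega>
      unfolding lgain_def using norm_mult_le_opnorm[of "A n \<omega>" x] assms opnorm_A_pos[of n \<omega>]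
      by (subst ln_le_cancel_iff) (auto simp: field_simps)
    then show ?thesis unfolding gain_def top.mean_def
      by (intro integral_mono integrable_lgain_A assms top.h_int)
  qed
  have lower: "top.mean n \<le> gain n x + c" for n
  proof -
    have pw: "ln (opnorm (A n \<omega>)) \<le> ln (real CARD('m)) + (lgain (A n \<omega>) x
        + (\<Sum>i\<in>UNIV. \<bar>lgain (A n \<omega>) (e i) - lgain (A n \<omega>) x\<bar>))" for \<omega>
    proof -
      define s where "s = lgain (A n \<omega>) x + (\<Sum>i\<in>UNIV. \<bar>lgain (A n \<omega>) (e i) - lgain (A n \<omega>) x\<bar>)"
      have col: "norm (A n \<omega> *v e i) \<le> exp s" for i
      proof -
        have "\<bar>lgain (A n \<omega>) (e i) - lgain (A n \<omega>) x\<bar> \<le> (\<Sum>i\<in>UNIV. \<bar>lgain (A n \<omega>) (e i) - lgain (A n \<omega>) x\<bar>)"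
          by (rule member_le_sum) auto
        then have "ln (norm (A n \<omega> *v e i)) \<le> s" using e(2)[of i] by (simp add: lgain_def s_def)
        then have "exp (ln (norm (A n \<omega> *v e i))) \<le> exp s" by simp
          then show ?thesis using e(1)[of i] by simp
      qed
      have "opnorm (A n \<omega>) \<le> real CARD('m) * exp s"
      proof (rule opnorm_leI)
        fix z :: "real ^ 'm"
        have "z = (\<Sum>i\<in>UNIV. (z $ i) *\<^sub>R e i)"
          using basis_expansion[of z] by (simp add: e_def scalar_mult_eq_scaleR)
        then have "A n \<omega> *v z = (\<Sum>i\<in>UNIV. (z $ i) *\<^sub>R (A n \<omega> *v e i))"
          using linear_sum[OF matrix_vector_mul_linear, of "A n \<omega>" "\<lambda>i. (z $ i) *\<^sub>R e i" UNIV]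
          by (simp add: matrix_vector_mult_scaleR)
        then have "norm (A n \<omega> *v z) \<le> (\<Sum>i\<in>UNIV. norm ((z $ i) *\<^sub>R (A n \<omega> *v e i)))"
          by (simp only: norm_sum)
        also have "\<dots> \<le> (\<Sum>i\<in>(UNIV :: 'm set). norm z * exp s)"
          using col component_le_norm_cart[of z] by (intro sum_mono) (auto intro!: mult_mono)
        finally show "norm (A n \<omega> *v z) \<le> real CARD('m) * exp s * norm z" by (simp add: mult_ac)
      qed
      then have "ln (opnorm (A n \<omega>)) \<le> ln (real CARD('m) * exp s)"
        using opnorm_A_pos[of n \<omega>] by (subst ln_le_cancel_iff) auto
      also have "\<dots> = ln (real CARD('m)) + s" by (simp add: ln_mult)
      finally show ?thesis by (simp add: s_def)
    qed
    have int: "integrable S (\<lambda>\<omega>. \<bar>lgain (A n \<omega>) (e i) - lgain (A n \<omega>) x\<bar>)" for i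
      using integrable_lgain_A assms e(1) by simp
    have "top.mean n \<le> (\<integral>\<omega>. ln (real CARD('m)) + (lgain (A n \<omega>) x
        + (\<Sum>i\<in>UNIV. \<bar>lgain (A n \<omega>) (e i) - lgain (A n \<omega>) x\<bar>)) \<partial>S)"
      unfolding top.mean_def using int integrable_lgain_A[OF assms] by (intro integral_mono pw top.h_int) auto
    also have "\<dots> = ln (real CARD('m)) + (gain n x + (\<Sum>i\<in>UNIV. \<integral>\<omega>. \<bar>lgain (A n \<omega>) (e i) - lgain (A n \<omega>) x\<bar> \<partial>S))"
      using int integrable_lgain_A[OF assms] by (simp add: gain_def P.prob_space[simplified])
    also have "(\<Sum>i\<in>UNIV. \<integral>\<omega>. \<bar>lgain (A n \<omega>) (e i) - lgain (A n \<omega>) x\<bar> \<partial>S) \<le> (\<Sum>i\<in>(UNIV :: 'm set). gain_const)"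
    proof (rule sum_mono)
      fix i
      have "sdist (e i) x powr \<theta> \<le> 1 powr \<theta>" using \<theta>_pos by (intro powr_mono2 sdist_nonneg sdist_le_1) auto
      then have "gain_const * sdist (e i) x powr \<theta> \<le> gain_const * 1" using gain_const_nonneg by (intro mult_left_mono) auto
      then show "(\<integral>\<omega>. \<bar>lgain (A n \<omega>) (e i) - lgain (A n \<omega>) x\<bar> \<partial>S) \<le> gain_const"
        using lgain_diff_int[OF e(1) assms, of n i] by linarith
    qed
    finally show ?thesis by (simp add: c_def)
  qed
  have "(\<lambda>n. c / real n) \<longlonglongrightarrow> 0" by (rule lim_const_over_n)
  then have "(\<lambda>n. top.mean n / real n - c / real n) \<longlonglongrightarrow> top.rate - 0"
    by (intro tendsto_diff top.mean_limit)
  then have low: "(\<lambda>n. top.mean n / real n - c / real n) \<longlonglongrightarrow> top.rate" by simp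
  show ?thesis
  proof (rule tendsto_sandwich[OF _ _ low top.mean_limit])
    show "\<forall>\<^sub>F n in sequentially. top.mean n / real n - c / real n \<le> gain n x / real n"
    proof (rule always_eventually, rule allI)
      fix n
      have "(top.mean n - c) / real n \<le> gain n x / real n"
        using lower[of n] by (intro divide_right_mono) auto
      then show "top.mean n / real n - c / real n \<le> gain n x / real n" by (simp add: diff_divide_distrib)
    qed
    show "\<forall>\<^sub>F n in sequentially. gain n x / real n \<le> top.mean n / real n"
      using upper by (intro always_eventually allI divide_right_mono) auto
  qed
qed

text \<open>
  Replacing the letters of one cocycle by those of another one at a time, each replacement costs
  the distance of the two matrices directly, and through the change of direction that it causes;
  the effect of the latter on all later steps is bounded since the expected growth is a Hoelder
  function of the direction, uniformly in the number of steps.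
\<close>
lemma gain_compare:
  assumes "contracting_cocycle M b q K N \<theta> \<rho>"
    and d: "0 < d" "(\<integral>\<^sup>+s. ennreal (opnorm (a s - b s)) \<partial>M) \<le> ennreal d"
    and x: "x \<noteq> 0"
  shows "\<bar>gain n x - contracting_cocycle.gain M b n x\<bar>
    \<le> real n * ((1 / \<theta> + gain_const) * ((2 + K) * d powr \<theta>))"
  using x
proof (induction n arbitrary: x)
  interpret B: contracting_cocycle M b q K N \<theta> \<rho> by fact
  case 0
  then show ?case by (simp add: gain_def B.gain_def lgain_def)
next
  interpret B: contracting_cocycle M b q K N \<theta> \<rho> by fact
  interpret cocycle_pair M a b q K \<theta> d
    by unfold_locales (use \<theta>_pos \<theta>_le d in auto)
  case (Suc n)
  define E where "E = (1 / \<theta> + gain_const) * ((2 + K) * d powr \<theta>)"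
  let ?y = "\<lambda>s. (opnorm (a s - b s) * wt s) powr \<theta>"
  have y_int: "integrable M ?y"
    using diff_moment by (intro integrableI_bounded) (auto intro: le_less_trans)
  have y_le: "(\<integral>s. ?y s \<partial>M) \<le> (2 + K) * d powr \<theta>"
    using diff_moment K_ge_1 by (subst (asm) nn_integral_eq_integral[OF y_int]) (auto simp: ennreal_le_iff)
  have D: "norm z \<le> wt s * norm (a s *v z)" "norm z \<le> wt s * norm (b s *v z)" for s and z :: "real ^ 'm"
    using norm_le_distortion_mult[OF det_a, of z s] norm_le_distortion_mult[OF B.det_a, of z s] distortion_le_wt[of s]
    by (meson mult_right_mono norm_ge_zero order_trans)+
  have w0: "0 \<le> wt s" for s using wt_ge_1[of s] by simp
  have intA: "integrable S (\<lambda>\<omega>. lgain (A (Suc n) \<omega>) x)" by (rule integrable_lgain_A[OF Suc.prems])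
  have intB: "integrable S (\<lambda>\<omega>. lgain (B.A (Suc n) \<omega>) x)" by (rule B.integrable_lgain_A[OF Suc.prems])
  have inA: "(\<integral>\<omega>. lgain (A (Suc n) (case_nat s \<omega>)) x \<partial>S) = lgain (a s) x + gain n (a s *v x)" for s
    unfolding lgain_A_Suc_case_nat[OF Suc.prems] gain_def
    using integrable_lgain_A[OF a_mult_neq_0[OF Suc.prems]] by (simp add: P.prob_space[simplified])
  have inB: "(\<integral>\<omega>. lgain (B.A (Suc n) (case_nat s \<omega>)) x \<partial>S) = lgain (b s) x + B.gain n (b s *v x)" for s
    unfolding B.lgain_A_Suc_case_nat[OF Suc.prems] B.gain_def
    using B.integrable_lgain_A[OF B.a_mult_neq_0[OF Suc.prems]] by (simp add: P.prob_space[simplified])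
  have gA: "gain (Suc n) x = (\<integral>s. lgain (a s) x + gain n (a s *v x) \<partial>M)"
    unfolding gain_def[of "Suc n"] using integral_case_nat(1)[OF intA] by (simp only: inA)
  have gB: "B.gain (Suc n) x = (\<integral>s. lgain (b s) x + B.gain n (b s *v x) \<partial>M)"
    unfolding B.gain_def[of "Suc n"] using integral_case_nat(1)[OF intB] by (simp only: inB)
  have iA: "integrable M (\<lambda>s. lgain (a s) x + gain n (a s *v x))"
    using integral_case_nat(2)[OF intA] by (simp only: inA)
  have iB: "integrable M (\<lambda>s. lgain (b s) x + B.gain n (b s *v x))"
    using integral_case_nat(2)[OF intB] by (simp only: inB)
  have pw: "\<bar>(lgain (a s) x + gain n (a s *v x)) - (lgain (b s) x + B.gain n (b s *v x))\<bar>
      \<le> (1 / \<theta> + gain_const) * ?y s + real n * E" for s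
  proof -
    have nz: "a s *v x \<noteq> 0" "b s *v x \<noteq> 0" using a_mult_neq_0 B.a_mult_neq_0 Suc.prems by auto
    have 1: "\<bar>lgain (a s) x - lgain (b s) x\<bar> \<le> ?y s / \<theta>"
      using \<theta>_pos \<theta>_le by (intro abs_lgain_compare D w0 Suc.prems) auto
    have "sdist (a s *v x) (b s *v x) \<le> norm (a s *v x - b s *v x) / norm (b s *v x)"
      by (rule sdist_le_norm_diff[OF nz(1)])
    also have "\<dots> \<le> opnorm (a s - b s) * norm x / norm (b s *v x)"
      using norm_mult_le_opnorm[of "a s - b s" x]
      by (intro divide_right_mono) (auto simp: matrix_vector_mult_diff_rdistrib)
    also have "\<dots> \<le> opnorm (a s - b s) * (wt s * norm (b s *v x)) / norm (b s *v x)"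
      using D(2)[of x s] opnorm_nonneg[of "a s - b s"] by (intro divide_right_mono mult_left_mono) auto
    also have "\<dots> = opnorm (a s - b s) * wt s" using nz by simp
    finally have "sdist (a s *v x) (b s *v x) powr \<theta> \<le> ?y s"
      using \<theta>_pos by (intro powr_mono2 sdist_nonneg) auto
    then have "gain_const * sdist (a s *v x) (b s *v x) powr \<theta> \<le> gain_const * ?y s"
      by (intro mult_left_mono gain_const_nonneg)
    then have 2: "\<bar>gain n (a s *v x) - gain n (b s *v x)\<bar> \<le> gain_const * ?y s"
      using gain_diff_le[OF nz, of n] by linarith
    have 3: "\<bar>gain n (b s *v x) - B.gain n (b s *v x)\<bar> \<le> real n * E"
      using Suc.IH[OF nz(2)] by (simp add: E_def)
    have "(1 / \<theta> + gain_const) * ?y s = ?y s / \<theta> + gain_const * ?y s" by (simp add: distrib_right)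
    then show ?thesis using 1 2 3 by linarith
  qed
  have "\<bar>gain (Suc n) x - B.gain (Suc n) x\<bar>
      = \<bar>\<integral>s. (lgain (a s) x + gain n (a s *v x)) - (lgain (b s) x + B.gain n (b s *v x)) \<partial>M\<bar>"
    unfolding gA gB by (subst Bochner_Integration.integral_diff[OF iA iB]) simp
  also have "\<dots> \<le> (\<integral>s. \<bar>(lgain (a s) x + gain n (a s *v x)) - (lgain (b s) x + B.gain n (b s *v x))\<bar> \<partial>M)"
    by (rule integral_abs_bound)
  also have "\<dots> \<le> (\<integral>s. (1 / \<theta> + gain_const) * ?y s + real n * E \<partial>M)"
    using y_int by (intro integral_mono pw integrable_abs Bochner_Integration.integrable_diff iA iB) auto
  also have "\<dots> = (1 / \<theta> + gain_const) * (\<integral>s. ?y s \<partial>M) + real n * E"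
    using y_int by (simp add: M.prob_space)
  also have "\<dots> \<le> E + real n * E"
    unfolding E_def using y_le gain_const_nonneg \<theta>_pos by (intro add_right_mono mult_left_mono) auto
  finally show ?case unfolding E_def[symmetric] by (simp add: distrib_right)
qed

lemma rate_compare:
  assumes "contracting_cocycle M b q K N \<theta> \<rho>"
    and d: "0 < d" "(\<integral>\<^sup>+s. ennreal (opnorm (a s - b s)) \<partial>M) \<le> ennreal d"
  shows "\<bar>top.rate - subadditive_process.rate M (\<lambda>n \<omega>. ln (opnorm (mat_prod b n \<omega>)))\<bar>
    \<le> (1 / \<theta> + gain_const) * ((2 + K) * d powr \<theta>)"
proof -
  interpret B: contracting_cocycle M b q K N \<theta> \<rho> by fact
  let ?x = "axis undefined 1 :: real ^ 'm"
  have x: "?x \<noteq> 0" by (simp add: axis_eq_0_iff)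
  have "(\<lambda>n. \<bar>gain n ?x / real n - B.gain n ?x / real n\<bar>) \<longlonglongrightarrow> \<bar>top.rate - B.top.rate\<bar>"
    by (intro tendsto_intros gain_limit B.gain_limit x)
  moreover have "\<bar>gain n ?x / real n - B.gain n ?x / real n\<bar> \<le> (1 / \<theta> + gain_const) * ((2 + K) * d powr \<theta>)"
    if "1 \<le> n" for n
  proof -
    have "\<bar>gain n ?x / real n - B.gain n ?x / real n\<bar> = \<bar>gain n ?x - B.gain n ?x\<bar> / real n"
      by (simp add: diff_divide_distrib[symmetric])
    also have "\<dots> \<le> real n * ((1 / \<theta> + gain_const) * ((2 + K) * d powr \<theta>)) / real n"
      using gain_compare[OF assms x, of n] by (intro divide_right_mono) auto
    finally show ?thesis using that by simp
  qed
  then have "\<exists>n0. \<forall>n\<ge>n0. \<bar>gain n ?x / real n - B.gain n ?x / real n\<bar> \<le> (1 / \<theta> + gain_const) * ((2 + K) * d powr \<theta>)"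
    by blast
  ultimately show ?thesis by (rule LIMSEQ_le_const2)
qed

end

section \<open>Locally constant cocycles over the Bernoulli shift\<close>

definition letter :: "((int \<Rightarrow> 's) \<Rightarrow> 'b) \<Rightarrow> 's \<Rightarrow> 'b" where
  "letter B s = B (\<lambda>_. s)"

definition half_line :: "(int \<Rightarrow> 's) \<Rightarrow> nat \<Rightarrow> 's" where
  "half_line \<omega> n = \<omega> (int n)"

lemma letter_eq: "locally_constant B \<Longrightarrow> B \<omega> = letter B (\<omega> 0)"
  unfolding locally_constant_def letter_def by (elim allE[of _ \<omega>] allE[of _ "\<lambda>_. \<omega> 0"] impE) auto

lemma funpow_shift: "(shift ^^ n) \<omega> = (\<lambda>i. \<omega> (i + int n))"
proof (induction n)
  case (Suc n)
  have "(shift ^^ Suc n) \<omega> = shift ((shift ^^ n) \<omega>)" by simp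
  also have "\<dots> = (\<lambda>i. \<omega> (i + 1 + int n))" by (simp only: Suc shift_def)
  finally show ?case by (simp add: algebra_simps)
qed simp

lemma cocycle_iter_eq_mat_prod:
  "locally_constant B \<Longrightarrow> cocycle_iter B n \<omega> = mat_prod (letter B) n (half_line \<omega>)"
proof (induction n)
  case (Suc n)
  then show ?case
    using letter_eq[OF Suc.prems, of "(shift ^^ n) \<omega>"] by (simp add: funpow_shift half_line_def)
qed simp

lemma Cp_spaceD:
  assumes "B \<in> Cp_space p \<mu>"
  shows "B \<in> borel_measurable (bernoulli_measure \<mu>)" "locally_constant B" "det (letter B s) = 1"
    "(\<integral>\<^sup>+\<omega>. ennreal (opnorm (B \<omega>) powr p) \<partial>bernoulli_measure \<mu>) < \<infinity>"
  using assms by (auto simp: Cp_space_def SL_def letter_def)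

context letters
begin

lemma measurable_const_seq: "(\<lambda>s. (\<lambda>_. s)) \<in> measurable M (bernoulli_measure M)"
  unfolding bernoulli_measure_def by (rule measurable_PiM_single') (auto simp: space_M)

lemma space_bernoulli [simp]: "space (bernoulli_measure M) = UNIV"
  by (simp add: bernoulli_measure_def space_PiM space_M)

lemma prob_space_bernoulli: "prob_space (bernoulli_measure M)"
  unfolding bernoulli_measure_def by (rule prob_space_PiM) (rule M.prob_space_axioms)

lemma letter_measurable:
  assumes "B \<in> Cp_space p M"
  shows "letter B \<in> borel_measurable M"
  unfolding letter_def by (rule measurable_compose[OF measurable_const_seq Cp_spaceD(1)[OF assms]])

lemma distr_bernoulli_component: "distr (bernoulli_measure M) M (\<lambda>\<omega>. \<omega> 0) = M"
  unfolding bernoulli_measure_def by (rule distr_PiM_component) (auto intro: M.prob_space_axioms)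

lemma measurable_component_bernoulli [measurable]: "(\<lambda>\<omega>. \<omega> 0) \<in> measurable (bernoulli_measure M) M"
  unfolding bernoulli_measure_def by (rule measurable_component_singleton) simp

lemma nn_integral_bernoulli:
  assumes [measurable]: "f \<in> borel_measurable M"
  shows "(\<integral>\<^sup>+\<omega>. f (\<omega> 0) \<partial>bernoulli_measure M) = (\<integral>\<^sup>+s. f s \<partial>M)"
proof -
  have "(\<integral>\<^sup>+s. f s \<partial>distr (bernoulli_measure M) M (\<lambda>\<omega>. \<omega> 0)) = (\<integral>\<^sup>+\<omega>. f (\<omega> 0) \<partial>bernoulli_measure M)"
    by (rule nn_integral_distr) auto
  then show ?thesis by (simp add: distr_bernoulli_component)
qed

lemma AE_bernoulli_component:
  assumes "AE s in M. P s"
  shows "AE \<omega> in bernoulli_measure M. P (\<omega> 0)"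
proof -
  have "AE s in distr (bernoulli_measure M) M (\<lambda>\<omega>. \<omega> 0). P s" using assms unfolding distr_bernoulli_component .
  then show ?thesis by (rule AE_distrD[rotated]) measurable
qed

lemma AE_half_line:
  assumes "AE \<omega> in S. P \<omega>"
  shows "AE \<omega> in bernoulli_measure M. P (half_line \<omega>)"
proof -
  have reindex: "distr (Pi\<^sub>M UNIV (\<lambda>_::int. M)) (\<Pi>\<^sub>M i\<in>(UNIV::nat set). M) (\<lambda>\<omega>. \<lambda>n\<in>UNIV. \<omega> (int n)) = (\<Pi>\<^sub>M i\<in>UNIV. M)"
    by (rule distr_PiM_reindex) (auto intro: M.prob_space_axioms)
  have half_line: "(\<lambda>\<omega>. \<lambda>n\<in>UNIV. \<omega> (int n)) = half_line"
    by (auto simp: fun_eq_iff half_line_def)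
  have eq: "distr (bernoulli_measure M) S half_line = S"
    using reindex unfolding half_line bernoulli_measure_def .
  have "half_line \<in> measurable (bernoulli_measure M) S"
    unfolding half_line_def bernoulli_measure_def
    by (rule measurable_PiM_single') (auto simp: space_M)
  moreover have "AE \<omega> in distr (bernoulli_measure M) S half_line. P \<omega>" using assms unfolding eq .
  ultimately show ?thesis by (rule AE_distrD)
qed

lemma L1_dist_eq:
  assumes "B \<in> Cp_space p M" "B' \<in> Cp_space p M"
  shows "L1_dist M B B' = (\<integral>\<^sup>+s. ennreal (opnorm (letter B s - letter B' s)) \<partial>M)"
proof -
  note [measurable] = letter_measurable[OF assms(1)] letter_measurable[OF assms(2)]
  have "L1_dist M B B' = (\<integral>\<^sup>+\<omega>. ennreal (opnorm (letter B (\<omega> 0) - letter B' (\<omega> 0))) \<partial>bernoulli_measure M)"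
    unfolding L1_dist_def
    using letter_eq[OF Cp_spaceD(2)[OF assms(1)]] letter_eq[OF Cp_spaceD(2)[OF assms(2)]] by simp
  also have "\<dots> = (\<integral>\<^sup>+s. ennreal (opnorm (letter B s - letter B' s)) \<partial>M)"
    by (rule nn_integral_bernoulli) measurable
  finally show ?thesis .
qed

text \<open>
  Since \<open>min 1 p \<le> 1\<close>, this power function is subadditive, so that the moment of \<open>B\<close> is
  bounded by those of \<open>A\<close> and of the difference, and the latter is at most one plus the distance.
\<close>
lemma Cp_moment_near:
  fixes A B :: "(int \<Rightarrow> 's) \<Rightarrow> real ^ 'm ^ 'm"
  assumes p: "0 < p" and A: "A \<in> Cp_space p M" and B: "B \<in> Cp_space p M"
    and near: "L1_dist M A B \<le> 1"
  shows "(\<integral>\<^sup>+s. ennreal (distortion (letter B s) powr (min 1 p / real CARD('m))) \<partial>M)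
    \<le> ennreal ((real CARD('m) * fact CARD('m)) powr (min 1 p / real CARD('m)))
      * (4 + (\<integral>\<^sup>+\<omega>. ennreal (opnorm (A \<omega>) powr p) \<partial>bernoulli_measure M))"
proof -
  define r where "r = min 1 p"
  have r: "0 < r" "r \<le> 1" "r \<le> p" using p by (auto simp: r_def)
  define c where "c = (real CARD('m) * fact CARD('m)) powr (r / real CARD('m))"
  note [measurable] = letter_measurable[OF A] letter_measurable[OF B]
  have le: "y powr r' \<le> 1 + y powr p'" if "0 \<le> y" "0 < r'" "r' \<le> p'" for y r' p' :: real
  proof (cases "y \<le> 1")
    case True
    then have "y powr r' \<le> 1 powr r'" using that by (intro powr_mono2) auto
    then show ?thesis by (simp add: add_increasing2)
  next
    case False
    then have "y powr r' \<le> y powr p'" using that by (intro powr_mono) auto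
    then show ?thesis by simp
  qed
  have pw: "distortion (letter B s) powr (r / real CARD('m))
      \<le> c * (3 + opnorm (letter A s) powr p + opnorm (letter A s - letter B s))" for s
  proof -
    let ?a = "opnorm (letter A s)" and ?b = "opnorm (letter B s)" and ?d = "opnorm (letter A s - letter B s)"
    have nn: "0 \<le> ?a" "0 \<le> ?b" "0 \<le> ?d" by (auto simp: opnorm_nonneg)
    have "distortion (letter B s) powr (r / real CARD('m)) = c * (max 1 ?b ^ CARD('m)) powr (r / real CARD('m))"
      unfolding distortion_def c_def by (rule powr_mult)
    also have "(max 1 ?b ^ CARD('m)) powr (r / real CARD('m)) = max 1 ?b powr r"
      by (simp add: powr_realpow[symmetric] powr_powr)
    also have "max 1 ?b powr r \<le> (max 1 ?a + ?d) powr r"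
    proof (intro powr_mono2)
      have "?b \<le> ?a + opnorm (letter B s - letter A s)" using opnorm_triangle[of "letter A s" "letter B s - letter A s"] by simp
      then show "max 1 ?b \<le> max 1 ?a + ?d" using nn by (simp add: opnorm_minus_commute[of "letter B s"]) linarith
    qed (use r in auto)
    also have "\<dots> \<le> max 1 ?a powr r + ?d powr r" using r nn by (intro powr_add_le) auto
    also have "max 1 ?a powr r \<le> 1 + ?a powr r"
      using r by (cases "?a \<le> 1") (auto simp: max_def)
    also have "?a powr r \<le> 1 + ?a powr p" by (rule le[OF nn(1) r(1) r(3)])
    also have "?d powr r \<le> 1 + ?d" using le[OF nn(3) r(1) r(2)] nn by simp
    finally show ?thesis by (simp add: c_def mult_left_mono add.assoc)
  qed
  have c0: "0 \<le> c" by (simp add: c_def)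
  have "(\<integral>\<^sup>+s. ennreal (distortion (letter B s) powr (r / real CARD('m))) \<partial>M)
      \<le> (\<integral>\<^sup>+s. ennreal c * (ennreal 3 + ennreal (opnorm (letter A s) powr p) + ennreal (opnorm (letter A s - letter B s))) \<partial>M)"
  proof (intro nn_integral_mono)
    fix s
    let ?x = "opnorm (letter A s) powr p" and ?y = "opnorm (letter A s - letter B s)"
    have "ennreal (distortion (letter B s) powr (r / real CARD('m))) \<le> ennreal (c * (3 + ?x + ?y))"
      by (rule ennreal_leI) (rule pw)
    also have "\<dots> = ennreal c * ennreal (3 + ?x + ?y)" by (rule ennreal_mult') (rule c0)
    also have "ennreal (3 + ?x + ?y) = ennreal (3 + ?x) + ennreal ?y"
      by (rule ennreal_plus) (auto simp: opnorm_nonneg)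
    also have "ennreal (3 + ?x) = ennreal 3 + ennreal ?x" by (rule ennreal_plus) auto
    finally show "ennreal (distortion (letter B s) powr (r / real CARD('m)))
        \<le> ennreal c * (ennreal 3 + ennreal ?x + ennreal ?y)" .
  qed
  also have "\<dots> = ennreal c * (ennreal 3 + (\<integral>\<^sup>+s. ennreal (opnorm (letter A s) powr p) \<partial>M) + L1_dist M A B)"
    by (simp add: nn_integral_cmult nn_integral_add M.emeasure_space_1 L1_dist_eq[OF A B])
  also have "\<dots> \<le> ennreal c * (ennreal 3 + (\<integral>\<^sup>+s. ennreal (opnorm (letter A s) powr p) \<partial>M) + 1)"
    by (intro mult_left_mono add_left_mono near) simp
  also have "(\<integral>\<^sup>+s. ennreal (opnorm (letter A s) powr p) \<partial>M) = (\<integral>\<^sup>+\<omega>. ennreal (opnorm (A \<omega>) powr p) \<partial>bernoulli_measure M)"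
    using nn_integral_bernoulli[of "\<lambda>s. ennreal (opnorm (letter A s) powr p)"] letter_eq[OF Cp_spaceD(2)[OF A]]
    by simp
  also have "ennreal 3 + (\<integral>\<^sup>+\<omega>. ennreal (opnorm (A \<omega>) powr p) \<partial>bernoulli_measure M) + 1
      = 4 + (\<integral>\<^sup>+\<omega>. ennreal (opnorm (A \<omega>) powr p) \<partial>bernoulli_measure M)"
  proof -
    have "ennreal 3 + z + 1 = 4 + z" for z
    proof -
      have "ennreal 3 + z + 1 = (ennreal 3 + 1) + z" by (simp only: add.assoc add.commute[of z 1])
      also have "ennreal 3 + 1 = 4" by simp
      finally show ?thesis .
    qed
    then show ?thesis .
  qed
  finally show ?thesis by (simp only: c_def r_def)
qed

lemma bounded_cocycle_near:
  fixes A :: "(int \<Rightarrow> 's) \<Rightarrow> real ^ 'm ^ 'm"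
  assumes dim: "CARD('m) \<ge> 2" and p: "0 < p" and A: "A \<in> Cp_space p M"
  shows "\<exists>K. \<forall>B \<in> Cp_space p M. L1_dist M A B \<le> 1 \<longrightarrow> bounded_cocycle M (letter B) (min 1 p / real CARD('m)) K"
proof -
  let ?q = "min 1 p / real CARD('m)"
  define X where "X = ennreal ((real CARD('m) * fact CARD('m)) powr ?q)
      * (4 + (\<integral>\<^sup>+\<omega>. ennreal (opnorm (A \<omega>) powr p) \<partial>bernoulli_measure M))"
  have X: "X < \<infinity>" using Cp_spaceD(4)[OF A] by (simp add: X_def ennreal_mult_less_top)
  have "bounded_cocycle M (letter B) ?q (enn2real X)" if B: "B \<in> Cp_space p M" "L1_dist M A B \<le> 1" for B
  proof -
    note [measurable] = letter_measurable[OF B(1)]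
    have le: "(\<integral>\<^sup>+s. ennreal (distortion (letter B s) powr ?q) \<partial>M) \<le> X"
      unfolding X_def by (rule Cp_moment_near[OF p A B])
    have int: "integrable M (\<lambda>s. distortion (letter B s) powr ?q)"
      using le X by (intro integrableI_bounded) (auto intro: le_less_trans)
    have "(\<integral>s. distortion (letter B s) powr ?q \<partial>M) \<le> enn2real X"
    proof -
      have "ennreal (\<integral>s. distortion (letter B s) powr ?q \<partial>M) \<le> ennreal (enn2real X)"
        using le X by (subst nn_integral_eq_integral[OF int, symmetric]) auto
      then show ?thesis by (simp add: ennreal_le_iff)
    qed
    then show ?thesis
      by unfold_locales (use dim p int Cp_spaceD(3)[OF B(1)] in auto)
  qed
  then show ?thesis by blast
qed

lemma AE_bernoulli_limit_unique:
  assumes "AE \<omega> in bernoulli_measure M. X \<omega> \<longlonglongrightarrow> (l :: real)" "AE \<omega> in bernoulli_measure M. X \<omega> \<longlonglongrightarrow> l'"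
  shows "l = l'"
proof -
  interpret prob_space "bernoulli_measure M" by (rule prob_space_bernoulli)
  have "AE \<omega> in bernoulli_measure M. l = l'" using assms by eventually_elim (rule LIMSEQ_unique)
  then show ?thesis by simp
qed

end

context sl_cocycle
begin

lemma lyapunov1_eq_rate:
  assumes "locally_constant B" "letter B = a"
  shows "lyapunov1 M B = top.rate"
    and "AE \<omega> in bernoulli_measure M. (\<lambda>n. 1 / real n * ln (opnorm (cocycle_iter B n \<omega>))) \<longlonglongrightarrow> top.rate"
proof -
  have "AE \<omega> in bernoulli_measure M. (\<lambda>n. ln (opnorm (A n (half_line \<omega>))) / real n) \<longlonglongrightarrow> top.rate"
    by (rule AE_half_line) (rule top.ratio_tendsto_rate)
  then show ae: "AE \<omega> in bernoulli_measure M. (\<lambda>n. 1 / real n * ln (opnorm (cocycle_iter B n \<omega>))) \<longlonglongrightarrow> top.rate"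
    by (simp add: cocycle_iter_eq_mat_prod assms)
  show "lyapunov1 M B = top.rate"
    unfolding lyapunov1_def
  proof (rule the_equality)
    show "l = top.rate" if "AE \<omega> in bernoulli_measure M.
        (\<lambda>n. 1 / real n * ln (opnorm (cocycle_iter B n \<omega>))) \<longlonglongrightarrow> l" for l
      by (rule AE_bernoulli_limit_unique[OF that ae])
  qed (rule ae)
qed

lemma lyapunov2_eq_rate:
  assumes "locally_constant B" "letter B = a"
  shows "lyapunov2 M B = area.rate - top.rate"
proof -
  have "AE \<omega> in bernoulli_measure M. (\<lambda>n. ln (area_norm (A n (half_line \<omega>))) / real n) \<longlonglongrightarrow> area.rate"
    by (rule AE_half_line) (rule area.ratio_tendsto_rate)
  moreover have "AE \<omega> in bernoulli_measure M. (\<lambda>n. ln (opnorm (A n (half_line \<omega>))) / real n) \<longlonglongrightarrow> top.rate"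
    by (rule AE_half_line) (rule top.ratio_tendsto_rate)
  ultimately have ae: "AE \<omega> in bernoulli_measure M.
      (\<lambda>n. 1 / real n * ln (second_singular_value (cocycle_iter B n \<omega>))) \<longlonglongrightarrow> area.rate - top.rate"
  proof eventually_elim
    case (elim \<omega>)
    have "ln (second_singular_value (A n (half_line \<omega>)))
        = ln (area_norm (A n (half_line \<omega>))) - ln (opnorm (A n (half_line \<omega>)))" for n
    proof -
      have "0 < opnorm (A n (half_line \<omega>)) * second_singular_value (A n (half_line \<omega>))"
        using area_norm_A_pos by (simp add: area_norm_eq_singular_values[OF dim_ge_2, symmetric])
      then have "0 < second_singular_value (A n (half_line \<omega>))"
        using opnorm_A_pos[of n "half_line \<omega>"] by (simp add: zero_less_mult_iff)
      then show ?thesis using opnorm_A_pos[of n "half_line \<omega>"]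
        by (simp add: area_norm_eq_singular_values[OF dim_ge_2] ln_mult)
    qed
    then show ?case
      using tendsto_diff[OF elim] by (simp add: cocycle_iter_eq_mat_prod assms diff_divide_distrib)
  qed
  show ?thesis
    unfolding lyapunov2_def
  proof (rule the_equality)
    show "l = area.rate - top.rate" if "AE \<omega> in bernoulli_measure M.
        (\<lambda>n. 1 / real n * ln (second_singular_value (cocycle_iter B n \<omega>))) \<longlonglongrightarrow> l" for l
      by (rule AE_bernoulli_limit_unique[OF that ae])
  qed (rule ae)
qed

lemma opnorm_on_pos:
  assumes "subspace E" "E \<noteq> {0}"
  shows "0 < opnorm_on E (A n \<omega>)"
proof -
  obtain e where e: "e \<in> E" "e \<noteq> 0" using assms subspace_0 by blast
  define u where "u = (1 / norm e) *\<^sub>R e"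
  have u: "u \<in> E" "norm u = 1" using e assms(1) by (auto simp: u_def subspace_scale)
  have "bdd_above ((\<lambda>v. norm (A n \<omega> *v v)) ` {v \<in> E. norm v = 1})"
    by (rule bdd_aboveI2[of _ _ "opnorm (A n \<omega>)"]) (auto intro: order_trans[OF norm_mult_le_opnorm])
  then have "norm (A n \<omega> *v u) \<le> opnorm_on E (A n \<omega>)"
    unfolding opnorm_on_def using u by (intro cSUP_upper) auto
  moreover have "0 < norm (A n \<omega> *v u)" using u by auto
  ultimately show ?thesis by linarith
qed

lemma opnorm_le_opnorm_on_UNIV: "opnorm (A n \<omega>) \<le> opnorm_on UNIV (A n \<omega>)"
proof (rule opnorm_leI)
  fix x
  have bdd: "bdd_above ((\<lambda>v. norm (A n \<omega> *v v)) ` {v \<in> UNIV. norm v = 1})"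
    by (rule bdd_aboveI2[of _ _ "opnorm (A n \<omega>)"]) (auto intro: order_trans[OF norm_mult_le_opnorm])
  show "norm (A n \<omega> *v x) \<le> opnorm_on UNIV (A n \<omega>) * norm x"
  proof (cases "x = 0")
    case False
    have "norm (A n \<omega> *v ((1 / norm x) *\<^sub>R x)) \<le> opnorm_on UNIV (A n \<omega>)"
      unfolding opnorm_on_def using False by (intro cSUP_upper[OF _ bdd]) auto
    then show ?thesis using False by (simp add: matrix_vector_mult_scaleR field_simps)
  qed simp
qed

text \<open>
  Along the products on a proper invariant subspace the definition of quasi-irreducibility supplies the
  limit; on the whole space the limit is the exponent itself.
\<close>
lemma quasi_irreducible_cocycle_of_quasi_irreducible:
  assumes B: "B \<in> Cp_space p M" "letter B = a" and qi: "quasi_irreducible M B"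
  shows "quasi_irreducible_cocycle M a q"
proof
  note lc = Cp_spaceD(2)[OF B(1)]
  fix E :: "(real ^ 'm) set"
  assume E: "subspace E" "E \<noteq> {0}" and inv: "AE s in M. (\<lambda>v. a s *v v) ` E \<subseteq> E"
  have limit_not_less: "\<not> (AE \<omega> in bernoulli_measure M. \<exists>l<top.rate. \<forall>\<^sub>F n in sequentially. X n \<omega> \<le> exp (l * real n))"
    if "\<And>n \<omega>. 0 < X n \<omega>" "AE \<omega> in bernoulli_measure M. (\<lambda>n. 1 / real n * ln (X n \<omega>)) \<longlonglongrightarrow> top.rate"
    for X :: "nat \<Rightarrow> (int \<Rightarrow> 's) \<Rightarrow> real"
  proof
    interpret prob_space "bernoulli_measure M" by (rule prob_space_bernoulli)
    assume "AE \<omega> in bernoulli_measure M. \<exists>l<top.rate. \<forall>\<^sub>F n in sequentially. X n \<omega> \<le> exp (l * real n)"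
    with that(2) have "AE \<omega> in bernoulli_measure M. False"
    proof eventually_elim
      case (elim \<omega>)
      then obtain l where l: "l < top.rate" "\<forall>\<^sub>F n in sequentially. X n \<omega> \<le> exp (l * real n)" by blast
      have "\<forall>\<^sub>F n in sequentially. 1 / real n * ln (X n \<omega>) \<le> l"
        using l(2) eventually_ge_at_top[of "1::nat"]
      proof eventually_elim
        case (elim n)
        have "ln (X n \<omega>) \<le> ln (exp (l * real n))" using elim(1) that(1)[of n \<omega>] by (subst ln_le_cancel_iff) auto
        then show ?case using elim(2) by (simp add: field_simps)
      qed
      then have "top.rate \<le> l" using elim(1) by (intro tendsto_upperbound[OF elim(1)]) auto
      then show False using l(1) by simp
    qed
    then show False by simp
  qed
  show "\<not> (AE \<omega> in S. \<exists>l<top.rate. \<forall>\<^sub>F n in sequentially. opnorm_on E (A n \<omega>) \<le> exp (l * real n))"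
  proof
    assume "AE \<omega> in S. \<exists>l<top.rate. \<forall>\<^sub>F n in sequentially. opnorm_on E (A n \<omega>) \<le> exp (l * real n)"
    then have ae: "AE \<omega> in bernoulli_measure M. \<exists>l<top.rate.
        \<forall>\<^sub>F n in sequentially. opnorm_on E (cocycle_iter B n \<omega>) \<le> exp (l * real n)"
      using AE_half_line by (simp add: cocycle_iter_eq_mat_prod[OF lc] B(2))
    show False
    proof (cases "E = UNIV")
      case True
      have "AE \<omega> in bernoulli_measure M. \<exists>l<top.rate.
          \<forall>\<^sub>F n in sequentially. opnorm (cocycle_iter B n \<omega>) \<le> exp (l * real n)"
        using ae
      proof eventually_elim
        case (elim \<omega>)
        then obtain l where l: "l < top.rate" "\<forall>\<^sub>F n in sequentially. opnorm_on E (cocycle_iter B n \<omega>) \<le> exp (l * real n)" by blast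
        from l(2) have "\<forall>\<^sub>F n in sequentially. opnorm (cocycle_iter B n \<omega>) \<le> exp (l * real n)"
          by eventually_elim
            (use True opnorm_le_opnorm_on_UNIV in \<open>auto simp: cocycle_iter_eq_mat_prod[OF lc] B(2) intro: order_trans\<close>)
        then show ?case using l(1) by blast
      qed
      moreover have "0 < opnorm (cocycle_iter B n \<omega>)" for n \<omega>
        by (simp add: cocycle_iter_eq_mat_prod[OF lc] B(2) opnorm_A_pos)
      ultimately show False using limit_not_less[OF _ lyapunov1_eq_rate(2)[OF lc B(2)]] by blast
    next
      case False
      have closed: "closed {g :: real ^ 'm ^ 'm. (\<lambda>v. g *v v) ` E \<subseteq> E}"
      proof -
        have "{g :: real ^ 'm ^ 'm. (\<lambda>v. g *v v) ` E \<subseteq> E} = (\<Inter>v\<in>E. (\<lambda>g. g *v v) -` E)" by auto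
        then show ?thesis
          using closed_vimage[OF closed_subspace[OF E(1)] continuous_matrix_apply] by auto
      qed
      have "AE \<omega> in bernoulli_measure M. (\<lambda>v. B \<omega> *v v) ` E \<subseteq> E"
        using AE_bernoulli_component[OF inv] by (simp add: letter_eq[OF lc, symmetric] B(2)[symmetric])
      then have "AE g in distr (bernoulli_measure M) borel B. (\<lambda>v. g *v v) ` E \<subseteq> E"
        using closed Cp_spaceD(1)[OF B(1)] by (subst AE_distr_iff) auto
      then have lim: "AE \<omega> in bernoulli_measure M. (\<lambda>n. 1 / real n * ln (opnorm_on E (cocycle_iter B n \<omega>))) \<longlonglongrightarrow> top.rate"
        using qi E False unfolding quasi_irreducible_def lyapunov1_eq_rate(1)[OF lc B(2)] by blast
      have "0 < opnorm_on E (cocycle_iter B n \<omega>)" for n \<omega>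
        by (simp add: cocycle_iter_eq_mat_prod[OF lc] B(2) opnorm_on_pos[OF E])
      then show False using limit_not_less[OF _ lim] ae by blast
    qed
  qed
qed

end

section \<open>Hoelder continuity of the top exponent\<close>

lemma (in letters) contracting_cocycle_near:
  fixes a :: "'s \<Rightarrow> real ^ 'm ^ 'm"
  assumes qi: "quasi_irreducible_cocycle M a q" and a: "bounded_cocycle M a q K"
    and gap: "subadditive_process.rate M (\<lambda>n \<omega>. ln (area_norm (mat_prod a n \<omega>)))
      < 2 * subadditive_process.rate M (\<lambda>n \<omega>. ln (opnorm (mat_prod a n \<omega>)))"
  shows "\<exists>\<delta>>0. \<exists>N \<theta> \<rho>. \<forall>b. bounded_cocycle M b q K \<longrightarrow>
    (\<integral>\<^sup>+s. ennreal (opnorm (a s - b s)) \<partial>M) \<le> ennreal \<delta> \<longrightarrow> contracting_cocycle M b q K N \<theta> \<rho>"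
proof -
  interpret A: bounded_cocycle M a q K by fact
  obtain n where n: "1 \<le> n" "\<And>x. x \<noteq> 0 \<Longrightarrow> (\<integral>\<omega>. A.angle_rate n x \<omega> \<partial>S) \<le> - 1"
    using ex_mean_angle_rate_le[OF qi a gap] by blast
  define t where "t = min (q / 4) (1 / 2)"
  have t: "0 < t" "4 * t \<le> q" "2 * t \<le> 1" using A.q_pos by (auto simp: t_def)
  \<comment> \<open>\<open>\<delta>\<close> is chosen such that the perturbation \<open>B * \<delta> powr t\<close> of the mean angle rate is a half.\<close>
  define B where "B = 4 / t * (real n * K ^ n * (2 + K))"
  have B: "0 < B" using t n(1) A.K_ge_1 by (simp add: B_def)
  define \<delta> where "\<delta> = (1 / (2 * B)) powr (1 / t)"
  have \<delta>: "0 < \<delta>" "B * \<delta> powr t = 1 / 2" using B t by (simp_all add: \<delta>_def powr_powr)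
  define D where "D = 2 * K ^ n / (q / 8)\<^sup>2"
  have D: "0 < D" using A.K_ge_1 A.q_pos by (simp add: D_def)
  define \<theta> where "\<theta> = min (min (q / 8) (1 / 2)) (1 / (4 * D))"
  have \<theta>: "0 < \<theta>" "\<theta> \<le> q / 8" "\<theta> \<le> 1 / 2" "\<theta> \<le> 1 / (4 * D)" using A.q_pos D by (auto simp: \<theta>_def)
  then have \<theta>D: "\<theta> * (2 * K ^ n / (q / 8)\<^sup>2) \<le> 1 / 4"
    unfolding D_def[symmetric] using D by (simp add: field_simps)
  have "contracting_cocycle M b q K n \<theta> (1 - \<theta> / 4)"
    if b: "bounded_cocycle M b q K" and near: "(\<integral>\<^sup>+s. ennreal (opnorm (a s - b s)) \<partial>M) \<le> ennreal \<delta>" for b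
  proof -
    interpret B: bounded_cocycle M b q K by fact
    interpret cocycle_pair M a b q K t \<delta> by unfold_locales (use t \<delta> near in auto)
    have neg: "(\<integral>\<omega>. B.angle_rate n x \<omega> \<partial>S) \<le> - 1 / 2" if x: "x \<noteq> 0" for x
    proof -
      have "(\<integral>\<omega>. B.angle_rate n x \<omega> \<partial>S)
          \<le> (\<integral>\<omega>. A.angle_rate n x \<omega> \<partial>S) + 4 / t * (real n * K ^ n * ((2 + K) * \<delta> powr t))"
        by (rule mean_angle_rate_le[OF x])
      also have "4 / t * (real n * K ^ n * ((2 + K) * \<delta> powr t)) = B * \<delta> powr t" by (simp add: B_def)
      also have "\<dots> = 1 / 2" by (rule \<delta>(2))
      finally show ?thesis using n(2)[OF x] by simp
    qed
    show ?thesis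
    proof
      fix x y :: "real ^ 'm" assume xy: "x \<noteq> 0" "y \<noteq> 0"
      show "(\<integral>\<^sup>+\<omega>. ennreal (sdist (mat_prod b n \<omega> *v x) (mat_prod b n \<omega> *v y) powr \<theta>) \<partial>S)
          \<le> ennreal ((1 - \<theta> / 4) * sdist x y powr \<theta>)"
        by (intro B.contraction_of_mean_angle_rate neg \<theta>(1,2) \<theta>D xy)
    qed (use n \<theta> in auto)
  qed
  with \<delta>(1) show ?thesis by blast
qed

text \<open>The comparison of exponents assumes a positive distance; this covers distance zero.\<close>
lemma le_powr_of_forall_greater:
  fixes C \<theta> d y :: real
  assumes "0 < C" "0 < \<theta>" "0 \<le> d" "\<And>d'. 0 < d' \<Longrightarrow> d \<le> d' \<Longrightarrow> y \<le> C * d' powr \<theta>"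
  shows "y \<le> C * d powr \<theta>"
proof (cases "d = 0")
  case False
  then show ?thesis using assms by simp
next
  case True
  have "y \<le> e" if "0 < e" for e
  proof -
    have "y \<le> C * ((e / C) powr (1 / \<theta>)) powr \<theta>" using that assms(1) True by (intro assms(4)) auto
    also have "\<dots> = e" using that assms(1,2) by (simp add: powr_powr)
    finally show ?thesis .
  qed
  then have "y \<le> 0" by (rule field_le_epsilon[of y 0, simplified])
  then show ?thesis using True by simp
qed

theorem corollary2p4:
  fixes p :: real
    and \<mu> :: "'s::metric_space measure"
    and A :: "(int \<Rightarrow> 's) \<Rightarrow> real ^ 'm ^ 'm"
  assumes "p > 0"
    and "CARD('m) \<ge> 2"
    and "compact (UNIV :: 's set)"
    and "prob_space \<mu>" and "sets \<mu> = sets borel"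
    and "A \<in> Cp_space p \<mu>"
    and "quasi_irreducible \<mu> A"
    and "lyapunov1 \<mu> A > lyapunov2 \<mu> A"
  shows "\<exists>\<delta> > 0. \<exists>C > 0. \<exists>\<alpha>. 0 < \<alpha> \<and> \<alpha> \<le> 1 \<and>
    (\<forall>B \<in> Cp_space p \<mu>. \<forall>B' \<in> Cp_space p \<mu>.
       L1_dist \<mu> A B < ennreal \<delta> \<longrightarrow> L1_dist \<mu> A B' < ennreal \<delta> \<longrightarrow>
       \<bar>lyapunov1 \<mu> B - lyapunov1 \<mu> B'\<bar> \<le> C * enn2real (L1_dist \<mu> B B') powr \<alpha>)"
proof -
  interpret letters \<mu>
  proof (intro letters.intro sequence_space.intro product_prob_spaceI letters_axioms.intro)
    show "space \<mu> = UNIV" using sets_eq_imp_space_eq[OF assms(5)] by simp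
  qed (rule assms)
  let ?q = "min 1 p / real CARD('m)"
  note A = \<open>A \<in> Cp_space p \<mu>\<close>
  obtain K where K: "\<And>B. B \<in> Cp_space p \<mu> \<Longrightarrow> L1_dist \<mu> A B \<le> 1 \<Longrightarrow> bounded_cocycle \<mu> (letter B) ?q K"
    using bounded_cocycle_near[OF assms(2,1) A] by blast
  have "opnorm (0 :: real ^ 'm ^ 'm) = 0"
    using opnorm_leI[of "0 :: real ^ 'm ^ 'm" 0] opnorm_nonneg[of "0 :: real ^ 'm ^ 'm"] by simp
  then have "L1_dist \<mu> A A = 0" by (simp add: L1_dist_def)
  then have a: "bounded_cocycle \<mu> (letter A) ?q K" using K[OF A] by simp
  interpret a: bounded_cocycle \<mu> "letter A" ?q K by (rule a)
  have qi: "quasi_irreducible_cocycle \<mu> (letter A) ?q"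
    by (rule a.quasi_irreducible_cocycle_of_quasi_irreducible[OF A refl assms(7)])
  have gap: "a.area.rate < 2 * a.top.rate"
    using assms(8) Cp_spaceD(2)[OF A]
    by (simp add: a.lyapunov1_eq_rate(1) a.lyapunov2_eq_rate)
  obtain \<delta> N \<theta> \<rho> where \<delta>: "0 < \<delta>" and near: "\<And>b. bounded_cocycle \<mu> b ?q K \<Longrightarrow>
      (\<integral>\<^sup>+s. ennreal (opnorm (letter A s - b s)) \<partial>\<mu>) \<le> ennreal \<delta> \<Longrightarrow> contracting_cocycle \<mu> b ?q K N \<theta> \<rho>"
    using contracting_cocycle_near[OF qi a gap] by blast
  \<comment> \<open>The moments are bounded by \<open>K\<close> within distance one.\<close>
  define \<delta>' where "\<delta>' = min 1 \<delta>"
  have \<delta>': "0 < \<delta>'" "ennreal \<delta>' \<le> 1" "ennreal \<delta>' \<le> ennreal \<delta>"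
    using \<delta> ennreal_leI[of \<delta>' 1] ennreal_leI[of \<delta>' \<delta>] by (auto simp: \<delta>'_def)
  have contr: "contracting_cocycle \<mu> (letter B) ?q K N \<theta> \<rho>"
    if B: "B \<in> Cp_space p \<mu>" and d: "L1_dist \<mu> A B < ennreal \<delta>'" for B
  proof (rule near)
    have "L1_dist \<mu> A B \<le> 1" using d \<delta>'(2) by (intro order_trans[OF less_imp_le[OF d]])
    then show "bounded_cocycle \<mu> (letter B) ?q K" by (rule K[OF B])
    show "(\<integral>\<^sup>+s. ennreal (opnorm (letter A s - letter B s)) \<partial>\<mu>) \<le> ennreal \<delta>"
      using order_trans[OF less_imp_le[OF d] \<delta>'(3)] unfolding L1_dist_eq[OF A B] .
  qed
  interpret c: contracting_cocycle \<mu> "letter A" ?q K N \<theta> \<rho>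
    using contr[OF A] \<open>L1_dist \<mu> A A = 0\<close> \<delta>'(1) by simp
  define C where "C = (1 / \<theta> + c.gain_const) * (2 + K)"
  have "0 < C" using c.\<theta>_pos c.gain_const_nonneg a.K_ge_1 by (simp add: C_def add_pos_nonneg)
  moreover have "0 < \<theta>" "\<theta> \<le> 1" using c.\<theta>_pos c.\<theta>_le by auto
  moreover have "\<bar>lyapunov1 \<mu> B - lyapunov1 \<mu> B'\<bar> \<le> C * enn2real (L1_dist \<mu> B B') powr \<theta>"
    if B: "B \<in> Cp_space p \<mu>" "B' \<in> Cp_space p \<mu>"
      and d: "L1_dist \<mu> A B < ennreal \<delta>'" "L1_dist \<mu> A B' < ennreal \<delta>'" for B B'
  proof -
    interpret b: contracting_cocycle \<mu> "letter B" ?q K N \<theta> \<rho> by (rule contr[OF B(1) d(1)])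
    interpret b': contracting_cocycle \<mu> "letter B'" ?q K N \<theta> \<rho> by (rule contr[OF B(2) d(2)])
    have "L1_dist \<mu> B B' \<le> L1_dist \<mu> A B + L1_dist \<mu> A B'"
    proof -
      have tri: "opnorm (B \<omega> - B' \<omega>) \<le> opnorm (A \<omega> - B \<omega>) + opnorm (A \<omega> - B' \<omega>)" for \<omega>
        using opnorm_triangle[of "B \<omega> - A \<omega>" "A \<omega> - B' \<omega>"] by (simp add: opnorm_minus_commute[of "B \<omega>" "A \<omega>"])
      have "L1_dist \<mu> B B' \<le> (\<integral>\<^sup>+\<omega>. ennreal (opnorm (A \<omega> - B \<omega>)) + ennreal (opnorm (A \<omega> - B' \<omega>)) \<partial>bernoulli_measure \<mu>)"
        unfolding L1_dist_def using tri
        by (intro nn_integral_mono) (simp add: ennreal_plus[symmetric] opnorm_nonneg ennreal_leI del: ennreal_plus)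
      also have "\<dots> = L1_dist \<mu> A B + L1_dist \<mu> A B'"
        unfolding L1_dist_def
        using Cp_spaceD(1)[OF A] Cp_spaceD(1)[OF B(1)] Cp_spaceD(1)[OF B(2)] by (intro nn_integral_add) auto
      finally show ?thesis .
    qed
    also have "\<dots> < \<infinity>" using d by (auto simp: less_top[symmetric])
    finally have fin: "L1_dist \<mu> B B' < \<infinity>" .
    show ?thesis
    proof (rule le_powr_of_forall_greater[OF \<open>0 < C\<close> \<open>0 < \<theta>\<close> enn2real_nonneg])
      fix d' :: real assume d': "0 < d'" "enn2real (L1_dist \<mu> B B') \<le> d'"
      have "L1_dist \<mu> B B' \<le> ennreal d'"
        using fin d' by (metis ennreal_enn2real ennreal_leI infinity_ennreal_def)
      then have "(\<integral>\<^sup>+s. ennreal (opnorm (letter B s - letter B' s)) \<partial>\<mu>) \<le> ennreal d'"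
        by (simp add: L1_dist_eq[OF B])
      then have "\<bar>b.top.rate - b'.top.rate\<bar> \<le> (1 / \<theta> + c.gain_const) * ((2 + K) * d' powr \<theta>)"
        by (rule b.rate_compare[OF b'.contracting_cocycle_axioms d'(1)])
      then show "\<bar>lyapunov1 \<mu> B - lyapunov1 \<mu> B'\<bar> \<le> C * d' powr \<theta>"
        using b.lyapunov1_eq_rate(1)[OF Cp_spaceD(2)[OF B(1)] refl]
          b'.lyapunov1_eq_rate(1)[OF Cp_spaceD(2)[OF B(2)] refl]
        by (simp add: C_def mult.assoc)
    qed
  qed
  ultimately show ?thesis using \<delta>'(1) by blast
qed

end
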